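(* Let $(M,g)$ be a compact connected Riemannian manifold and let $G$ be a compact Lie group acting transitively on $(M,g)$ by isometries, with Lie algebra $\mathfrak{g}=\mathfrak{c}\oplus\mathfrak{g}_1\oplus\cdots\oplus\mathfrak{g}_k$, where $\mathfrak{c}$ is the center and the $\mathfrak{g}_i$ are the simple ideals of $\mathfrak{g}$; elements of $\mathfrak{g}$ are identified with Killing vector fields on $(M,g)$. Let $Z=Z_0+Z_1\in\mathfrak{g}$ be a Killing vector field of constant length on $(M,g)$, where $Z_0\in\mathfrak{c}$, $Z_1\in\mathfrak{g}_1$, $Z_1\ne0$. If $Z_1$ is a regular element of the Lie algebra $\mathfrak{g}_1$, then every $X\in\mathfrak{g}_1$ is a Killing vector field of constant length on $(M,g)$.
   Context: The group $G$ is a group of isometries of $(M,g)$ (so the action is effective). Each $U\in\mathfrak{g}$ is identified with the Killing vector field $\widetilde U(x)=\frac{d}{dt}\exp(tU)(x)\big|_{t=0}$ on $M$; the map $U\mapsto\widetilde U$ is linear and injective, and $[\widetilde U,\widetilde V]=-\widetilde{[U,V]}$. $U\in\mathfrak g$ has constant length if $x\mapsto g_x(\widetilde U(x),\widetilde U(x))$ is constant on $M$. An element $U$ of a Lie algebra $\mathfrak{h}$ is regular in $\mathfrak{h}$ if its centralizer in $\mathfrak{h}$ has minimal dimension among the centralizers of all elements of $\mathfrak{h}$. *)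

theory Defs
  imports
    "HOL-Analysis.Analysis"
    "HOL-Library.Function_Algebras"
    "HOL-Algebra.Group_Action"
begin

section \<open>The pointwise vector space structure on functions\<close>

text \<open>Tangent vectors and vector fields are real-valued operators below; this instance makes
  \<^const>\<open>subspace\<close> and \<^const>\<open>dim\<close> available for sets of them.\<close>

instantiation "fun" :: (type, scaleR) scaleR
begin
definition "c *\<^sub>R f = (\<lambda>x. c *\<^sub>R f x)"
instance ..
end

instance "fun" :: (type, real_vector) real_vector
  by standard (simp_all add: scaleR_fun_def fun_eq_iff scaleR_add_right scaleR_add_left)

section \<open>Smooth manifolds\<close>

fun k_smooth_on :: "nat \<Rightarrow> 'a::real_normed_vector set \<Rightarrow> ('a \<Rightarrow> 'b::real_normed_vector) \<Rightarrow> bool" where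
  "k_smooth_on 0 S f \<longleftrightarrow> continuous_on S f"
| "k_smooth_on (Suc k) S f \<longleftrightarrow> (\<forall>x\<in>S. f differentiable (at x)) \<and>
     (\<forall>v. k_smooth_on k S (\<lambda>x. frechet_derivative f (at x) v))"

text \<open>Only used for open \<open>S\<close>.\<close>

definition smooth_on :: "'a::real_normed_vector set \<Rightarrow> ('a \<Rightarrow> 'b::real_normed_vector) \<Rightarrow> bool" where
  "smooth_on S f \<longleftrightarrow> (\<forall>k. k_smooth_on k S f)"

text \<open>A manifold is a whole topological type with an atlas, which need not be maximal. A chart is
  its domain together with a coordinate map, whose values outside the domain are irrelevant.
  The class \<open>euclidean_space\<close> excludes dimension \<open>0\<close>.\<close>

type_synonym ('a, 'e) atlas = "('a set \<times> ('a \<Rightarrow> 'e)) set"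

definition smooth_atlas ::
    "('a::{t2_space,second_countable_topology}, 'e::euclidean_space) atlas \<Rightarrow> bool" where
  "smooth_atlas A \<longleftrightarrow>
     (\<Union>(U, \<phi>)\<in>A. U) = UNIV \<and>
     (\<forall>(U, \<phi>)\<in>A. open U \<and> open (\<phi> ` U) \<and> homeomorphism U (\<phi> ` U) \<phi> (inv_into U \<phi>)) \<and>
     (\<forall>(U, \<phi>)\<in>A. \<forall>(V, \<psi>)\<in>A. smooth_on (\<phi> ` (U \<inter> V)) (\<psi> \<circ> inv_into U \<phi>))"

definition euclidean_atlas :: "('e::euclidean_space, 'e) atlas" where
  "euclidean_atlas = {(UNIV, id)}"

definition prod_atlas :: "('a, 'd) atlas \<Rightarrow> ('b, 'e) atlas \<Rightarrow> ('a \<times> 'b, 'd \<times> 'e) atlas" where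
  "prod_atlas A B = {(U \<times> V, map_prod \<phi> \<psi>) | U \<phi> V \<psi>. (U, \<phi>) \<in> A \<and> (V, \<psi>) \<in> B}"

definition smooth_map ::
    "('a::topological_space, 'd::euclidean_space) atlas \<Rightarrow>
     ('b::topological_space, 'e::euclidean_space) atlas \<Rightarrow> ('a \<Rightarrow> 'b) \<Rightarrow> bool" where
  "smooth_map A B F \<longleftrightarrow> continuous_on UNIV F \<and>
     (\<forall>(U, \<phi>)\<in>A. \<forall>(V, \<psi>)\<in>B. smooth_on (\<phi> ` (U \<inter> F -` V)) (\<psi> \<circ> F \<circ> inv_into U \<phi>))"

definition diffeomorphism ::
    "('a::topological_space, 'd::euclidean_space) atlas \<Rightarrow>
     ('b::topological_space, 'e::euclidean_space) atlas \<Rightarrow> ('a \<Rightarrow> 'b) \<Rightarrow> bool" where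
  "diffeomorphism A B F \<longleftrightarrow> bij F \<and> smooth_map A B F \<and> smooth_map B A (inv_into UNIV F)"

abbreviation smooth_fun ::
    "('a::topological_space, 'e::euclidean_space) atlas \<Rightarrow> ('a \<Rightarrow> real) \<Rightarrow> bool" where
  "smooth_fun A \<equiv> smooth_map A (euclidean_atlas :: (real, real) atlas)"

section \<open>Tangent vectors and vector fields\<close>

text \<open>Tangent vectors at \<open>p\<close> are the derivations at \<open>p\<close> of the algebra of smooth functions. They are
  set to \<open>0\<close> on non-smooth functions, so that equality of tangent vectors is equality of operators.\<close>

type_synonym 'a tangent = "('a \<Rightarrow> real) \<Rightarrow> real"

definition tangent_space ::
    "('a::topological_space, 'e::euclidean_space) atlas \<Rightarrow> 'a \<Rightarrow> 'a tangent set" where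
  "tangent_space A p = {v.
     (\<forall>f h. smooth_fun A f \<longrightarrow> smooth_fun A h \<longrightarrow> v (\<lambda>x. f x + h x) = v f + v h) \<and>
     (\<forall>c f. smooth_fun A f \<longrightarrow> v (\<lambda>x. c * f x) = c * v f) \<and>
     (\<forall>f h. smooth_fun A f \<longrightarrow> smooth_fun A h \<longrightarrow> v (\<lambda>x. f x * h x) = v f * h p + f p * v h) \<and>
     (\<forall>f. \<not> smooth_fun A f \<longrightarrow> v f = 0)}"

text \<open>The differential of a map into a manifold with atlas \<open>B\<close>.\<close>

definition push_forward ::
    "('b::topological_space, 'e::euclidean_space) atlas \<Rightarrow> ('a \<Rightarrow> 'b) \<Rightarrow> 'a tangent \<Rightarrow> 'b tangent" where
  "push_forward B F v = (\<lambda>f. if smooth_fun B f then v (f \<circ> F) else 0)"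

definition velocity ::
    "('a::topological_space, 'e::euclidean_space) atlas \<Rightarrow> (real \<Rightarrow> 'a) \<Rightarrow> real \<Rightarrow> 'a tangent" where
  "velocity A \<gamma> t = (\<lambda>f. if smooth_fun A f then deriv (\<lambda>s. f (\<gamma> s)) t else 0)"

type_synonym 'a vfield = "'a \<Rightarrow> 'a tangent"

definition vector_field ::
    "('a::topological_space, 'e::euclidean_space) atlas \<Rightarrow> 'a vfield \<Rightarrow> bool" where
  "vector_field A X \<longleftrightarrow> (\<forall>p. X p \<in> tangent_space A p) \<and>
     (\<forall>f. smooth_fun A f \<longrightarrow> smooth_fun A (\<lambda>p. X p f))"

definition lie_bracket :: "'a vfield \<Rightarrow> 'a vfield \<Rightarrow> 'a vfield" where
  "lie_bracket X Y = (\<lambda>p f. X p (\<lambda>q. Y q f) - Y p (\<lambda>q. X q f))"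

definition integral_curve ::
    "('a::topological_space, 'e::euclidean_space) atlas \<Rightarrow> 'a vfield \<Rightarrow> (real \<Rightarrow> 'a) \<Rightarrow> bool" where
  "integral_curve A X \<gamma> \<longleftrightarrow>
     (\<forall>t f. smooth_fun A f \<longrightarrow> ((\<lambda>s. f (\<gamma> s)) has_real_derivative X (\<gamma> t) f) (at t))"

section \<open>Riemannian metrics and Killing fields\<close>

definition riemannian_metric ::
    "('a::topological_space, 'e::euclidean_space) atlas \<Rightarrow>
     ('a \<Rightarrow> 'a tangent \<Rightarrow> 'a tangent \<Rightarrow> real) \<Rightarrow> bool" where
  "riemannian_metric A g \<longleftrightarrow>
     (\<forall>p. \<forall>u\<in>tangent_space A p. \<forall>v\<in>tangent_space A p.
        (\<forall>w\<in>tangent_space A p. g p (u + v) w = g p u w + g p v w) \<and>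
        (\<forall>c. g p (c *\<^sub>R u) v = c * g p u v) \<and>
        g p u v = g p v u \<and>
        (u \<noteq> 0 \<longrightarrow> g p u u > 0)) \<and>
     (\<forall>X Y. vector_field A X \<longrightarrow> vector_field A Y \<longrightarrow> smooth_fun A (\<lambda>p. g p (X p) (Y p)))"

definition isometry ::
    "('a::topological_space, 'e::euclidean_space) atlas \<Rightarrow>
     ('a \<Rightarrow> 'a tangent \<Rightarrow> 'a tangent \<Rightarrow> real) \<Rightarrow> ('a \<Rightarrow> 'a) \<Rightarrow> bool" where
  "isometry A g F \<longleftrightarrow> diffeomorphism A A F \<and>
     (\<forall>p. \<forall>u\<in>tangent_space A p. \<forall>v\<in>tangent_space A p.
        g (F p) (push_forward A F u) (push_forward A F v) = g p u v)"

text \<open>A Killing field is a vector field whose flow consists of isometries. The flow is required to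
  be global, which is no restriction on a compact manifold.\<close>

definition killing_field ::
    "('a::topological_space, 'e::euclidean_space) atlas \<Rightarrow>
     ('a \<Rightarrow> 'a tangent \<Rightarrow> 'a tangent \<Rightarrow> real) \<Rightarrow> 'a vfield \<Rightarrow> bool" where
  "killing_field A g X \<longleftrightarrow> vector_field A X \<and>
     (\<exists>\<theta>. (\<forall>p. integral_curve A X (\<lambda>t. \<theta> t p) \<and> \<theta> 0 p = p) \<and> (\<forall>t. isometry A g (\<theta> t)))"

definition constant_length ::
    "('a \<Rightarrow> 'a tangent \<Rightarrow> 'a tangent \<Rightarrow> real) \<Rightarrow> 'a vfield \<Rightarrow> bool" where
  "constant_length g X \<longleftrightarrow> (\<lambda>p. g p (X p) (X p)) constant_on UNIV"

section \<open>Lie groups and their actions\<close>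

definition lie_group ::
    "('a::{t2_space,second_countable_topology}, 'e::euclidean_space) atlas \<Rightarrow> 'a monoid \<Rightarrow> bool" where
  "lie_group A G \<longleftrightarrow> smooth_atlas A \<and> group G \<and> carrier G = UNIV \<and>
     smooth_map (prod_atlas A A) A (\<lambda>(a, b). a \<otimes>\<^bsub>G\<^esub> b) \<and>
     smooth_map A A (\<lambda>a. inv\<^bsub>G\<^esub> a)"

text \<open>The Lie algebra consists of the left-invariant vector fields, with bracket
  \<^const>\<open>lie_bracket\<close>.\<close>

definition lie_algebra ::
    "('a::topological_space, 'e::euclidean_space) atlas \<Rightarrow> 'a monoid \<Rightarrow> 'a vfield set" where
  "lie_algebra A G = {X. vector_field A X \<and>
     (\<forall>a b. push_forward A (\<lambda>c. a \<otimes>\<^bsub>G\<^esub> c) (X b) = X (a \<otimes>\<^bsub>G\<^esub> b))}"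

definition lie_exp ::
    "('a::topological_space, 'e::euclidean_space) atlas \<Rightarrow> 'a monoid \<Rightarrow> 'a vfield \<Rightarrow> 'a" where
  "lie_exp A G X = (THE \<gamma>. integral_curve A X \<gamma> \<and> \<gamma> 0 = \<one>\<^bsub>G\<^esub>) 1"

definition isometric_action ::
    "('g::topological_space, 'd::euclidean_space) atlas \<Rightarrow> 'g monoid \<Rightarrow>
     ('m::topological_space, 'e::euclidean_space) atlas \<Rightarrow>
     ('m \<Rightarrow> 'm tangent \<Rightarrow> 'm tangent \<Rightarrow> real) \<Rightarrow> ('g \<Rightarrow> 'm \<Rightarrow> 'm) \<Rightarrow> bool" where
  "isometric_action B G A g \<alpha> \<longleftrightarrow> group_action G UNIV \<alpha> \<and>
     smooth_map (prod_atlas B A) A (\<lambda>(a, x). \<alpha> a x) \<and> (\<forall>a. isometry A g (\<alpha> a))"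

definition fundamental_field ::
    "('g::topological_space, 'd::euclidean_space) atlas \<Rightarrow> 'g monoid \<Rightarrow>
     ('m::topological_space, 'e::euclidean_space) atlas \<Rightarrow>
     ('g \<Rightarrow> 'm \<Rightarrow> 'm) \<Rightarrow> 'g vfield \<Rightarrow> 'm vfield" where
  "fundamental_field B G A \<alpha> U = (\<lambda>x. velocity A (\<lambda>t. \<alpha> (lie_exp B G (t *\<^sub>R U)) x) 0)"

section \<open>Lie algebras of vector fields\<close>

text \<open>Here \<open>L\<close> is the underlying subspace of a Lie algebra with bracket
  \<^const>\<open>lie_bracket\<close>.\<close>

definition lie_ideal :: "'a vfield set \<Rightarrow> 'a vfield set \<Rightarrow> bool" where
  "lie_ideal L I \<longleftrightarrow> subspace I \<and> I \<subseteq> L \<and> (\<forall>X\<in>L. \<forall>Y\<in>I. lie_bracket X Y \<in> I)"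

definition simple_lie_algebra :: "'a vfield set \<Rightarrow> bool" where
  "simple_lie_algebra L \<longleftrightarrow> (\<exists>X\<in>L. \<exists>Y\<in>L. lie_bracket X Y \<noteq> 0) \<and>
     (\<forall>I. lie_ideal L I \<longrightarrow> I = {0} \<or> I = L)"

definition lie_centralizer :: "'a vfield set \<Rightarrow> 'a vfield \<Rightarrow> 'a vfield set" where
  "lie_centralizer L U = {X \<in> L. lie_bracket U X = 0}"

definition lie_center :: "'a vfield set \<Rightarrow> 'a vfield set" where
  "lie_center L = {X \<in> L. \<forall>Y\<in>L. lie_bracket X Y = 0}"

definition regular_in :: "'a vfield set \<Rightarrow> 'a vfield \<Rightarrow> bool" where
  "regular_in L U \<longleftrightarrow> U \<in> L \<and>
     (\<forall>V\<in>L. dim (lie_centralizer L U) \<le> dim (lie_centralizer L V))"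

definition direct_sum :: "'v::real_vector set \<Rightarrow> 'i set \<Rightarrow> ('i \<Rightarrow> 'v set) \<Rightarrow> bool" where
  "direct_sum V I W \<longleftrightarrow> finite I \<and> (\<forall>i\<in>I. subspace (W i)) \<and>
     V = {\<Sum>i\<in>I. w i | w. \<forall>i\<in>I. w i \<in> W i} \<and>
     (\<forall>w. (\<forall>i\<in>I. w i \<in> W i) \<longrightarrow> (\<Sum>i\<in>I. w i) = 0 \<longrightarrow> (\<forall>i\<in>I. w i = 0))"

end

theory Submission
  imports Defs
begin

text \<open>
Fix a base point \<open>o\<close> and pull the metric back to the forms \<open>B\<^sub>a(U, V) = g\<^sub>o(Ad(a)U, Ad(a)V)\<close> on the
Lie algebra. A field \<open>U\<close> has constant length iff \<open>B\<^sub>a(U, U)\<close> does not depend on \<open>a\<close>. Differentiating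
this three times for \<open>Z\<close> gives polynomial identities between \<open>B = B\<^sub>a\<close> and the bracket. With respect
to an invariant inner product, let \<open>T\<close> be the centralizer of \<open>Z\<^sub>1\<close> and \<open>t\<close> its intersection with the
simple ideal, which is abelian because \<open>Z\<^sub>1\<close> is regular. The identities, combined by a trace argument
that replaces the root decomposition, force \<open>B\<close> to vanish between \<open>t\<close> and the complement of \<open>T\<close>,
which says that \<open>B(U, U)\<close> is infinitesimally constant for every \<open>U\<close> in \<open>t\<close>. Finally every element of
the ideal is conjugate into \<open>t\<close>.
\<close>

section \<open>Calculus of smooth maps\<close>

text \<open>Why three derivatives: the first two give \<open>B(Dx, z) = 0\<close> and make
  \<open>D = ad z1\<close> skew for \<open>B\<close> on the range of \<open>D\<close>, whereas
  \<open>B\<close> between a general element of \<open>T\<close> and that range first enters at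
  third order. It enters there together with the unknown values of \<open>B\<close> on the range of
  \<open>D\<close>. Letting the derivation \<open>D\<close> act on all three arguments of the
  identity cancels exactly these, and what remains is symmetric in three vectors. The trace argument
  rests on the real operators \<open>S u = ad u o D\<close> for \<open>u\<close> in
  \<open>t\<close>. They are symmetric, regularity makes them commute, and their trace form is
  positive definite on \<open>t\<close> because a simple ideal has no center. The analytic half
  exists because Lie algebra elements are given as operators on functions. Hadamard's lemma
  identifies the derivations at a point with coordinate vectors, and exponentials, the adjoint
  action and the bracket are then built on the model space. There are two forms on it:
  \<open>B\<close> comes from the metric and may be degenerate, while the invariant inner product
  only serves to make \<open>ad\<close> skew. The latter is moved to the standard product of the
  Euclidean type.\<close>

lemma k_smooth_on_cong:
  assumes "open S" "\<And>x. x \<in> S \<Longrightarrow> f x = g x" "k_smooth_on k S f"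
  shows "k_smooth_on k S g"
  using assms(2,3)
proof (induction k arbitrary: f g)
  case 0
  then show ?case by (auto cong: continuous_on_cong)
next
  case (Suc k)
  have der: "(g has_derivative frechet_derivative f (at x)) (at x)" if "x \<in> S" for x
    using Suc.prems that assms(1)
    by (auto simp: frechet_derivative_works intro: has_derivative_transform_within_open[of f])
  then have eq: "frechet_derivative f (at x) v = frechet_derivative g (at x) v" if "x \<in> S" for x v
    using frechet_derivative_at[OF der[OF that]] by simp
  show ?case
    using Suc.prems(2) der Suc.IH[OF eq] by (auto simp: differentiable_def)
qed

lemma k_smooth_on_SucI:
  assumes "open S" "\<And>x. x \<in> S \<Longrightarrow> (f has_derivative f' x) (at x)"
    and "\<And>v. k_smooth_on k S (\<lambda>x. f' x v)"
  shows "k_smooth_on (Suc k) S f"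
proof -
  have eq: "f' x v = frechet_derivative f (at x) v" if "x \<in> S" for x v
    using frechet_derivative_at[OF assms(2)[OF that]] by simp
  show ?thesis
    using assms(2) k_smooth_on_cong[OF assms(1) eq assms(3)] by (auto simp: differentiable_def)
qed

lemma k_smooth_on_SucD:
  assumes "k_smooth_on (Suc k) S f" "x \<in> S"
  shows "(f has_derivative frechet_derivative f (at x)) (at x)"
  using assms by (simp add: frechet_derivative_works)

lemma k_smooth_on_subset: "k_smooth_on k S f \<Longrightarrow> T \<subseteq> S \<Longrightarrow> k_smooth_on k T f"
proof (induction k arbitrary: f)
  case 0
  then show ?case using continuous_on_subset by auto
next
  case (Suc k)
  then show ?case by (simp add: subset_iff)
qed

lemma k_smooth_on_Suc_imp: "k_smooth_on (Suc k) S f \<Longrightarrow> k_smooth_on k S f"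
proof (induction k arbitrary: f)
  case 0
  then show ?case
    by (simp add: continuous_at_imp_continuous_on differentiable_imp_continuous_within)
next
  case (Suc k)
  then show ?case by simp
qed

lemma k_smooth_on_local:
  assumes "\<And>x. x \<in> S \<Longrightarrow> \<exists>U. open U \<and> x \<in> U \<and> k_smooth_on k (U \<inter> S) f" "open S"
  shows "k_smooth_on k S f"
  using assms(1)
proof (induction k arbitrary: f)
  case 0
  have "continuous (at x) f" if "x \<in> S" for x
  proof -
    obtain U where "open U" "x \<in> U" "continuous_on (U \<inter> S) f" using 0 \<open>x \<in> S\<close> by auto
    then show ?thesis using that assms(2) continuous_on_eq_continuous_at[of "U \<inter> S" f] by auto
  qed
  then show ?case by (simp add: continuous_at_imp_continuous_on)
next
  case (Suc k)
  have "f differentiable at x" if x: "x \<in> S" for x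
  proof -
    obtain U where "open U" "x \<in> U" "k_smooth_on (Suc k) (U \<inter> S) f" using Suc.prems[OF x] by blast
    then show ?thesis using x by simp
  qed
  moreover have "k_smooth_on k S (\<lambda>x. frechet_derivative f (at x) v)" for v
  proof (rule Suc.IH)
    fix x assume "x \<in> S"
    then obtain U where "open U" "x \<in> U" "k_smooth_on (Suc k) (U \<inter> S) f" using Suc.prems by blast
    then show "\<exists>U. open U \<and> x \<in> U \<and> k_smooth_on k (U \<inter> S) (\<lambda>x. frechet_derivative f (at x) v)"
      by auto
  qed
  ultimately show ?case by simp
qed

lemma k_smooth_on_const: "open S \<Longrightarrow> k_smooth_on k S (\<lambda>x. c)"
proof (induction k arbitrary: c)
  case (Suc k)
  then show ?case by (intro k_smooth_on_SucI[where f'="\<lambda>x v. 0"]) (auto intro: derivative_intros)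
qed auto

lemma k_smooth_on_bounded_linear:
  assumes "bounded_linear L" "open S" shows "k_smooth_on k S L"
proof (cases k)
  case 0
  then show ?thesis using assms by (simp add: linear_continuous_on)
next
  case (Suc m)
  show ?thesis unfolding Suc
    by (rule k_smooth_on_SucI[where f'="\<lambda>x. L"])
      (use assms in \<open>auto intro: bounded_linear_imp_has_derivative k_smooth_on_const\<close>)
qed

lemma k_smooth_on_linear_compose:
  assumes "bounded_linear L" "open S" "k_smooth_on k S f"
  shows "k_smooth_on k S (\<lambda>x. L (f x))"
  using assms(3)
proof (induction k arbitrary: f)
  case 0
  then show ?case using assms(1) by (auto intro: bounded_linear.continuous_on)
next
  case (Suc k)
  show ?case
    by (rule k_smooth_on_SucI[OF assms(2)
          bounded_linear.has_derivative[OF assms(1) k_smooth_on_SucD[OF Suc.prems]]])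
      (use Suc in auto)
qed

lemma k_smooth_on_add:
  assumes "open S" "k_smooth_on k S f" "k_smooth_on k S g"
  shows "k_smooth_on k S (\<lambda>x. f x + g x)"
  using assms(2,3)
proof (induction k arbitrary: f g)
  case 0
  then show ?case by (auto intro: continuous_intros)
next
  case (Suc k)
  show ?case
    by (rule k_smooth_on_SucI[where
          f'="\<lambda>x v. frechet_derivative f (at x) v + frechet_derivative g (at x) v"])
      (use Suc assms in \<open>auto intro!: has_derivative_add simp: frechet_derivative_works[symmetric]\<close>)
qed

lemma k_smooth_on_bilinear:
  assumes "bounded_bilinear P" "open S" "k_smooth_on k S f" "k_smooth_on k S g"
  shows "k_smooth_on k S (\<lambda>x. P (f x) (g x))"
  using assms(3,4)
proof (induction k arbitrary: f g)
  case 0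
  then show ?case using assms(1) by (auto intro: bounded_bilinear.continuous_on)
next
  case (Suc k)
  show ?case
  proof (rule k_smooth_on_SucI[OF assms(2)])
    show "((\<lambda>x. P (f x) (g x)) has_derivative
        (\<lambda>v. P (f x) (frechet_derivative g (at x) v) + P (frechet_derivative f (at x) v) (g x))) (at x)"
      if "x \<in> S" for x
      by (rule bounded_bilinear.FDERIV[OF assms(1)])
        (use Suc.prems that k_smooth_on_SucD in blast)+
    show "k_smooth_on k S (\<lambda>x. P (f x) (frechet_derivative g (at x) v) +
        P (frechet_derivative f (at x) v) (g x))" for v
      using Suc.prems k_smooth_on_Suc_imp[OF Suc.prems(1)] k_smooth_on_Suc_imp[OF Suc.prems(2)]
      by (intro k_smooth_on_add assms(2) Suc.IH) auto
  qed
qed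

lemma k_smooth_on_sum:
  assumes "open S" "finite I" "\<And>i. i \<in> I \<Longrightarrow> k_smooth_on k S (f i)"
  shows "k_smooth_on k S (\<lambda>x. \<Sum>i\<in>I. f i x)"
  using assms(2,3)
  by (induction I rule: finite_induct) (auto intro!: k_smooth_on_const k_smooth_on_add assms(1))

lemma linear_euclidean_expand:
  fixes L :: "'a::euclidean_space \<Rightarrow> 'b::real_vector"
  assumes "linear L"
  shows "L x = (\<Sum>b\<in>Basis. (x \<bullet> b) *\<^sub>R L b)"
proof -
  have "L x = L (\<Sum>b\<in>Basis. (x \<bullet> b) *\<^sub>R b)" by (simp add: euclidean_representation)
  also have "\<dots> = (\<Sum>b\<in>Basis. (x \<bullet> b) *\<^sub>R L b)" using assms by (simp add: linear_sum linear_scale)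
  finally show ?thesis .
qed

text \<open>The derivative \<open>f'(g x)(g' x v)\<close> applies a varying linear map to a varying
  vector, so the induction hypothesis does not fit it. Expanding the inner vector in
  \<open>Basis\<close> gives a finite sum of scalar functions times \<open>f'(g x) b\<close>, each
  of which is covered; this is the reason for a Euclidean middle space.\<close>

lemma k_smooth_on_compose:
  fixes g :: "'a::real_normed_vector \<Rightarrow> 'b::euclidean_space" and f :: "'b \<Rightarrow> 'c::real_normed_vector"
  assumes "open S" "open T" "k_smooth_on k S g" "k_smooth_on k T f" "g ` S \<subseteq> T"
  shows "k_smooth_on k S (\<lambda>x. f (g x))"
  using assms(3-5)
proof (induction k arbitrary: f g)
  case 0
  then show ?case by (auto intro: continuous_on_compose2)
next
  case (Suc k)
  let ?g = "\<lambda>x. frechet_derivative g (at x)" and ?f = "\<lambda>x. frechet_derivative f (at x)"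
  have g: "(g has_derivative ?g x) (at x)" if "x \<in> S" for x
    using Suc.prems that k_smooth_on_SucD by blast
  have f: "(f has_derivative ?f (g x)) (at (g x))" if "x \<in> S" for x
    using Suc.prems that k_smooth_on_SucD by blast
  have expand: "(\<Sum>b\<in>Basis. (?g x v \<bullet> b) *\<^sub>R ?f (g x) b) = ?f (g x) (?g x v)" if "x \<in> S" for x v
    using linear_euclidean_expand[OF has_derivative_linear[OF f[OF that]]] by metis
  have sm: "k_smooth_on k S (\<lambda>x. ?f (g x) (?g x v))" for v
  proof (rule k_smooth_on_cong[OF assms(1) expand])
    show "k_smooth_on k S (\<lambda>x. \<Sum>b\<in>Basis. (?g x v \<bullet> b) *\<^sub>R ?f (g x) b)"
    proof (intro k_smooth_on_sum assms(1) k_smooth_on_bilinear[OF bounded_bilinear_scaleR]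
        k_smooth_on_linear_compose[OF bounded_linear_inner_left])
      show "k_smooth_on k S (\<lambda>x. ?f (g x) b)" for b
        using Suc.prems k_smooth_on_Suc_imp[OF Suc.prems(1)] by (intro Suc.IH) auto
    qed (use Suc.prems in auto)
  qed
  show ?case
    by (rule k_smooth_on_SucI[OF assms(1) _ sm])
      (use has_derivative_compose[OF g f] in auto)
qed

lemma smooth_on_cong: "open S \<Longrightarrow> (\<And>x. x \<in> S \<Longrightarrow> f x = g x) \<Longrightarrow> smooth_on S f \<Longrightarrow> smooth_on S g"
  unfolding smooth_on_def using k_smooth_on_cong by blast

lemma smooth_on_subset: "smooth_on S f \<Longrightarrow> T \<subseteq> S \<Longrightarrow> smooth_on T f"
  unfolding smooth_on_def using k_smooth_on_subset by blast

lemma smooth_on_local: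
  assumes "\<And>x. x \<in> S \<Longrightarrow> \<exists>U. open U \<and> x \<in> U \<and> smooth_on (U \<inter> S) f" "open S"
  shows "smooth_on S f"
  unfolding smooth_on_def
proof
  fix k show "k_smooth_on k S f"
    by (rule k_smooth_on_local[OF _ assms(2)]) (meson assms(1) smooth_on_def)
qed

lemma smooth_on_const: "open S \<Longrightarrow> smooth_on S (\<lambda>x. c)"
  unfolding smooth_on_def using k_smooth_on_const by blast

lemma smooth_on_bounded_linear: "bounded_linear L \<Longrightarrow> open S \<Longrightarrow> smooth_on S L"
  unfolding smooth_on_def using k_smooth_on_bounded_linear by blast

lemma smooth_on_linear_compose:
  "bounded_linear L \<Longrightarrow> open S \<Longrightarrow> smooth_on S f \<Longrightarrow> smooth_on S (\<lambda>x. L (f x))"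
  unfolding smooth_on_def using k_smooth_on_linear_compose by blast

lemma smooth_on_add:
  "open S \<Longrightarrow> smooth_on S f \<Longrightarrow> smooth_on S g \<Longrightarrow> smooth_on S (\<lambda>x. f x + g x)"
  unfolding smooth_on_def using k_smooth_on_add by blast

lemma smooth_on_bilinear:
  "bounded_bilinear P \<Longrightarrow> open S \<Longrightarrow> smooth_on S f \<Longrightarrow> smooth_on S g \<Longrightarrow> smooth_on S (\<lambda>x. P (f x) (g x))"
  unfolding smooth_on_def using k_smooth_on_bilinear by blast

lemmas smooth_on_mult = smooth_on_bilinear[OF bounded_bilinear_mult]
lemmas smooth_on_scaleR = smooth_on_bilinear[OF bounded_bilinear_scaleR]

lemma smooth_on_sum:
  assumes "open S" "finite I" "\<And>i. i \<in> I \<Longrightarrow> smooth_on S (f i)"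
  shows "smooth_on S (\<lambda>x. \<Sum>i\<in>I. f i x)"
  unfolding smooth_on_def
proof
  fix k show "k_smooth_on k S (\<lambda>x. \<Sum>i\<in>I. f i x)"
    by (rule k_smooth_on_sum[OF assms(1,2)]) (use assms(3) in \<open>simp add: smooth_on_def\<close>)
qed

lemma smooth_on_compose:
  fixes g :: "'a::real_normed_vector \<Rightarrow> 'b::euclidean_space" and f :: "'b \<Rightarrow> 'c::real_normed_vector"
  shows "open S \<Longrightarrow> open T \<Longrightarrow> smooth_on S g \<Longrightarrow> smooth_on T f \<Longrightarrow> g ` S \<subseteq> T \<Longrightarrow>
    smooth_on S (\<lambda>x. f (g x))"
  unfolding smooth_on_def using k_smooth_on_compose by blast

lemma smooth_on_has_derivative:
  assumes "smooth_on S f" "x \<in> S"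
  shows "(f has_derivative frechet_derivative f (at x)) (at x)"
  using assms k_smooth_on_SucD[of 0 S f x] unfolding smooth_on_def by blast

lemma smooth_on_frechet_derivative:
  assumes "smooth_on S f" shows "smooth_on S (\<lambda>x. frechet_derivative f (at x) v)"
  unfolding smooth_on_def
proof
  fix k show "k_smooth_on k S (\<lambda>x. frechet_derivative f (at x) v)"
    using assms k_smooth_on.simps(2)[of k S f] unfolding smooth_on_def by blast
qed

lemma smooth_on_continuous_on: "smooth_on S f \<Longrightarrow> continuous_on S f"
  unfolding smooth_on_def using k_smooth_on.simps(1) by blast

lemma smooth_on_Pair:
  assumes "open S" "smooth_on S f" "smooth_on S g"
  shows "smooth_on S (\<lambda>x. (f x, g x))"
proof -
  have "smooth_on S (\<lambda>x. (f x, 0) + (0, g x))"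
    by (rule smooth_on_add[OF assms(1)
          smooth_on_linear_compose[OF bounded_linear_Pair[OF bounded_linear_ident bounded_linear_zero] assms(1,2)]
          smooth_on_linear_compose[OF bounded_linear_Pair[OF bounded_linear_zero bounded_linear_ident] assms(1,3)]])
  then show ?thesis by simp
qed

text \<open>The derivative of \<open>1/f\<close> contains only \<open>1/f\<close> and a derivative
  of \<open>f\<close>, so the order of smoothness of \<open>1/f\<close> climbs one step at a
  time.\<close>

lemma smooth_on_inverse:
  fixes f :: "'a::real_normed_vector \<Rightarrow> real"
  assumes "open S" "smooth_on S f" "\<And>x. x \<in> S \<Longrightarrow> f x \<noteq> 0"
  shows "smooth_on S (\<lambda>x. inverse (f x))"
proof -
  have "k_smooth_on k S (\<lambda>x. inverse (f x))" for k
  proof (induction k)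
    case 0
    then show ?case using assms smooth_on_continuous_on by (auto intro: continuous_intros)
  next
    case (Suc k)
    have f: "k_smooth_on k S (\<lambda>x. frechet_derivative f (at x) v)" for v
      using smooth_on_frechet_derivative[OF assms(2)] by (auto simp: smooth_on_def)
    show ?case
    proof (rule k_smooth_on_SucI[where
          f'="\<lambda>x v. (inverse (f x) * frechet_derivative f (at x) v) * (- 1 * inverse (f x))"])
      fix x assume "x \<in> S"
      then show "((\<lambda>x. inverse (f x)) has_derivative
          (\<lambda>v. (inverse (f x) * frechet_derivative f (at x) v) * (- 1 * inverse (f x)))) (at x)"
        by (intro has_derivative_eq_rhs[OF Deriv.has_derivative_inverse[OF assms(3)
                smooth_on_has_derivative[OF assms(2)]]]) auto
    next
      fix v
      show "k_smooth_on k S (\<lambda>x. (inverse (f x) * frechet_derivative f (at x) v) * (- 1 * inverse (f x)))"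
        by (rule k_smooth_on_bilinear[OF bounded_bilinear_mult assms(1)
              k_smooth_on_bilinear[OF bounded_bilinear_mult assms(1) Suc.IH f]
              k_smooth_on_bilinear[OF bounded_bilinear_mult assms(1) k_smooth_on_const[OF assms(1)] Suc.IH]])
    qed (rule assms)
  qed
  then show ?thesis by (simp add: smooth_on_def)
qed

section \<open>Symmetry of second derivatives\<close>

lemma second_difference_mvt:
  fixes f :: "'a::real_normed_vector \<Rightarrow> real"
  assumes "smooth_on S f" "0 < h"
    and S: "\<And>s t. 0 \<le> s \<Longrightarrow> s \<le> h \<Longrightarrow> 0 \<le> t \<Longrightarrow> t \<le> h \<Longrightarrow> x + s *\<^sub>R u + t *\<^sub>R v \<in> S"
  obtains s t where "0 < s" "s < h" "0 < t" "t < h"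
    and "f (x + h *\<^sub>R u + h *\<^sub>R v) - f (x + h *\<^sub>R u) - f (x + h *\<^sub>R v) + f x =
      h * (h * frechet_derivative (\<lambda>y. frechet_derivative f (at y) u) (at (x + s *\<^sub>R u + t *\<^sub>R v)) v)"
proof -
  let ?D = "\<lambda>y. frechet_derivative f (at y)"
  let ?g = "\<lambda>s. f (x + s *\<^sub>R u + h *\<^sub>R v) - f (x + s *\<^sub>R u)"
  have line: "((\<lambda>s. F (z + s *\<^sub>R w)) has_real_derivative F' w) (at s)"
    if "(F has_derivative F') (at (z + s *\<^sub>R w))" for F :: "'a \<Rightarrow> real" and F' z w s
  proof -
    have "((\<lambda>s. z + s *\<^sub>R w) has_derivative (\<lambda>d. d *\<^sub>R w)) (at s)"
      by (auto intro!: derivative_eq_intros)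
    from has_derivative_compose[OF this that]
    have "((\<lambda>s. F (z + s *\<^sub>R w)) has_derivative (\<lambda>d. F' (d *\<^sub>R w))) (at s)" .
    moreover have "(\<lambda>d. F' (d *\<^sub>R w)) = (*) (F' w)"
      using linear_scale[OF has_derivative_linear[OF that]] by (auto simp: fun_eq_iff)
    ultimately show ?thesis by (simp add: has_field_derivative_def)
  qed
  have 1: "(?g has_real_derivative ?D (x + s *\<^sub>R u + h *\<^sub>R v) u - ?D (x + s *\<^sub>R u) u) (at s)"
    if "0 \<le> s" "s \<le> h" for s
  proof (rule DERIV_diff)
    have "x + h *\<^sub>R v + s *\<^sub>R u \<in> S" using S[of s h] that assms(2) by (simp add: algebra_simps)
    from line[OF smooth_on_has_derivative[OF assms(1) this]]
    show "((\<lambda>s. f (x + s *\<^sub>R u + h *\<^sub>R v)) has_real_derivative ?D (x + s *\<^sub>R u + h *\<^sub>R v) u) (at s)"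
      by (simp add: algebra_simps)
    have "x + s *\<^sub>R u \<in> S" using S[of s 0] that assms(2) by simp
    from line[OF smooth_on_has_derivative[OF assms(1) this]]
    show "((\<lambda>s. f (x + s *\<^sub>R u)) has_real_derivative ?D (x + s *\<^sub>R u) u) (at s)" .
  qed
  obtain s where s: "0 < s" "s < h"
    "?g h - ?g 0 = (h - 0) * (?D (x + s *\<^sub>R u + h *\<^sub>R v) u - ?D (x + s *\<^sub>R u) u)"
    using MVT2[of 0 h ?g, OF assms(2) 1] by blast
  have 2: "((\<lambda>t. ?D (x + s *\<^sub>R u + t *\<^sub>R v) u) has_real_derivative
      frechet_derivative (\<lambda>y. ?D y u) (at (x + s *\<^sub>R u + t *\<^sub>R v)) v) (at t)" if "0 \<le> t" "t \<le> h" for t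
    by (rule line, rule smooth_on_has_derivative[OF smooth_on_frechet_derivative[OF assms(1)]])
      (use S s that in simp)
  obtain t where t: "0 < t" "t < h"
    "?D (x + s *\<^sub>R u + h *\<^sub>R v) u - ?D (x + s *\<^sub>R u + 0 *\<^sub>R v) u =
      (h - 0) * frechet_derivative (\<lambda>y. ?D y u) (at (x + s *\<^sub>R u + t *\<^sub>R v)) v"
    using MVT2[of 0 h "\<lambda>t. ?D (x + s *\<^sub>R u + t *\<^sub>R v) u", OF assms(2) 2] by blast
  show ?thesis by (rule that[OF s(1,2) t(1,2)]) (use s(3) t(3) in \<open>simp add: algebra_simps\<close>)
qed

text \<open>The second difference of \<open>f\<close> over a small parallelogram does not depend on
  the order of \<open>u\<close> and \<open>v\<close>. In either order it equals \<open>h * h\<close>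
  times a mixed derivative at a nearby point, and continuity of the mixed derivatives compares them
  at \<open>x\<close>.\<close>

lemma second_derivative_symmetric:
  fixes f :: "'a::real_normed_vector \<Rightarrow> real"
  assumes "open S" "smooth_on S f" "x \<in> S"
  shows "frechet_derivative (\<lambda>y. frechet_derivative f (at y) u) (at x) v =
    frechet_derivative (\<lambda>y. frechet_derivative f (at y) v) (at x) u"
proof -
  define A where "A u v y = frechet_derivative (\<lambda>y. frechet_derivative f (at y) u) (at y) v" for u v y
  have cont: "isCont (A u v) x" for u v
    using smooth_on_continuous_on[OF smooth_on_frechet_derivative[OF smooth_on_frechet_derivative[OF assms(2)]]]
      assms(1,3) unfolding A_def by (simp add: continuous_on_eq_continuous_at)
  have "\<bar>A u v x - A v u x\<bar> < 2 * e" if "e > 0" for e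
  proof -
    obtain d1 where d1: "d1 > 0" "\<And>y. dist y x < d1 \<Longrightarrow> dist (A u v y) (A u v x) < e"
      using cont[of u v] \<open>e > 0\<close> unfolding continuous_at_eps_delta by metis
    obtain d2 where d2: "d2 > 0" "\<And>y. dist y x < d2 \<Longrightarrow> dist (A v u y) (A v u x) < e"
      using cont[of v u] \<open>e > 0\<close> unfolding continuous_at_eps_delta by metis
    obtain d3 where d3: "d3 > 0" "ball x d3 \<subseteq> S" using assms(1,3) open_contains_ball by blast
    define d where "d = min d1 (min d2 d3)"
    \<comment> \<open>The \<open>+ 1\<close> keeps \<open>N\<close> positive when \<open>u\<close>
      and \<open>v\<close> vanish; with \<open>h * N = d / 2\<close> the whole parallelogram stays
      within distance \<open>d\<close> of \<open>x\<close>.\<close>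
    define N where "N = norm u + norm v + 1"
    define h where "h = d / (2 * N)"
    have pos: "N > 0" unfolding N_def by (smt (verit) norm_ge_zero)
    have h: "h > 0" using pos d1 d2 d3 unfolding h_def d_def by simp
    have hd: "h * N = d / 2" using pos by (simp add: h_def)
    have d_pos: "d > 0" using d1 d2 d3 unfolding d_def by simp
    have near: "dist (x + s *\<^sub>R u' + t *\<^sub>R v') x < d"
      if "0 \<le> s" "s \<le> h" "0 \<le> t" "t \<le> h" "norm u' + norm v' = norm u + norm v" for s t u' v'
    proof -
      have "norm (s *\<^sub>R u' + t *\<^sub>R v') \<le> s * norm u' + t * norm v'"
        using norm_triangle_ineq[of "s *\<^sub>R u'" "t *\<^sub>R v'"] that by simp
      also have "\<dots> \<le> h * norm u' + h * norm v'"
        using that by (intro add_mono mult_right_mono) auto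
      also have "\<dots> = h * (norm u + norm v)" using that by (simp add: distrib_left[symmetric])
      also have "\<dots> \<le> h * N" using h by (intro mult_left_mono) (auto simp: N_def)
      also have "\<dots> < d" using hd d_pos by simp
      finally show ?thesis by (simp add: dist_norm algebra_simps)
    qed
    have inS: "x + s *\<^sub>R u' + t *\<^sub>R v' \<in> S"
      if "0 \<le> s" "s \<le> h" "0 \<le> t" "t \<le> h" "norm u' + norm v' = norm u + norm v" for s t u' v'
    proof -
      have "dist x (x + s *\<^sub>R u' + t *\<^sub>R v') < d3"
        using near[OF that] unfolding d_def by (simp add: dist_commute)
      then show ?thesis using d3(2) by (auto simp: subset_iff)
    qed
    obtain s t where st: "0 < s" "s < h" "0 < t" "t < h"
      and 1: "f (x + h *\<^sub>R u + h *\<^sub>R v) - f (x + h *\<^sub>R u) - f (x + h *\<^sub>R v) + f x =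
        h * (h * A u v (x + s *\<^sub>R u + t *\<^sub>R v))"
      using second_difference_mvt[OF assms(2) h inS, of u v] unfolding A_def by blast
    obtain s' t' where st': "0 < s'" "s' < h" "0 < t'" "t' < h"
      and 2: "f (x + h *\<^sub>R v + h *\<^sub>R u) - f (x + h *\<^sub>R v) - f (x + h *\<^sub>R u) + f x =
        h * (h * A v u (x + s' *\<^sub>R v + t' *\<^sub>R u))"
      using second_difference_mvt[OF assms(2) h inS, of v u] unfolding A_def by (auto simp: add.commute)
    have "h * (h * A u v (x + s *\<^sub>R u + t *\<^sub>R v)) = h * (h * A v u (x + s' *\<^sub>R v + t' *\<^sub>R u))"
      using 1 2 by (simp add: algebra_simps)
    then have eq: "A u v (x + s *\<^sub>R u + t *\<^sub>R v) = A v u (x + s' *\<^sub>R v + t' *\<^sub>R u)" using h by simp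
    have "dist (A u v (x + s *\<^sub>R u + t *\<^sub>R v)) (A u v x) < e"
      using near[of s t u v] st by (intro d1) (auto simp: d_def)
    moreover have "dist (A v u (x + s' *\<^sub>R v + t' *\<^sub>R u)) (A v u x) < e"
      using near[of s' t' v u] st' by (intro d2) (auto simp: d_def)
    ultimately show ?thesis using eq by (simp add: dist_real_def)
  qed
  from this[of "\<bar>A u v x - A v u x\<bar> / 2"] have "A u v x = A v u x" by (cases "A u v x = A v u x") auto
  then show ?thesis by (simp add: A_def)
qed

section \<open>Bump functions\<close>

definition flat :: "nat \<Rightarrow> real \<Rightarrow> real" where
  "flat n x = (if x \<le> 0 then 0 else (1 / x) ^ n * exp (- 1 / x))"

text \<open>A quadratic bound gives derivative \<open>0\<close> at the origin. With
  \<open>y = 1 / x\<close> it says that \<open>y ^ (n + 2) * exp (- y)\<close> is bounded, and the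
  constant comes from raising \<open>y / (n + 2) \<le> exp (y / (n + 2))\<close> to the power
  \<open>n + 2\<close>.\<close>

lemma flat_bound: "\<bar>flat n x\<bar> \<le> real ((n + 2) ^ (n + 2)) * x\<^sup>2"
proof (cases "x \<le> 0")
  case False
  define y where "y = 1 / x"
  have y: "y > 0" "x = 1 / y" using False by (auto simp: y_def)
  have "(y / real (n + 2)) ^ (n + 2) \<le> exp (y / real (n + 2)) ^ (n + 2)"
    using y exp_ge_add_one_self[of "y / real (n + 2)"] by (intro power_mono) (auto intro: order_trans[OF _ exp_ge_add_one_self])
  also have "\<dots> = exp (real (n + 2) * (y / real (n + 2)))" by (rule exp_of_nat_mult[symmetric])
  also have "\<dots> = exp y" by (simp del: of_nat_add)
  finally have "y ^ (n + 2) \<le> real ((n + 2) ^ (n + 2)) * exp y"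
    by (simp only: power_divide of_nat_power) (simp add: divide_le_eq mult.commute)
  then have "y ^ (n + 2) * exp (- y) \<le> real ((n + 2) ^ (n + 2))"
    by (simp add: exp_minus divide_simps)
  moreover define C where "C = real ((n + 2) ^ (n + 2))"
  moreover have "y ^ (n + 2) * exp (- y) = y ^ n * exp (- y) * y\<^sup>2"
    by (simp add: power2_eq_square)
  ultimately have "y ^ n * exp (- y) \<le> C / y\<^sup>2"
    by (simp only: pos_le_divide_eq[OF zero_less_power[OF y(1)]])
  moreover have "flat n x = y ^ n * exp (- y)" using False by (simp add: flat_def y_def)
  moreover have "x\<^sup>2 = 1 / y\<^sup>2" unfolding y(2) by (simp add: power_divide)
  ultimately have "\<bar>flat n x\<bar> \<le> C * x\<^sup>2" using y(1) by simp
  then show ?thesis by (simp only: C_def)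
qed (simp add: flat_def)

text \<open>Carrying the exponent \<open>n\<close> makes the family closed under differentiation up
  to linear combinations, so that smoothness is an induction on the order with \<open>n\<close>
  arbitrary.\<close>

lemma flat_deriv: "(flat n has_real_derivative flat (n + 2) x - real n * flat (n + 1) x) (at x)"
proof -
  consider "x < 0" | "x = 0" | "x > 0" by linarith
  then show ?thesis
  proof cases
    case 1
    have "((\<lambda>x. 0) has_real_derivative 0) (at x)" by simp
    then have "(flat n has_real_derivative 0) (at x)"
      by (rule has_field_derivative_transform_within_open[of _ _ _ "{..<0}"]) (use 1 in \<open>auto simp: flat_def\<close>)
    then show ?thesis using 1 by (simp add: flat_def)
  next
    case 2
    let ?C = "real ((n + 2) ^ (n + 2))"
    have "((\<lambda>h. (flat n (0 + h) - flat n 0) / h) \<longlongrightarrow> 0) (at 0)"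
    proof (rule Lim_null_comparison)
      show "\<forall>\<^sub>F h in at 0. norm ((flat n (0 + h) - flat n 0) / h) \<le> ?C * \<bar>h\<bar>"
      proof (rule eventually_at_filter[THEN iffD2, OF always_eventually], intro allI impI)
        fix h :: real assume "h \<noteq> 0"
        then show "norm ((flat n (0 + h) - flat n 0) / h) \<le> ?C * \<bar>h\<bar>"
          using flat_bound[of n h] flat_bound[of n 0]
          by (simp add: divide_le_eq power2_eq_square abs_mult[symmetric] mult.assoc flat_def del: of_nat_power)
      qed
      show "((\<lambda>h. ?C * \<bar>h\<bar>) \<longlongrightarrow> 0) (at 0)"
        by (auto intro!: tendsto_eq_intros)
    qed
    then show ?thesis using 2 by (simp add: DERIV_def flat_def)
  next
    case 3
    have "((\<lambda>x. (1 / x) ^ n * exp (- 1 / x)) has_real_derivative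
        flat (n + 2) x - real n * flat (n + 1) x) (at x)"
    proof (cases n)
      case 0
      then show ?thesis
        using 3 by (auto intro!: derivative_eq_intros simp: flat_def field_simps power2_eq_square)
    next
      case (Suc m)
      have i: "((\<lambda>x. 1 / x) has_real_derivative - (1 / x)\<^sup>2) (at x)"
        using 3 by (auto intro!: derivative_eq_intros simp: power2_eq_square)
      have e: "((\<lambda>x. exp (- 1 / x)) has_real_derivative exp (- 1 / x) * (1 / x)\<^sup>2) (at x)"
        using 3 by (auto intro!: derivative_eq_intros simp: power2_eq_square)
      show ?thesis
        unfolding Suc using 3
        by (intro DERIV_cong[OF DERIV_mult[OF DERIV_power_Suc[OF i, of m] e]])
          (simp add: flat_def algebra_simps power2_eq_square)
    qed
    then show ?thesis
      by (rule has_field_derivative_transform_within_open[of _ _ _ "{0<..}"]) (use 3 in \<open>auto simp: flat_def\<close>)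
  qed
qed

lemma flat_smooth: "smooth_on UNIV (flat n)"
proof -
  have "k_smooth_on k UNIV (flat n)" for k
  proof (induction k arbitrary: n)
    case 0
    then show ?case
      by (auto intro!: continuous_at_imp_continuous_on DERIV_isCont flat_deriv)
  next
    case (Suc k)
    show ?case
    proof (rule k_smooth_on_SucI[OF open_UNIV])
      show "(flat n has_derivative (\<lambda>v. (flat (n + 2) x + (- real n) * flat (n + 1) x) * v)) (at x)" for x
        using flat_deriv[of n x] by (simp add: has_field_derivative_def)
      show "k_smooth_on k UNIV (\<lambda>x. (flat (n + 2) x + (- real n) * flat (n + 1) x) * v)" for v
        by (rule k_smooth_on_bilinear[OF bounded_bilinear_mult open_UNIV
              k_smooth_on_add[OF open_UNIV Suc.IH k_smooth_on_bilinear[OF bounded_bilinear_mult open_UNIV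
                  k_smooth_on_const[OF open_UNIV] Suc.IH]]
              k_smooth_on_const[OF open_UNIV]])
    qed
  qed
  then show ?thesis by (simp add: smooth_on_def)
qed

lemma smooth_bump:
  fixes x0 :: "'a::euclidean_space"
  assumes "r > 0"
  obtains \<beta> :: "'a \<Rightarrow> real" where "smooth_on UNIV \<beta>"
    "\<And>x. x \<in> ball x0 (r / 2) \<Longrightarrow> \<beta> x = 1" "\<And>x. x \<notin> cball x0 r \<Longrightarrow> \<beta> x = 0"
proof -
  \<comment> \<open>The squared distance from \<open>x0\<close> in units of \<open>r\<close>: at
    most \<open>1/4\<close> on the inner ball, at least \<open>1\<close> outside the outer one. The
    two summands of \<open>d\<close> below vanish for \<open>q \<ge> 1\<close> and for
    \<open>q \<le> 1/4\<close>, hence never together, and the first one divided by \<open>d\<close>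
    is the cutoff.\<close>
  define q where "q x = (1 / r\<^sup>2) * ((x - x0) \<bullet> (x - x0))" for x
  have q_norm: "q x = (dist x0 x / r)\<^sup>2" for x
  proof -
    have "(x0 - x) \<bullet> (x0 - x) = (x - x0) \<bullet> (x - x0)" by (simp add: inner_diff_left inner_diff_right)
    then show ?thesis by (simp add: q_def dist_norm power_divide power2_norm_eq_inner)
  qed
  have diff: "smooth_on UNIV (\<lambda>x. x + (- x0))"
    by (rule smooth_on_add[OF open_UNIV smooth_on_bounded_linear[OF bounded_linear_ident open_UNIV]
          smooth_on_const[OF open_UNIV]])
  have q: "smooth_on UNIV q"
    using smooth_on_mult[OF open_UNIV smooth_on_const[OF open_UNIV, where c="1 / r\<^sup>2"]
        smooth_on_bilinear[OF bounded_bilinear_inner open_UNIV diff diff]] by (simp add: q_def[abs_def])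
  have lin: "smooth_on UNIV (\<lambda>x. a * q x + b)" for a b
    by (rule smooth_on_add[OF open_UNIV smooth_on_mult[OF open_UNIV smooth_on_const[OF open_UNIV] q]
          smooth_on_const[OF open_UNIV]])
  have fl: "smooth_on UNIV (\<lambda>x. flat 0 (a * q x + b))" for a b
    by (rule smooth_on_compose[OF open_UNIV open_UNIV lin flat_smooth subset_UNIV])
  define d where "d x = flat 0 (- 1 * q x + 1) + flat 0 (1 * q x + (- 1 / 4))" for x
  have flat_pos: "flat 0 t \<ge> 0" "flat 0 t > 0 \<longleftrightarrow> t > 0" for t by (auto simp: flat_def)
  have d_pos: "d x > 0" for x
  proof (cases "q x < 1")
    case True
    then have "flat 0 (- 1 * q x + 1) > 0" using flat_pos(2) by simp
    then show ?thesis unfolding d_def using flat_pos(1) by (rule add_pos_nonneg)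
  next
    case False
    then have "flat 0 (1 * q x + (- 1 / 4)) > 0" unfolding flat_pos(2) by simp
    then show ?thesis unfolding d_def by (rule add_nonneg_pos[OF flat_pos(1)])
  qed
  have d: "smooth_on UNIV d" unfolding d_def[abs_def] by (rule smooth_on_add[OF open_UNIV fl fl])
  define \<beta> where "\<beta> x = flat 0 (- 1 * q x + 1) * inverse (d x)" for x
  show ?thesis
  proof
    show "smooth_on UNIV \<beta>" unfolding \<beta>_def[abs_def]
      by (rule smooth_on_mult[OF open_UNIV fl smooth_on_inverse[OF open_UNIV d]])
        (use d_pos in \<open>simp add: less_imp_neq[symmetric]\<close>)
    show "\<beta> x = 1" if "x \<in> ball x0 (r / 2)" for x
    proof -
      have "dist x0 x / r \<le> 1 / 2" using that assms by (simp add: divide_simps)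
      then have "q x \<le> (1 / 2)\<^sup>2" unfolding q_norm using assms by (intro power_mono) auto
      then have "flat 0 (1 * q x + (- 1 / 4)) = 0" by (simp add: flat_def power2_eq_square)
      then have "flat 0 (- 1 * q x + 1) = d x" by (simp add: d_def)
      then show ?thesis using d_pos[of x] by (simp add: \<beta>_def)
    qed
    show "\<beta> x = 0" if "x \<notin> cball x0 r" for x
    proof -
      have "1 \<le> dist x0 x / r" using that assms by (simp add: divide_simps)
      then have "1\<^sup>2 \<le> q x" unfolding q_norm by (intro power_mono) auto
      then show ?thesis by (simp add: \<beta>_def flat_def)
    qed
  qed
qed

section \<open>Integrals along rays and Hadamard's lemma\<close>

lemma k_smooth_on_radial_integral:
  fixes q :: "'a::euclidean_space \<Rightarrow> real"
  assumes "k_smooth_on k (ball x0 r) q"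
  shows "k_smooth_on k (ball x0 r) (\<lambda>x. integral {0..1} (\<lambda>t. t ^ m * q (x0 + t *\<^sub>R (x - x0))))"
  using assms
\<comment> \<open>By the chain rule each differentiation under the integral sign produces a factor
  \<open>t\<close>. The weight \<open>t ^ m\<close> absorbs it, so the derivative is again an
  integral of this kind.\<close>
proof (induction k arbitrary: q m)
  have inb: "x0 + t *\<^sub>R (x - x0) \<in> ball x0 r" if "x \<in> ball x0 r" "t \<in> {0..1}" for t x
  proof -
    have "dist x0 (x0 + t *\<^sub>R (x - x0)) = t * dist x0 x"
      using that by (simp add: dist_norm norm_minus_commute)
    also have "\<dots> \<le> 1 * dist x0 x" using that by (intro mult_right_mono) auto
    also have "\<dots> < r" using that by simp
    finally show ?thesis by simp
  qed
  have cont: "continuous_on (ball x0 r \<times> cbox 0 1) (\<lambda>(x, t). t ^ m *\<^sub>R p (x0 + t *\<^sub>R (x - x0)))"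
    if "continuous_on (ball x0 r) p" for p :: "'a \<Rightarrow> 'b::real_normed_vector" and m
    unfolding split_beta
    by (intro continuous_intros continuous_on_compose2[OF that]) (use inb in \<open>auto simp: cbox_interval\<close>)
  {
    case 0
    then have "continuous_on (ball x0 r) (\<lambda>x. integral (cbox 0 1) (\<lambda>t. t ^ m * q (x0 + t *\<^sub>R (x - x0))))"
      using cont[of q m] by (intro integral_continuous_on_param) simp
    then show ?case by (simp add: cbox_interval)
  next
    case (Suc k)
    let ?D = "\<lambda>y. frechet_derivative q (at y)"
    have der: "(q has_derivative ?D y) (at y)" if "y \<in> ball x0 r" for y
      using Suc.prems that by (rule k_smooth_on_SucD)
    have app: "blinfun_apply (Blinfun (?D y)) = ?D y" if "y \<in> ball x0 r" for y
      using der[OF that] by (simp add: bounded_linear_Blinfun_apply has_derivative_bounded_linear)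
    have contB: "continuous_on (ball x0 r) (\<lambda>y. Blinfun (?D y))"
    proof (rule continuous_on_blinfun_componentwise)
      fix i :: 'a
      have "k_smooth_on k (ball x0 r) (\<lambda>y. ?D y i)" using Suc.prems by simp
      then have "continuous_on (ball x0 r) (\<lambda>y. ?D y i)"
        using k_smooth_on_Suc_imp by (induction k) auto
      then show "continuous_on (ball x0 r) (\<lambda>y. blinfun_apply (Blinfun (?D y)) i)"
        by (rule continuous_on_cong[THEN iffD1, OF refl, rotated]) (simp add: app)
    qed
    let ?fx = "\<lambda>x t. t ^ (m + 1) *\<^sub>R Blinfun (?D (x0 + t *\<^sub>R (x - x0)))"
    have contq: "continuous_on (ball x0 r) q"
      by (rule continuous_at_imp_continuous_on) (use der has_derivative_continuous in blast)
    have contfx: "continuous_on (ball x0 r \<times> cbox 0 1) (\<lambda>(x, t). ?fx x t)"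
      using cont[OF contB, of "m + 1"] .
    have slice: "continuous_on (cbox 0 1) (\<lambda>t. F x t)"
      if "continuous_on (ball x0 r \<times> cbox 0 (1::real)) (\<lambda>(x, t). F x t)" "x \<in> ball x0 r"
      for F :: "'a \<Rightarrow> real \<Rightarrow> 'b::real_normed_vector" and x
    proof -
      have "continuous_on (cbox 0 1) (\<lambda>t. case (x, t) of (x, t) \<Rightarrow> F x t)"
        by (rule continuous_on_compose2[OF that(1)])
          (use that(2) in \<open>auto intro!: continuous_on_Pair continuous_on_const continuous_on_id\<close>)
      then show ?thesis by simp
    qed
    have deriv: "((\<lambda>x. integral (cbox 0 1) (\<lambda>t. t ^ m * q (x0 + t *\<^sub>R (x - x0)))) has_derivative
        blinfun_apply (integral (cbox 0 1) (?fx x))) (at x within ball x0 r)" if x: "x \<in> ball x0 r" for x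
    proof (rule leibniz_rule[OF _ _ contfx x convex_ball])
      fix x t assume xt: "x \<in> ball x0 r" "t \<in> cbox 0 (1::real)"
      have inn: "x0 + t *\<^sub>R (x - x0) \<in> ball x0 r" using inb xt by (simp add: cbox_interval)
      have "((\<lambda>x. x0 + t *\<^sub>R (x - x0)) has_derivative (\<lambda>v. t *\<^sub>R v)) (at x)"
        by (auto intro!: derivative_eq_intros)
      from has_derivative_compose[OF this der[OF inn]]
      have "((\<lambda>x. t ^ m * q (x0 + t *\<^sub>R (x - x0))) has_derivative
          (\<lambda>v. t ^ m * ?D (x0 + t *\<^sub>R (x - x0)) (t *\<^sub>R v))) (at x)"
        by (rule has_derivative_mult_right)
      moreover have "(\<lambda>v. t ^ m * ?D (x0 + t *\<^sub>R (x - x0)) (t *\<^sub>R v)) = blinfun_apply (?fx x t)"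
        using linear_scale[OF has_derivative_linear[OF der[OF inn]]] app[OF inn]
        by (auto simp: fun_eq_iff blinfun.scaleR_left)
      ultimately show "((\<lambda>x. t ^ m * q (x0 + t *\<^sub>R (x - x0))) has_derivative blinfun_apply (?fx x t))
          (at x within ball x0 r)"
        by (simp add: has_derivative_at_withinI)
    next
      fix x assume "x \<in> ball x0 r"
      then show "(\<lambda>t. t ^ m * q (x0 + t *\<^sub>R (x - x0))) integrable_on cbox 0 1"
        using slice[OF cont[OF contq, of m]] by (intro integrable_continuous) simp
    qed
    have apply_deriv: "blinfun_apply (integral (cbox 0 1) (?fx x)) v =
        integral {0..1} (\<lambda>t. t ^ (m + 1) * ?D (x0 + t *\<^sub>R (x - x0)) v)" if x: "x \<in> ball x0 r" for x v
    proof -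
      have "blinfun_apply (integral (cbox 0 1) (?fx x)) v =
          integral (cbox 0 1) (\<lambda>t. blinfun_apply (?fx x t) v)"
        using slice[OF contfx x] by (intro blinfun_apply_integral integrable_continuous)
      also have "\<dots> = integral {0..1} (\<lambda>t. t ^ (m + 1) * ?D (x0 + t *\<^sub>R (x - x0)) v)"
        unfolding cbox_interval
      proof (rule integral_cong)
        fix t :: real assume "t \<in> {0..1}"
        then show "blinfun_apply (?fx x t) v = t ^ (m + 1) * ?D (x0 + t *\<^sub>R (x - x0)) v"
          using app[OF inb[OF x]] by (simp add: blinfun.scaleR_left)
      qed
      finally show ?thesis .
    qed
    have 1: "((\<lambda>x. integral {0..1} (\<lambda>t. t ^ m * q (x0 + t *\<^sub>R (x - x0)))) has_derivative
        (\<lambda>v. integral {0..1} (\<lambda>t. t ^ (m + 1) * ?D (x0 + t *\<^sub>R (x - x0)) v))) (at x)"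
      if "x \<in> ball x0 r" for x
    proof -
      have "blinfun_apply (integral (cbox 0 1) (?fx x)) =
          (\<lambda>v. integral {0..1} (\<lambda>t. t ^ (m + 1) * ?D (x0 + t *\<^sub>R (x - x0)) v))"
        using apply_deriv[OF that] by (simp add: fun_eq_iff)
      then show ?thesis
        using deriv[OF that] unfolding at_within_open[OF that open_ball] by (simp only: cbox_interval)
    qed
    show ?case
    proof (rule k_smooth_on_SucI[OF open_ball 1])
      show "k_smooth_on k (ball x0 r) (\<lambda>x. integral {0..1} (\<lambda>t. t ^ (m + 1) * ?D (x0 + t *\<^sub>R (x - x0)) v))" for v
        by (rule Suc.IH) (use Suc.prems in simp)
    qed
  }
qed

text \<open>The fundamental theorem of calculus along the segment from \<open>x0\<close> to
  \<open>x\<close>, with the derivative in direction \<open>x - x0\<close> expanded in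
  \<open>Basis\<close>. The coefficients being smooth is the point: derivations can be applied to
  the products.\<close>

lemma hadamard:
  fixes f :: "'a::euclidean_space \<Rightarrow> real"
  assumes "smooth_on (ball x0 r) f"
  obtains h where "\<And>b. smooth_on (ball x0 r) (h b)"
    "\<And>x. x \<in> ball x0 r \<Longrightarrow> f x = f x0 + (\<Sum>b\<in>Basis. ((x - x0) \<bullet> b) * h b x)"
    "\<And>b. h b x0 = frechet_derivative f (at x0) b"
proof -
  let ?D = "\<lambda>y. frechet_derivative f (at y)"
  define h where "h b x = integral {0..1} (\<lambda>t. t ^ 0 * ?D (x0 + t *\<^sub>R (x - x0)) b)" for b x
  show ?thesis
  proof
    show "smooth_on (ball x0 r) (h b)" for b
      using k_smooth_on_radial_integral smooth_on_frechet_derivative[OF assms, of b]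
      unfolding smooth_on_def h_def by blast
    show "h b x0 = ?D x0 b" for b by (simp add: h_def)
    show "f x = f x0 + (\<Sum>b\<in>Basis. ((x - x0) \<bullet> b) * h b x)" if x: "x \<in> ball x0 r" for x
    proof -
      have inb: "x0 + t *\<^sub>R (x - x0) \<in> ball x0 r" if "t \<in> {0..1}" for t
      proof -
        have "dist x0 (x0 + t *\<^sub>R (x - x0)) = t * dist x0 x"
          using that by (simp add: dist_norm norm_minus_commute)
        also have "\<dots> \<le> 1 * dist x0 x" using that by (intro mult_right_mono) auto
        also have "\<dots> < r" using x by simp
        finally show ?thesis by simp
      qed
      have der: "(f has_derivative ?D (x0 + t *\<^sub>R (x - x0))) (at (x0 + t *\<^sub>R (x - x0)))"
        if "t \<in> {0..1}" for t
        using smooth_on_has_derivative[OF assms inb[OF that]] .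
      have "((\<lambda>t. f (x0 + t *\<^sub>R (x - x0))) has_vector_derivative ?D (x0 + t *\<^sub>R (x - x0)) (x - x0))
          (at t within {0..1})" if "t \<in> {0..1}" for t
      proof -
        have "((\<lambda>t. x0 + t *\<^sub>R (x - x0)) has_derivative (\<lambda>d. d *\<^sub>R (x - x0))) (at t)"
          by (auto intro!: derivative_eq_intros)
        from has_derivative_compose[OF this der[OF that]] show ?thesis
          using linear_scale[OF has_derivative_linear[OF der[OF that]]]
          by (simp add: has_vector_derivative_def has_derivative_at_withinI)
      qed
      then have "((\<lambda>t. ?D (x0 + t *\<^sub>R (x - x0)) (x - x0)) has_integral
          f (x0 + 1 *\<^sub>R (x - x0)) - f (x0 + 0 *\<^sub>R (x - x0))) {0..1}"
        by (intro fundamental_theorem_of_calculus) auto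
      then have "((\<lambda>t. ?D (x0 + t *\<^sub>R (x - x0)) (x - x0)) has_integral f x - f x0) {0..1}" by simp
      moreover have "?D (x0 + t *\<^sub>R (x - x0)) (x - x0) =
          (\<Sum>b\<in>Basis. ((x - x0) \<bullet> b) * (t ^ 0 * ?D (x0 + t *\<^sub>R (x - x0)) b))" if "t \<in> {0..1}" for t
        using linear_euclidean_expand[OF has_derivative_linear[OF der[OF that]], of "x - x0"] by simp
      ultimately have 1: "((\<lambda>t. \<Sum>b\<in>Basis. ((x - x0) \<bullet> b) * (t ^ 0 * ?D (x0 + t *\<^sub>R (x - x0)) b)) has_integral
          f x - f x0) {0..1}"
        by (rule has_integral_eq[rotated]) (simp_all)
      have cont: "continuous_on {0..1} (\<lambda>t. t ^ 0 * ?D (x0 + t *\<^sub>R (x - x0)) b)" for b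
      proof -
        have "continuous_on {0..1} (\<lambda>t. ?D (x0 + t *\<^sub>R (x - x0)) b)"
          by (rule continuous_on_compose2[OF smooth_on_continuous_on[OF smooth_on_frechet_derivative[OF assms, of b]]])
            (use inb in \<open>auto intro!: continuous_intros\<close>)
        then show ?thesis by simp
      qed
      have "((\<lambda>t. \<Sum>b\<in>Basis. ((x - x0) \<bullet> b) * (t ^ 0 * ?D (x0 + t *\<^sub>R (x - x0)) b)) has_integral
          (\<Sum>b\<in>Basis. ((x - x0) \<bullet> b) * h b x)) {0..1}"
        unfolding h_def
        by (intro has_integral_sum finite_Basis has_integral_mult_right integrable_integral
            integrable_continuous_real cont)
      from has_integral_unique[OF 1 this] show ?thesis by simp
    qed
  qed
qed

section \<open>Local existence for ordinary differential equations\<close>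

lemma ode_lipschitz:
  fixes F :: "'a::euclidean_space \<Rightarrow> 'a"
  assumes "L > 0" and lip: "\<And>x y. norm (F x - F y) \<le> L * norm (x - y)"
  obtains x :: "real \<Rightarrow> 'a" and \<delta> where "\<delta> > 0" "x 0 = x0" "continuous_on UNIV x"
    "\<And>t. \<bar>t\<bar> < \<delta> \<Longrightarrow> (x has_vector_derivative F (x t)) (at t)"
proof -
  \<comment> \<open>With this length each of the two integrals in \<open>T\<close> contributes a
    Lipschitz constant \<open>1/4\<close>, so \<open>T\<close> contracts by \<open>1/2\<close>.
    Clamping the time by \<open>c\<close> lets the Picard operator act on bounded continuous
    functions on the whole line, a complete space.\<close>
  define \<delta> where "\<delta> = 1 / (8 * L)"
  define c where "c t = max (- \<delta>) (min \<delta> t)" for t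
  have \<delta>: "\<delta> > 0" using assms(1) by (simp add: \<delta>_def)
  have c: "c t \<in> {- \<delta>..\<delta>}" for t using \<delta> by (auto simp: c_def)
  have contF: "continuous_on UNIV F"
    by (rule lipschitz_on_continuous_on[OF lipschitz_onI[where L=L]]) (use assms in \<open>auto simp: dist_norm\<close>)
  \<comment> \<open>Starting at \<open>- \<delta>\<close> lets the upper limit lie on both sides of
    \<open>0\<close>; subtracting \<open>I y 0\<close> in \<open>T\<close> restores the initial
    value at time \<open>0\<close>.\<close>
  define I where "I y s = integral {- \<delta>..s} (\<lambda>\<tau>. F (apply_bcontfun y \<tau>))" for y :: "real \<Rightarrow>\<^sub>C 'a" and s
  have contFy: "continuous_on A (\<lambda>\<tau>. F (apply_bcontfun y \<tau>))" for A and y :: "real \<Rightarrow>\<^sub>C 'a"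
    by (rule continuous_on_compose2[OF contF]) auto
  define T where "T y = Bcontfun (\<lambda>t. x0 + (I y (c t) - I y 0))" for y
  have contI: "continuous_on {- \<delta>..\<delta>} (I y)" for y
    unfolding I_def[abs_def] by (intro indefinite_integral_continuous_1 integrable_continuous_real contFy)
  have "(\<lambda>t. x0 + (I y (c t) - I y 0)) \<in> bcontfun" for y
  proof -
    have "continuous_on UNIV c" unfolding c_def[abs_def] by (intro continuous_intros)
    then have "continuous_on UNIV (\<lambda>t. x0 + (I y (c t) - I y 0))"
      by (intro continuous_intros continuous_on_compose2[OF contI]) (use c in auto)
    moreover have "bounded ((\<lambda>s. x0 + (I y s - I y 0)) ` {- \<delta>..\<delta>})"
      by (intro compact_imp_bounded compact_continuous_image continuous_intros contI) auto
    then have "bounded (range (\<lambda>t. x0 + (I y (c t) - I y 0)))"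
      by (rule bounded_subset) (use c in auto)
    ultimately show ?thesis by (simp add: bcontfun_def)
  qed
  then have T: "apply_bcontfun (T y) t = x0 + (I y (c t) - I y 0)" for y t
    by (simp add: T_def Bcontfun_inverse)
  have diffI: "norm (I y s - I z s) \<le> dist y z / 4" if "s \<in> {- \<delta>..\<delta>}" for y z s
  proof -
    have "I y s - I z s = integral {- \<delta>..s} (\<lambda>\<tau>. F (apply_bcontfun y \<tau>) - F (apply_bcontfun z \<tau>))"
      unfolding I_def by (intro integral_diff[symmetric] integrable_continuous_real contFy)
    also have "norm \<dots> \<le> (L * dist y z) * (s - - \<delta>)"
    proof (rule integral_bound)
      show "norm (F (apply_bcontfun y t) - F (apply_bcontfun z t)) \<le> L * dist y z" for t
        by (rule order_trans[OF lip mult_left_mono])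
          (use assms(1) dist_bounded[of y t z] in \<open>simp_all add: dist_norm[where 'a='a]\<close>)
    qed (use that in \<open>auto intro!: continuous_intros contFy\<close>)
    also have "\<dots> \<le> (L * dist y z) * (2 * \<delta>)"
      using that assms(1) by (intro mult_left_mono) auto
    also have "\<dots> = dist y z / 4" using assms(1) by (simp add: \<delta>_def)
    finally show ?thesis .
  qed
  have "\<exists>!y. T y = y"
  proof (rule banach_fix_type[of "1/2"]; (intro allI)?)
    fix y z
    show "dist (T y) (T z) \<le> 1 / 2 * dist y z"
    proof (rule dist_bound)
      fix t
      have "dist (apply_bcontfun (T y) t) (apply_bcontfun (T z) t) =
          norm ((I y (c t) - I z (c t)) - (I y 0 - I z 0))"
        by (simp add: T dist_norm algebra_simps)
      also have "\<dots> \<le> dist y z / 4 + dist y z / 4"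
        by (rule order_trans[OF norm_triangle_ineq4 add_mono[OF diffI diffI]]) (use c \<delta> in auto)
      finally show "dist (apply_bcontfun (T y) t) (apply_bcontfun (T z) t) \<le> 1 / 2 * dist y z" by simp
    qed
  qed auto
  then obtain y where "T y = y" by blast
  then have y: "apply_bcontfun y t = x0 + (I y (c t) - I y 0)" for t using T[of y t] by simp
  show ?thesis
  proof
    show "\<delta> > 0" by (rule \<delta>)
    show "apply_bcontfun y 0 = x0" using \<delta> by (simp add: y c_def)
    show "continuous_on UNIV (apply_bcontfun y)" by simp
    show "(apply_bcontfun y has_vector_derivative F (apply_bcontfun y t)) (at t)" if "\<bar>t\<bar> < \<delta>" for t
    proof -
      have "(I y has_vector_derivative F (apply_bcontfun y t)) (at t within {- \<delta>..\<delta>})"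
        unfolding I_def[abs_def] by (rule integral_has_vector_derivative[OF contFy]) (use that in auto)
      moreover have "at t within {- \<delta>..\<delta>} = at t"
        by (rule at_within_interior) (use that in auto)
      ultimately have "(I y has_vector_derivative F (apply_bcontfun y t)) (at t)" by simp
      then have "((\<lambda>s. x0 + (I y s - I y 0)) has_vector_derivative F (apply_bcontfun y t)) (at t)"
        by (auto intro!: derivative_eq_intros)
      then show ?thesis
        by (rule has_vector_derivative_transform_within_open[of _ _ _ "{- \<delta><..<\<delta>}"])
          (use that y in \<open>auto simp: c_def\<close>)
    qed
  qed
qed

lemma ode_local:
  fixes F :: "'a::euclidean_space \<Rightarrow> 'a"
  assumes "open S" "x0 \<in> S" "smooth_on S F"
  obtains x :: "real \<Rightarrow> 'a" and \<delta> where "\<delta> > 0" "x 0 = x0"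
    "\<And>t. \<bar>t\<bar> < \<delta> \<Longrightarrow> x t \<in> S"
    "\<And>t. \<bar>t\<bar> < \<delta> \<Longrightarrow> (x has_vector_derivative F (x t)) (at t)"
proof -
  obtain r where r: "r > 0" "cball x0 r \<subseteq> S" using assms(1,2) open_contains_cball by blast
  let ?D = "\<lambda>y. frechet_derivative F (at y)"
  have der: "(F has_derivative ?D y) (at y)" if "y \<in> cball x0 r" for y
    using smooth_on_has_derivative[OF assms(3)] r that by blast
  have "\<exists>B. \<forall>y\<in>cball x0 r. norm (?D y b) \<le> B" for b
  proof -
    have "continuous_on (cball x0 r) (\<lambda>y. norm (?D y b))"
      using smooth_on_continuous_on[OF smooth_on_frechet_derivative[OF assms(3)]] r(2)
      by (intro continuous_on_norm) (rule continuous_on_subset)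
    then have "bounded ((\<lambda>y. norm (?D y b)) ` cball x0 r)"
      by (intro compact_imp_bounded compact_continuous_image) auto
    then show ?thesis by (auto simp: bounded_iff)
  qed
  then obtain B where B: "\<And>b y. y \<in> cball x0 r \<Longrightarrow> norm (?D y b) \<le> B b" by metis
  have B0: "B b \<ge> 0" for b using order_trans[OF norm_ge_zero B[of x0 b]] r by simp
  define L where "L = (\<Sum>b\<in>Basis. B b) + 1"
  have L: "L > 0" using sum_nonneg[of Basis B] B0 by (simp add: L_def add_nonneg_pos)
  have on: "onorm (?D y) \<le> L" if "y \<in> cball x0 r" for y
  proof (rule onorm_bound)
    fix v
    have "norm (?D y v) = norm (\<Sum>b\<in>Basis. (v \<bullet> b) *\<^sub>R ?D y b)"
      using linear_euclidean_expand[OF has_derivative_linear[OF der[OF that]]] by metis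
    also have "\<dots> \<le> (\<Sum>b\<in>Basis. norm v * B b)"
      by (rule order_trans[OF norm_sum]) (auto intro!: sum_mono mult_mono simp: Basis_le_norm B[OF that])
    also have "\<dots> = norm v * sum B Basis" by (rule sum_distrib_left[symmetric])
    also have "\<dots> \<le> L * norm v" by (simp add: L_def algebra_simps)
    finally show "norm (?D y v) \<le> L * norm v" .
  qed (use L in simp)
  have lip: "norm (F y - F z) \<le> L * norm (y - z)" if "y \<in> cball x0 r" "z \<in> cball x0 r" for y z
    by (rule differentiable_bound[OF convex_cball has_derivative_at_withinI[OF der] on that(1,2)])
  \<comment> \<open>Precomposing with the nearest-point projection onto the ball, which does not
    increase distances, makes \<open>F\<close> globally Lipschitz without changing it on the ball.
    By continuity the solution stays in the ball for a short time.\<close>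
  define G where "G y = F (closest_point (cball x0 r) y)" for y
  have cp: "closest_point (cball x0 r) y \<in> cball x0 r" for y
    by (rule closest_point_in_set) (use r in auto)
  have "norm (G y - G z) \<le> L * norm (y - z)" for y z
  proof -
    have "norm (G y - G z) \<le> L * dist (closest_point (cball x0 r) y) (closest_point (cball x0 r) z)"
      unfolding G_def dist_norm by (rule lip[OF cp cp])
    also have "\<dots> \<le> L * dist y z"
      using L r by (intro mult_left_mono closest_point_lipschitz) auto
    finally show ?thesis by (simp add: dist_norm)
  qed
  from ode_lipschitz[OF L this] obtain x :: "real \<Rightarrow> 'a" and \<delta> where x: "\<delta> > 0" "x 0 = x0"
    "continuous_on UNIV x" "\<And>t. \<bar>t\<bar> < \<delta> \<Longrightarrow> (x has_vector_derivative G (x t)) (at t)" by metis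
  have "isCont x 0" using x(3) by (simp add: continuous_on_eq_continuous_at)
  then obtain d where d: "d > 0" "\<And>t. dist t 0 < d \<Longrightarrow> dist (x t) (x 0) < r"
    using r(1) unfolding continuous_at_eps_delta by metis
  have inb: "x t \<in> cball x0 r" if "\<bar>t\<bar> < d" for t
    using d(2)[of t] that x(2) by (simp add: dist_commute)
  show ?thesis
  proof
    show "min \<delta> d > 0" "x 0 = x0" using x d by auto
    show "x t \<in> S" if "\<bar>t\<bar> < min \<delta> d" for t using inb[of t] r(2) that by auto
    show "(x has_vector_derivative F (x t)) (at t)" if "\<bar>t\<bar> < min \<delta> d" for t
      using x(4)[of t] closest_point_self[OF inb[of t]] that by (simp add: G_def)
  qed
qed

section \<open>Smooth maps between manifolds\<close>

lemma atlas_chart: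
  assumes "smooth_atlas A" "(U, \<phi>) \<in> A"
  shows chart_open: "open U" and chart_image_open: "open (\<phi> ` U)"
    and chart_cont: "continuous_on U \<phi>" and chart_inv_cont: "continuous_on (\<phi> ` U) (inv_into U \<phi>)"
    and chart_inv: "\<And>x. x \<in> U \<Longrightarrow> inv_into U \<phi> (\<phi> x) = x"
    and chart_inj: "inj_on \<phi> U"
proof -
  have *: "open U" "open (\<phi> ` U)" "homeomorphism U (\<phi> ` U) \<phi> (inv_into U \<phi>)"
    using assms by (auto simp: smooth_atlas_def)
  then show "open U" "open (\<phi> ` U)" "continuous_on U \<phi>" "continuous_on (\<phi> ` U) (inv_into U \<phi>)"
    and 1: "\<And>x. x \<in> U \<Longrightarrow> inv_into U \<phi> (\<phi> x) = x"
    by (auto simp: homeomorphism_def)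
  show "inj_on \<phi> U" using 1 by (rule inj_on_inverseI)
qed

lemma atlas_cover:
  assumes "smooth_atlas A" obtains U \<phi> where "(U, \<phi>) \<in> A" "p \<in> U"
proof -
  have "p \<in> (\<Union>(U, \<phi>)\<in>A. U)" using assms by (simp add: smooth_atlas_def)
  then show ?thesis using that by auto
qed

lemma atlas_transition:
  assumes "smooth_atlas A" "(U, \<phi>) \<in> A" "(V, \<psi>) \<in> A"
  shows "smooth_on (\<phi> ` (U \<inter> V)) (\<lambda>x. \<psi> (inv_into U \<phi> x))"
proof -
  have "\<forall>(U, \<phi>)\<in>A. \<forall>(V, \<psi>)\<in>A. smooth_on (\<phi> ` (U \<inter> V)) (\<psi> \<circ> inv_into U \<phi>)"
    using assms(1) by (simp add: smooth_atlas_def)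
  then show ?thesis using assms(2,3) by (fastforce simp: o_def)
qed

lemma chart_open_image:
  assumes "smooth_atlas A" "(U, \<phi>) \<in> A" "open W" "W \<subseteq> U"
  shows "open (\<phi> ` W)"
proof -
  have "\<phi> ` W = \<phi> ` U \<inter> inv_into U \<phi> -` W"
    using assms chart_inv[OF assms(1,2)] by (auto simp: image_iff subset_iff)
  then show ?thesis
    using continuous_open_preimage[OF chart_inv_cont[OF assms(1,2)] chart_image_open[OF assms(1,2)] assms(3)]
    by simp
qed

lemma smooth_map_continuous: "smooth_map A B F \<Longrightarrow> continuous_on UNIV F"
  by (simp add: smooth_map_def)

lemma smooth_map_open_vimage: "smooth_map A B F \<Longrightarrow> open V \<Longrightarrow> open (F -` V)"
  by (rule open_vimage[OF _ smooth_map_continuous])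

lemma smooth_map_chart:
  assumes "smooth_map A B F" "(U, \<phi>) \<in> A" "(V, \<psi>) \<in> B"
  shows "smooth_on (\<phi> ` (U \<inter> F -` V)) (\<lambda>x. \<psi> (F (inv_into U \<phi> x)))"
proof -
  have "\<forall>(U, \<phi>)\<in>A. \<forall>(V, \<psi>)\<in>B. smooth_on (\<phi> ` (U \<inter> F -` V)) (\<psi> \<circ> F \<circ> inv_into U \<phi>)"
    using assms(1) by (simp add: smooth_map_def)
  then show ?thesis using assms(2,3) by (fastforce simp: o_def)
qed

text \<open>\<open>smooth_map\<close> quantifies over every pair of charts. One pair near each point
  suffices, because any other pair differs from it by transition maps; continuity is assumed
  separately since it makes the relevant preimages open.\<close>

lemma smooth_mapI_local:
  fixes A :: "('a::{t2_space,second_countable_topology}, 'd::euclidean_space) atlas"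
    and B :: "('b::{t2_space,second_countable_topology}, 'e::euclidean_space) atlas"
  assumes A: "smooth_atlas A" and B: "smooth_atlas B" and cont: "continuous_on UNIV F"
    and loc: "\<And>p. \<exists>U \<phi> V \<psi> W. (U, \<phi>) \<in> A \<and> (V, \<psi>) \<in> B \<and> open W \<and> p \<in> W \<and> W \<subseteq> U \<inter> F -` V \<and>
      smooth_on (\<phi> ` W) (\<lambda>x. \<psi> (F (inv_into U \<phi> x)))"
  shows "smooth_map A B F"
proof -
  have "smooth_on (\<phi>' ` (U' \<inter> F -` V')) (\<psi>' \<circ> F \<circ> inv_into U' \<phi>')"
    if U': "(U', \<phi>') \<in> A" and V': "(V', \<psi>') \<in> B" for U' \<phi>' V' \<psi>'
  proof (rule smooth_on_local)
    have opF: "open (F -` V')" using open_vimage[OF chart_open[OF B V'] cont] .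
    then show op: "open (\<phi>' ` (U' \<inter> F -` V'))"
      by (intro chart_open_image[OF A U'] open_Int chart_open[OF A U']) auto
    fix x assume "x \<in> \<phi>' ` (U' \<inter> F -` V')"
    then obtain p where p: "p \<in> U'" "F p \<in> V'" "x = \<phi>' p" by auto
    obtain U \<phi> V \<psi> W where UV: "(U, \<phi>) \<in> A" "(V, \<psi>) \<in> B" and W: "open W" "p \<in> W" "W \<subseteq> U \<inter> F -` V"
      and sm: "smooth_on (\<phi> ` W) (\<lambda>x. \<psi> (F (inv_into U \<phi> x)))"
      using loc[of p] by blast
    define N where "N = W \<inter> U' \<inter> F -` V'"
    have N: "open N" "N \<subseteq> U'" "N \<subseteq> U" "N \<subseteq> W" "p \<in> N"
      using W p opF chart_open[OF A U'] by (auto simp: N_def)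
    note inv = chart_inv[OF A UV(1)] chart_inv[OF B UV(2)] chart_inv[OF A U']
    have opN: "open (\<phi>' ` N)" by (rule chart_open_image[OF A U' N(1,2)])
    have opN2: "open (\<phi> ` N)" by (rule chart_open_image[OF A UV(1) N(1,3)])
    have 1: "smooth_on (\<phi>' ` N) (\<lambda>x. \<phi> (inv_into U' \<phi>' x))"
      by (rule smooth_on_subset[OF atlas_transition[OF A U' UV(1)]]) (use N in auto)
    have 2: "smooth_on (\<phi> ` N) (\<lambda>x. \<psi> (F (inv_into U \<phi> x)))"
      by (rule smooth_on_subset[OF sm]) (use N in auto)
    have 3: "smooth_on (\<phi>' ` N) (\<lambda>x. \<psi> (F (inv_into U \<phi> (\<phi> (inv_into U' \<phi>' x)))))"
      by (rule smooth_on_compose[OF opN opN2 1 2]) (use N inv in \<open>auto simp: subset_iff\<close>)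
    have 4: "smooth_on (\<phi>' ` N) (\<lambda>x. \<psi>' (inv_into V \<psi> (\<psi> (F (inv_into U \<phi> (\<phi> (inv_into U' \<phi>' x)))))))"
      by (rule smooth_on_compose[OF opN chart_open_image[OF B UV(2), of "V \<inter> V'"] 3 atlas_transition[OF B UV(2) V']])
        (use N W chart_open[OF B UV(2)] chart_open[OF B V'] inv in \<open>auto simp: N_def subset_iff\<close>)
    have "smooth_on (\<phi>' ` N) (\<psi>' \<circ> F \<circ> inv_into U' \<phi>')"
    proof (rule smooth_on_cong[OF opN _ 4])
      fix y assume "y \<in> \<phi>' ` N"
      then obtain q where q: "q \<in> N" "y = \<phi>' q" by auto
      have "q \<in> U'" "q \<in> U" "F q \<in> V" using q N W by (auto simp: N_def)
      then show "\<psi>' (inv_into V \<psi> (\<psi> (F (inv_into U \<phi> (\<phi> (inv_into U' \<phi>' y)))))) =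
          (\<psi>' \<circ> F \<circ> inv_into U' \<phi>') y"
        using q inv by simp
    qed
    moreover have "\<phi>' ` N \<inter> \<phi>' ` (U' \<inter> F -` V') = \<phi>' ` N" by (auto simp: N_def)
    ultimately show "\<exists>Y. open Y \<and> x \<in> Y \<and>
        smooth_on (Y \<inter> \<phi>' ` (U' \<inter> F -` V')) (\<psi>' \<circ> F \<circ> inv_into U' \<phi>')"
      using opN N(5) p(3) by (intro exI[of _ "\<phi>' ` N"]) auto
  qed
  then show ?thesis using cont by (auto simp: smooth_map_def)
qed

lemma smooth_map_id:
  assumes A: "smooth_atlas A" shows "smooth_map A A (\<lambda>x. x)"
proof (rule smooth_mapI_local[OF A A])
  fix p
  obtain U \<phi> where U: "(U, \<phi>) \<in> A" "p \<in> U" using atlas_cover[OF A] .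
  have "smooth_on (\<phi> ` U) (\<lambda>x. \<phi> (inv_into U \<phi> x))"
    using atlas_transition[OF A U(1) U(1)] by simp
  then show "\<exists>U \<phi> V \<psi> W. (U, \<phi>) \<in> A \<and> (V, \<psi>) \<in> A \<and> open W \<and> p \<in> W \<and> W \<subseteq> U \<inter> (\<lambda>x. x) -` V \<and>
      smooth_on (\<phi> ` W) (\<lambda>x. \<psi> (inv_into U \<phi> x))"
    using U chart_open[OF A U(1)]
    by (intro exI[of _ U] exI[of _ \<phi>]) auto
qed simp

lemma smooth_map_const:
  assumes A: "smooth_atlas A" and B: "smooth_atlas B" shows "smooth_map A B (\<lambda>x. c)"
proof (rule smooth_mapI_local[OF A B])
  fix p
  obtain U \<phi> where U: "(U, \<phi>) \<in> A" "p \<in> U" using atlas_cover[OF A] .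
  obtain V \<psi> where V: "(V, \<psi>) \<in> B" "c \<in> V" using atlas_cover[OF B] .
  have "smooth_on (\<phi> ` U) (\<lambda>x. \<psi> c)" by (rule smooth_on_const[OF chart_image_open[OF A U(1)]])
  then show "\<exists>U \<phi> V \<psi> W. (U, \<phi>) \<in> A \<and> (V, \<psi>) \<in> B \<and> open W \<and> p \<in> W \<and> W \<subseteq> U \<inter> (\<lambda>x. c) -` V \<and>
      smooth_on (\<phi> ` W) (\<lambda>x. \<psi> c)"
    using U V chart_open[OF A U(1)]
    by (intro exI[of _ U] exI[of _ \<phi>] exI[of _ V] exI[of _ \<psi>]) auto
qed simp

lemma smooth_map_compose:
  assumes A: "smooth_atlas A" and B: "smooth_atlas B" and C: "smooth_atlas C"
    and F: "smooth_map A B F" and H: "smooth_map B C H"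
  shows "smooth_map A C (\<lambda>x. H (F x))"
proof (rule smooth_mapI_local[OF A C])
  show "continuous_on UNIV (\<lambda>x. H (F x))"
    by (rule continuous_on_compose2[OF smooth_map_continuous[OF H] smooth_map_continuous[OF F]]) simp
  fix p
  obtain U \<phi> where U: "(U, \<phi>) \<in> A" "p \<in> U" using atlas_cover[OF A] .
  obtain V \<psi> where V: "(V, \<psi>) \<in> B" "F p \<in> V" using atlas_cover[OF B] .
  obtain X \<eta> where X: "(X, \<eta>) \<in> C" "H (F p) \<in> X" using atlas_cover[OF C] .
  define Y where "Y = V \<inter> H -` X"
  define W where "W = U \<inter> F -` Y"
  have Y: "open Y" unfolding Y_def
    by (intro open_Int chart_open[OF B V(1)] smooth_map_open_vimage[OF H] chart_open[OF C X(1)])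
  have W: "open W" unfolding W_def
    by (intro open_Int chart_open[OF A U(1)] smooth_map_open_vimage[OF F] Y)
  note inv = chart_inv[OF A U(1)] chart_inv[OF B V(1)]
  have 1: "smooth_on (\<phi> ` W) (\<lambda>x. \<psi> (F (inv_into U \<phi> x)))"
    by (rule smooth_on_subset[OF smooth_map_chart[OF F U(1) V(1)]]) (auto simp: W_def Y_def)
  have 2: "smooth_on (\<phi> ` W) (\<lambda>x. \<eta> (H (inv_into V \<psi> (\<psi> (F (inv_into U \<phi> x))))))"
    by (rule smooth_on_compose[OF chart_open_image[OF A U(1) W] chart_open_image[OF B V(1) Y] 1
          smooth_on_subset[OF smooth_map_chart[OF H V(1) X(1)]]])
      (auto simp: W_def Y_def inv)
  have "smooth_on (\<phi> ` W) (\<lambda>x. \<eta> (H (F (inv_into U \<phi> x))))"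
    by (rule smooth_on_cong[OF chart_open_image[OF A U(1) W] _ 2]) (auto simp: W_def Y_def inv)
  then show "\<exists>U \<phi> V \<psi> W. (U, \<phi>) \<in> A \<and> (V, \<psi>) \<in> C \<and> open W \<and> p \<in> W \<and> W \<subseteq> U \<inter> (\<lambda>x. H (F x)) -` V \<and>
      smooth_on (\<phi> ` W) (\<lambda>x. \<psi> (H (F (inv_into U \<phi> x))))"
    using U V X W by (intro exI[of _ U] exI[of _ \<phi>] exI[of _ X] exI[of _ \<eta>] exI[of _ W])
      (auto simp: W_def Y_def)
qed

lemma inv_into_map_prod:
  assumes "inj_on \<phi> U" "inj_on \<psi> V" "x \<in> \<phi> ` U" "y \<in> \<psi> ` V"
  shows "inv_into (U \<times> V) (map_prod \<phi> \<psi>) (x, y) = (inv_into U \<phi> x, inv_into V \<psi> y)"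
  by (rule inv_into_f_eq) (use assms in \<open>auto intro!: map_prod_inj_on simp: f_inv_into_f inv_into_into\<close>)

lemma smooth_atlas_prod:
  assumes A: "smooth_atlas A" and B: "smooth_atlas B"
  shows "smooth_atlas (prod_atlas A B)"
  unfolding smooth_atlas_def
proof (intro conjI)
  have "\<exists>(X, \<eta>)\<in>prod_atlas A B. p \<in> X" for p
  proof -
    obtain U \<phi> where U: "(U, \<phi>) \<in> A" "fst p \<in> U" using atlas_cover[OF A] .
    obtain V \<psi> where V: "(V, \<psi>) \<in> B" "snd p \<in> V" using atlas_cover[OF B] .
    have "(U \<times> V, map_prod \<phi> \<psi>) \<in> prod_atlas A B" using U V by (auto simp: prod_atlas_def)
    moreover have "p \<in> U \<times> V" using U V by (auto simp: mem_Times_iff)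
    ultimately show ?thesis by (intro bexI[of _ "(U \<times> V, map_prod \<phi> \<psi>)"]) simp_all
  qed
  then show "(\<Union>(U, \<phi>)\<in>prod_atlas A B. U) = UNIV" by auto
  have im: "map_prod \<phi> \<psi> ` (U \<times> V) = \<phi> ` U \<times> \<psi> ` V" for \<phi> :: "'a \<Rightarrow> 'b" and \<psi> :: "'c \<Rightarrow> 'd" and U V
    by auto
  have inveq: "inv_into (U \<times> V) (map_prod \<phi> \<psi>) z = (inv_into U \<phi> (fst z), inv_into V \<psi> (snd z))"
    if "(U, \<phi>) \<in> A" "(V, \<psi>) \<in> B" "z \<in> \<phi> ` U \<times> \<psi> ` V" for U \<phi> V \<psi> z
    using inv_into_map_prod[OF chart_inj[OF A that(1)] chart_inj[OF B that(2)], of "fst z" "snd z"] that(3)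
    by (simp add: mem_Times_iff)
  have "open X \<and> open (\<eta> ` X) \<and> homeomorphism X (\<eta> ` X) \<eta> (inv_into X \<eta>)" if X: "(X, \<eta>) \<in> prod_atlas A B" for X \<eta>
  proof -
    obtain U \<phi> V \<psi> where eq: "X = U \<times> V" "\<eta> = map_prod \<phi> \<psi>" and UV: "(U, \<phi>) \<in> A" "(V, \<psi>) \<in> B"
      using X unfolding prod_atlas_def by blast
    have inj: "inj_on \<eta> X" unfolding eq
      by (intro map_prod_inj_on chart_inj[OF A UV(1)] chart_inj[OF B UV(2)])
    have "continuous_on X \<eta>" unfolding eq map_prod_def split_beta
      by (intro continuous_on_Pair continuous_on_compose2[OF chart_cont[OF A UV(1)]]
          continuous_on_compose2[OF chart_cont[OF B UV(2)]] continuous_intros) auto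
    moreover have "continuous_on (\<eta> ` X) (inv_into X \<eta>)"
    proof (rule continuous_on_cong[THEN iffD2, OF refl])
      show "inv_into X \<eta> z = (inv_into U \<phi> (fst z), inv_into V \<psi> (snd z))" if "z \<in> \<eta> ` X" for z
        using that unfolding eq im by (rule inveq[OF UV])
      show "continuous_on (\<eta> ` X) (\<lambda>z. (inv_into U \<phi> (fst z), inv_into V \<psi> (snd z)))"
        unfolding eq im
        by (intro continuous_on_Pair continuous_on_compose2[OF chart_inv_cont[OF A UV(1)]]
            continuous_on_compose2[OF chart_inv_cont[OF B UV(2)]] continuous_intros) auto
    qed
    ultimately have "homeomorphism X (\<eta> ` X) \<eta> (inv_into X \<eta>)"
      using inj by (auto simp: homeomorphism_def inv_into_into f_inv_into_f image_iff)
    moreover have "open X" "open (\<eta> ` X)"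
      unfolding eq im using UV chart_open[OF A] chart_open[OF B] chart_image_open[OF A] chart_image_open[OF B]
      by (auto intro: open_Times)
    ultimately show ?thesis by simp
  qed
  then show "\<forall>(U, \<phi>)\<in>prod_atlas A B. open U \<and> open (\<phi> ` U) \<and> homeomorphism U (\<phi> ` U) \<phi> (inv_into U \<phi>)"
    by auto
  have "smooth_on (map_prod \<phi> \<psi> ` ((U \<times> V) \<inter> (U' \<times> V'))) (map_prod \<phi>' \<psi>' \<circ> inv_into (U \<times> V) (map_prod \<phi> \<psi>))"
    if UV: "(U, \<phi>) \<in> A" "(V, \<psi>) \<in> B" "(U', \<phi>') \<in> A" "(V', \<psi>') \<in> B" for U \<phi> V \<psi> U' \<phi>' V' \<psi>'
  proof -
    have S: "map_prod \<phi> \<psi> ` ((U \<times> V) \<inter> (U' \<times> V')) = \<phi> ` (U \<inter> U') \<times> \<psi> ` (V \<inter> V')" (is "_ = ?S")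
      by auto
    have op1: "open (\<phi> ` (U \<inter> U'))" "open (\<psi> ` (V \<inter> V'))"
      using UV chart_open[OF A] chart_open[OF B]
      by (auto intro!: chart_open_image[OF A UV(1)] chart_open_image[OF B UV(2)])
    then have op: "open ?S" by (rule open_Times)
    have "smooth_on ?S (\<lambda>z. (\<phi>' (inv_into U \<phi> (fst z)), \<psi>' (inv_into V \<psi> (snd z))))"
      by (intro smooth_on_Pair op smooth_on_compose[OF op op1(1) _ atlas_transition[OF A UV(1,3)]]
          smooth_on_compose[OF op op1(2) _ atlas_transition[OF B UV(2,4)]]
          smooth_on_bounded_linear bounded_linear_fst bounded_linear_snd) auto
    then show ?thesis unfolding S
      by (rule smooth_on_cong[OF op, rotated]) (auto simp: inveq[OF UV(1,2)])
  qed
  then show "\<forall>(U, \<phi>)\<in>prod_atlas A B. \<forall>(V, \<psi>)\<in>prod_atlas A B. smooth_on (\<phi> ` (U \<inter> V)) (\<psi> \<circ> inv_into U \<phi>)"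
    by (auto simp: prod_atlas_def)
qed

lemma smooth_map_Pair:
  assumes A: "smooth_atlas A" and B: "smooth_atlas B" and C: "smooth_atlas C"
    and F: "smooth_map A B F" and H: "smooth_map A C H"
  shows "smooth_map A (prod_atlas B C) (\<lambda>x. (F x, H x))"
proof (rule smooth_mapI_local[OF A smooth_atlas_prod[OF B C]])
  show "continuous_on UNIV (\<lambda>x. (F x, H x))"
    by (intro continuous_on_Pair smooth_map_continuous[OF F] smooth_map_continuous[OF H])
  fix p
  obtain U \<phi> where U: "(U, \<phi>) \<in> A" "p \<in> U" using atlas_cover[OF A] .
  obtain V \<psi> where V: "(V, \<psi>) \<in> B" "F p \<in> V" using atlas_cover[OF B] .
  obtain X \<eta> where X: "(X, \<eta>) \<in> C" "H p \<in> X" using atlas_cover[OF C] .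
  define W where "W = U \<inter> F -` V \<inter> H -` X"
  have W: "open W" unfolding W_def
    by (intro open_Int chart_open[OF A U(1)] smooth_map_open_vimage[OF F] smooth_map_open_vimage[OF H]
        chart_open[OF B V(1)] chart_open[OF C X(1)])
  have op: "open (\<phi> ` W)" by (rule chart_open_image[OF A U(1) W]) (auto simp: W_def)
  have "smooth_on (\<phi> ` W) (\<lambda>x. (\<psi> (F (inv_into U \<phi> x)), \<eta> (H (inv_into U \<phi> x))))"
    by (rule smooth_on_Pair[OF op smooth_on_subset[OF smooth_map_chart[OF F U(1) V(1)]]
          smooth_on_subset[OF smooth_map_chart[OF H U(1) X(1)]]]) (auto simp: W_def)
  then show "\<exists>U \<phi> V \<psi> W. (U, \<phi>) \<in> A \<and> (V, \<psi>) \<in> prod_atlas B C \<and> open W \<and> p \<in> W \<and>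
      W \<subseteq> U \<inter> (\<lambda>x. (F x, H x)) -` V \<and> smooth_on (\<phi> ` W) (\<lambda>x. \<psi> (F (inv_into U \<phi> x), H (inv_into U \<phi> x)))"
    using U V X W by (intro exI[of _ U] exI[of _ \<phi>] exI[of _ "V \<times> X"] exI[of _ "map_prod \<psi> \<eta>"] exI[of _ W])
      (auto simp: W_def prod_atlas_def)
qed

lemma smooth_map_fst:
  assumes A: "smooth_atlas A" and B: "smooth_atlas B"
  shows "smooth_map (prod_atlas A B) A fst"
proof (rule smooth_mapI_local[OF smooth_atlas_prod[OF A B] A])
  fix p :: "'a \<times> 'c"
  obtain U \<phi> where U: "(U, \<phi>) \<in> A" "fst p \<in> U" using atlas_cover[OF A] .
  obtain V \<psi> where V: "(V, \<psi>) \<in> B" "snd p \<in> V" using atlas_cover[OF B] .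
  have op: "open (\<phi> ` U \<times> \<psi> ` V)"
    by (intro open_Times chart_image_open[OF A U(1)] chart_image_open[OF B V(1)])
  have im: "map_prod \<phi> \<psi> ` (U \<times> V) = \<phi> ` U \<times> \<psi> ` V" by auto
  have "smooth_on (map_prod \<phi> \<psi> ` (U \<times> V)) (\<lambda>x. \<phi> (fst (inv_into (U \<times> V) (map_prod \<phi> \<psi>) x)))"
    unfolding im
    by (rule smooth_on_cong[OF op _ smooth_on_bounded_linear[OF bounded_linear_fst op]])
      (auto simp: inv_into_map_prod chart_inj[OF A U(1)] chart_inj[OF B V(1)] f_inv_into_f
        chart_inv[OF A U(1)])
  then show "\<exists>U' \<phi>' V' \<psi>' W. (U', \<phi>') \<in> prod_atlas A B \<and> (V', \<psi>') \<in> A \<and> open W \<and> p \<in> W \<and>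
      W \<subseteq> U' \<inter> fst -` V' \<and> smooth_on (\<phi>' ` W) (\<lambda>x. \<psi>' (fst (inv_into U' \<phi>' x)))"
    using U V chart_open[OF A U(1)] chart_open[OF B V(1)]
    by (intro exI[of _ "U \<times> V"] exI[of _ "map_prod \<phi> \<psi>"] exI[of _ U] exI[of _ \<phi>])
      (auto simp: prod_atlas_def mem_Times_iff open_Times)
qed (simp add: continuous_on_fst)

lemma smooth_map_snd:
  assumes A: "smooth_atlas A" and B: "smooth_atlas B"
  shows "smooth_map (prod_atlas A B) B snd"
proof (rule smooth_mapI_local[OF smooth_atlas_prod[OF A B] B])
  fix p :: "'a \<times> 'c"
  obtain U \<phi> where U: "(U, \<phi>) \<in> A" "fst p \<in> U" using atlas_cover[OF A] .
  obtain V \<psi> where V: "(V, \<psi>) \<in> B" "snd p \<in> V" using atlas_cover[OF B] .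
  have op: "open (\<phi> ` U \<times> \<psi> ` V)"
    by (intro open_Times chart_image_open[OF A U(1)] chart_image_open[OF B V(1)])
  have im: "map_prod \<phi> \<psi> ` (U \<times> V) = \<phi> ` U \<times> \<psi> ` V" by auto
  have "smooth_on (map_prod \<phi> \<psi> ` (U \<times> V)) (\<lambda>x. \<psi> (snd (inv_into (U \<times> V) (map_prod \<phi> \<psi>) x)))"
    unfolding im
    by (rule smooth_on_cong[OF op _ smooth_on_bounded_linear[OF bounded_linear_snd op]])
      (auto simp: inv_into_map_prod chart_inj[OF A U(1)] chart_inj[OF B V(1)] f_inv_into_f
        chart_inv[OF B V(1)])
  then show "\<exists>U' \<phi>' V' \<psi>' W. (U', \<phi>') \<in> prod_atlas A B \<and> (V', \<psi>') \<in> B \<and> open W \<and> p \<in> W \<and>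
      W \<subseteq> U' \<inter> snd -` V' \<and> smooth_on (\<phi>' ` W) (\<lambda>x. \<psi>' (snd (inv_into U' \<phi>' x)))"
    using U V chart_open[OF A U(1)] chart_open[OF B V(1)]
    by (intro exI[of _ "U \<times> V"] exI[of _ "map_prod \<phi> \<psi>"] exI[of _ V] exI[of _ \<psi>])
      (auto simp: prod_atlas_def mem_Times_iff open_Times)
qed (simp add: continuous_on_snd)

section \<open>Smooth functions and bump functions\<close>

lemma smooth_atlas_euclidean: "smooth_atlas euclidean_atlas"
proof -
  have "inv_into UNIV id = id" by (auto simp: fun_eq_iff inv_into_f_eq)
  then show ?thesis
    using smooth_on_bounded_linear[OF bounded_linear_ident open_UNIV]
    by (auto simp: smooth_atlas_def euclidean_atlas_def homeomorphism_def id_def o_def)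
qed

lemma smooth_fun_chart:
  assumes "smooth_fun A f" "(U, \<phi>) \<in> A"
  shows "smooth_on (\<phi> ` U) (\<lambda>x. f (inv_into U \<phi> x))"
  using smooth_map_chart[OF assms, of UNIV id] by (simp add: euclidean_atlas_def)

lemma smooth_funI_local:
  assumes A: "smooth_atlas A"
    and loc: "\<And>p. \<exists>U \<phi> W. (U, \<phi>) \<in> A \<and> open W \<and> p \<in> W \<and> W \<subseteq> U \<and>
      smooth_on (\<phi> ` W) (\<lambda>x. f (inv_into U \<phi> x))"
  shows "smooth_fun A f"
proof (rule smooth_mapI_local[OF A smooth_atlas_euclidean])
  show "continuous_on UNIV f"
  proof (rule continuous_at_imp_continuous_on, intro ballI)
    fix p
    obtain U \<phi> W where U: "(U, \<phi>) \<in> A" and W: "open W" "p \<in> W" "W \<subseteq> U"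
      and sm: "smooth_on (\<phi> ` W) (\<lambda>x. f (inv_into U \<phi> x))"
      using loc[of p] by blast
    have "continuous_on W (\<lambda>x. f (inv_into U \<phi> (\<phi> x)))"
      by (rule continuous_on_compose2[OF smooth_on_continuous_on[OF sm]
            continuous_on_subset[OF chart_cont[OF A U] W(3)]]) auto
    then have "continuous_on W f"
      by (rule continuous_on_cong[THEN iffD1, OF refl, rotated]) (use chart_inv[OF A U] W in auto)
    then show "isCont f p" using W by (simp add: continuous_on_eq_continuous_at)
  qed
  show "\<exists>U \<phi> V \<psi> W. (U, \<phi>) \<in> A \<and> (V, \<psi>) \<in> euclidean_atlas \<and> open W \<and> p \<in> W \<and> W \<subseteq> U \<inter> f -` V \<and>
      smooth_on (\<phi> ` W) (\<lambda>x. \<psi> (f (inv_into U \<phi> x)))" for p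
  proof -
    obtain U \<phi> W where "(U, \<phi>) \<in> A" "open W" "p \<in> W" "W \<subseteq> U"
      "smooth_on (\<phi> ` W) (\<lambda>x. f (inv_into U \<phi> x))"
      using loc[of p] by blast
    then show ?thesis
      by (intro exI[of _ U] exI[of _ \<phi>] exI[of _ UNIV] exI[of _ id] exI[of _ W])
        (auto simp: euclidean_atlas_def)
  qed
qed

lemma smooth_funI:
  assumes A: "smooth_atlas A"
    and sm: "\<And>U \<phi>. (U, \<phi>) \<in> A \<Longrightarrow> smooth_on (\<phi> ` U) (\<lambda>x. f (inv_into U \<phi> x))"
  shows "smooth_fun A f"
proof (rule smooth_funI_local[OF A])
  fix p
  obtain U \<phi> where "(U, \<phi>) \<in> A" "p \<in> U" using atlas_cover[OF A] .
  then show "\<exists>U \<phi> W. (U, \<phi>) \<in> A \<and> open W \<and> p \<in> W \<and> W \<subseteq> U \<and>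
      smooth_on (\<phi> ` W) (\<lambda>x. f (inv_into U \<phi> x))"
    using sm chart_open[OF A] by blast
qed

lemma smooth_fun_const: "smooth_atlas A \<Longrightarrow> smooth_fun A (\<lambda>x. c)"
  by (rule smooth_map_const[OF _ smooth_atlas_euclidean])

lemma smooth_fun_add:
  assumes A: "smooth_atlas A" and "smooth_fun A f" "smooth_fun A h"
  shows "smooth_fun A (\<lambda>x. f x + h x)"
proof (rule smooth_funI[OF A])
  fix U \<phi> assume U: "(U, \<phi>) \<in> A"
  show "smooth_on (\<phi> ` U) (\<lambda>x. f (inv_into U \<phi> x) + h (inv_into U \<phi> x))"
    by (rule smooth_on_add[OF chart_image_open[OF A U] smooth_fun_chart[OF assms(2) U]
          smooth_fun_chart[OF assms(3) U]])
qed

lemma smooth_fun_mult: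
  assumes A: "smooth_atlas A" and "smooth_fun A f" "smooth_fun A h"
  shows "smooth_fun A (\<lambda>x. f x * h x)"
proof (rule smooth_funI[OF A])
  fix U \<phi> assume U: "(U, \<phi>) \<in> A"
  show "smooth_on (\<phi> ` U) (\<lambda>x. f (inv_into U \<phi> x) * h (inv_into U \<phi> x))"
    by (rule smooth_on_mult[OF chart_image_open[OF A U] smooth_fun_chart[OF assms(2) U]
          smooth_fun_chart[OF assms(3) U]])
qed

lemma smooth_fun_sum:
  assumes A: "smooth_atlas A"
  shows "finite I \<Longrightarrow> (\<And>i. i \<in> I \<Longrightarrow> smooth_fun A (f i)) \<Longrightarrow> smooth_fun A (\<lambda>x. \<Sum>i\<in>I. f i x)"
  by (induction I rule: finite_induct) (simp_all add: smooth_fun_const[OF A] smooth_fun_add[OF A])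

lemma smooth_fun_compose:
  "smooth_atlas A \<Longrightarrow> smooth_atlas B \<Longrightarrow> smooth_map A B F \<Longrightarrow> smooth_fun B f \<Longrightarrow> smooth_fun A (\<lambda>x. f (F x))"
  by (rule smooth_map_compose[OF _ _ smooth_atlas_euclidean])

text \<open>Multiplies by a bump function in the chart and extends by zero. Smoothness off
  \<open>W\<close> needs the support \<open>K\<close> to be closed in the whole manifold, which
  holds since it is compact in a Hausdorff space. Functions known only near a point thus become
  arguments for derivations, which act on global functions.\<close>

lemma smooth_extension:
  fixes A :: "('a::{t2_space,second_countable_topology}, 'd::euclidean_space) atlas"
  assumes A: "smooth_atlas A" and U: "(U, \<phi>) \<in> A" and W: "open W" "p \<in> W" "W \<subseteq> U"
    and q: "smooth_on (\<phi> ` W) q"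
  obtains f N where "smooth_fun A f" "open N" "p \<in> N" "N \<subseteq> W"
    "\<And>x. x \<in> N \<Longrightarrow> f x = q (\<phi> x)" "\<And>x. x \<notin> W \<Longrightarrow> f x = 0"
proof -
  have opW: "open (\<phi> ` W)" by (rule chart_open_image[OF A U W(1,3)])
  moreover have "\<phi> p \<in> \<phi> ` W" using W by blast
  ultimately obtain r where r: "r > 0" "cball (\<phi> p) r \<subseteq> \<phi> ` W"
    using open_contains_cball by blast
  obtain \<beta> :: "'d \<Rightarrow> real" where \<beta>: "smooth_on UNIV \<beta>"
    "\<And>x. x \<in> ball (\<phi> p) (r / 2) \<Longrightarrow> \<beta> x = 1" "\<And>x. x \<notin> cball (\<phi> p) r \<Longrightarrow> \<beta> x = 0"
    using smooth_bump[OF r(1)] by blast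
  define f where "f x = (if x \<in> W then \<beta> (\<phi> x) * q (\<phi> x) else 0)" for x
  define K where "K = inv_into U \<phi> ` cball (\<phi> p) r"
  have "compact K" unfolding K_def
    by (rule compact_continuous_image[OF continuous_on_subset[OF chart_inv_cont[OF A U]]])
      (use r W(3) in auto)
  then have K: "closed K" by (rule compact_imp_closed)
  have KU: "K \<subseteq> W"
    using r(2) W(3) chart_inv[OF A U] by (fastforce simp: K_def)
  have offK: "f x = 0" if "x \<notin> K" for x
  proof (cases "x \<in> W")
    case True
    then have "\<phi> x \<notin> cball (\<phi> p) r"
      using that chart_inv[OF A U, of x] W(3) by (force simp: K_def)
    then show ?thesis using \<beta>(3) by (simp add: f_def)
  qed (simp add: f_def)
  define N where "N = W \<inter> (U \<inter> \<phi> -` ball (\<phi> p) (r / 2))"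
  show ?thesis
  proof
    show "smooth_fun A f"
    proof (rule smooth_funI_local[OF A])
      fix x
      show "\<exists>U \<phi> W. (U, \<phi>) \<in> A \<and> open W \<and> x \<in> W \<and> W \<subseteq> U \<and>
          smooth_on (\<phi> ` W) (\<lambda>x. f (inv_into U \<phi> x))"
      proof (cases "x \<in> W")
        case True
        have "smooth_on (\<phi> ` W) (\<lambda>y. \<beta> y * q y)"
          by (rule smooth_on_mult[OF opW smooth_on_subset[OF \<beta>(1) subset_UNIV] q])
        then have "smooth_on (\<phi> ` W) (\<lambda>y. f (inv_into U \<phi> y))"
          by (rule smooth_on_cong[OF opW, rotated])
            (use chart_inv[OF A U] W(3) in \<open>auto simp: f_def\<close>)
        then show ?thesis using U True W by blast
      next
        case False
        obtain V \<psi> where V: "(V, \<psi>) \<in> A" "x \<in> V" using atlas_cover[OF A] .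
        have op: "open (V - K)" using chart_open[OF A V(1)] K by (rule open_Diff)
        have op2: "open (\<psi> ` (V - K))" by (rule chart_open_image[OF A V(1) op]) auto
        have "smooth_on (\<psi> ` (V - K)) (\<lambda>y. f (inv_into V \<psi> y))"
          by (rule smooth_on_cong[OF op2 _ smooth_on_const[OF op2, where c=0]])
            (use chart_inv[OF A V(1)] offK in auto)
        moreover have "x \<in> V - K" using V False KU by auto
        ultimately show ?thesis using V op by blast
      qed
    qed
    have "open (U \<inter> \<phi> -` ball (\<phi> p) (r / 2))"
      by (rule continuous_open_preimage[OF chart_cont[OF A U] chart_open[OF A U] open_ball])
    then show "open N" unfolding N_def using W(1) chart_open[OF A U] by (simp only: open_Int)
    show "p \<in> N" "N \<subseteq> W" using U W r by (auto simp: N_def)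
    show "f x = q (\<phi> x)" if "x \<in> N" for x using that \<beta>(2) by (simp add: f_def N_def)
    show "f x = 0" if "x \<notin> W" for x using that offK KU by blast
  qed
qed

section \<open>Tangent vectors in charts\<close>

text \<open>The vector with coordinates \<open>\<xi>\<close> in the chart. The default
  \<open>0\<close> is the one prescribed by \<open>tangent_space\<close>, so that it can equal a
  derivation as an operator.\<close>

definition chart_vec ::
    "('a::topological_space, 'e::euclidean_space) atlas \<Rightarrow> 'a set \<Rightarrow> ('a \<Rightarrow> 'e) \<Rightarrow> 'a \<Rightarrow> 'e \<Rightarrow> 'a tangent" where
  "chart_vec A U \<phi> p \<xi> = (\<lambda>f. if smooth_fun A f
     then frechet_derivative (\<lambda>x. f (inv_into U \<phi> x)) (at (\<phi> p)) \<xi> else 0)"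

lemma smooth_fun_chart_derivative:
  assumes "smooth_atlas A" "(U, \<phi>) \<in> A" "p \<in> U" "smooth_fun A f"
  shows "((\<lambda>x. f (inv_into U \<phi> x)) has_derivative
    frechet_derivative (\<lambda>x. f (inv_into U \<phi> x)) (at (\<phi> p))) (at (\<phi> p))"
  by (rule smooth_on_has_derivative[OF smooth_fun_chart[OF assms(4,2)]]) (use assms(3) in auto)

lemma chart_vecI:
  assumes "smooth_fun A f" "((\<lambda>x. f (inv_into U \<phi> x)) has_derivative f') (at (\<phi> p))"
  shows "chart_vec A U \<phi> p \<xi> f = f' \<xi>"
  using assms frechet_derivative_at[OF assms(2)] by (simp add: chart_vec_def)

lemma chart_vec_linear:
  assumes "smooth_atlas A" "(U, \<phi>) \<in> A" "p \<in> U"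
  shows "linear (\<lambda>\<xi>. chart_vec A U \<phi> p \<xi> f)"
proof (cases "smooth_fun A f")
  case True
  then show ?thesis
    using has_derivative_linear[OF smooth_fun_chart_derivative[OF assms True]] by (simp add: chart_vec_def)
next
  case False
  then show ?thesis by (simp add: chart_vec_def linear_zero)
qed

lemma chart_vec_tangent:
  assumes A: "smooth_atlas A" and U: "(U, \<phi>) \<in> A" "p \<in> U"
  shows "chart_vec A U \<phi> p \<xi> \<in> tangent_space A p"
proof -
  let ?D = "\<lambda>f. frechet_derivative (\<lambda>x. f (inv_into U \<phi> x)) (at (\<phi> p))"
  note der = smooth_fun_chart_derivative[OF A U]
  have "chart_vec A U \<phi> p \<xi> (\<lambda>x. f x + h x) = chart_vec A U \<phi> p \<xi> f + chart_vec A U \<phi> p \<xi> h"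
    if "smooth_fun A f" "smooth_fun A h" for f h
    using chart_vecI[OF smooth_fun_add[OF A that] has_derivative_add[OF der[OF that(1)] der[OF that(2)]]] that
    by (simp add: chart_vec_def)
  moreover have "chart_vec A U \<phi> p \<xi> (\<lambda>x. c * f x) = c * chart_vec A U \<phi> p \<xi> f"
    if "smooth_fun A f" for c f
    using chart_vecI[OF smooth_fun_mult[OF A smooth_fun_const[OF A] that]
        has_derivative_mult_right[OF der[OF that]]] that
    by (simp add: chart_vec_def)
  moreover have "chart_vec A U \<phi> p \<xi> (\<lambda>x. f x * h x) =
      chart_vec A U \<phi> p \<xi> f * h p + f p * chart_vec A U \<phi> p \<xi> h"
    if "smooth_fun A f" "smooth_fun A h" for f h
    using chart_vecI[OF smooth_fun_mult[OF A that] has_derivative_mult[OF der[OF that(1)] der[OF that(2)]]] that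
      chart_inv[OF A U(1,2)]
    by (simp add: chart_vec_def)
  ultimately show ?thesis by (simp add: tangent_space_def chart_vec_def)
qed

context
  fixes A :: "('a::{t2_space,second_countable_topology}, 'e::euclidean_space) atlas" and v p
  assumes A: "smooth_atlas A" and v: "v \<in> tangent_space A p"
begin

lemma tangent_add: "smooth_fun A f \<Longrightarrow> smooth_fun A h \<Longrightarrow> v (\<lambda>x. f x + h x) = v f + v h"
  and tangent_scale: "smooth_fun A f \<Longrightarrow> v (\<lambda>x. c * f x) = c * v f"
  and tangent_mult: "smooth_fun A f \<Longrightarrow> smooth_fun A h \<Longrightarrow> v (\<lambda>x. f x * h x) = v f * h p + f p * v h"
  and tangent_nonsmooth: "\<not> smooth_fun A f \<Longrightarrow> v f = 0"
  using v by (simp_all add: tangent_space_def)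

lemma tangent_const: "v (\<lambda>x. c) = 0"
proof -
  have "v (\<lambda>x. 1 * 1) = v (\<lambda>x. 1) * 1 + 1 * v (\<lambda>x. 1)"
    by (rule tangent_mult) (rule smooth_fun_const[OF A])+
  then have "v (\<lambda>x. 1) = 0" by simp
  then show ?thesis using tangent_scale[OF smooth_fun_const[OF A], of c 1] by simp
qed

lemma tangent_sum:
  "finite I \<Longrightarrow> (\<And>i. i \<in> I \<Longrightarrow> smooth_fun A (f i)) \<Longrightarrow> v (\<lambda>x. \<Sum>i\<in>I. f i x) = (\<Sum>i\<in>I. v (f i))"
  by (induction I rule: finite_induct) (simp_all add: tangent_const tangent_add smooth_fun_sum[OF A])

text \<open>For a bump \<open>\<rho>\<close> supported in \<open>N\<close> the products of
  \<open>\<rho>\<close> with \<open>f\<close> and \<open>h\<close> coincide globally; the Leibniz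
  rule at \<open>p\<close>, where \<open>\<rho>\<close> is \<open>1\<close>, carries this over to
  \<open>v\<close>.\<close>

lemma tangent_local:
  assumes "smooth_fun A f" "smooth_fun A h" "open N" "p \<in> N" "\<And>x. x \<in> N \<Longrightarrow> f x = h x"
  shows "v f = v h"
proof -
  obtain U \<phi> where U: "(U, \<phi>) \<in> A" "p \<in> U" using atlas_cover[OF A] .
  have W: "open (N \<inter> U)" "p \<in> N \<inter> U" "N \<inter> U \<subseteq> U" using assms(3,4) U chart_open[OF A U(1)] by auto
  obtain \<rho> N' where \<rho>: "smooth_fun A \<rho>" "p \<in> N'" "N' \<subseteq> N \<inter> U"
    "\<And>x. x \<in> N' \<Longrightarrow> \<rho> x = 1" "\<And>x. x \<notin> N \<inter> U \<Longrightarrow> \<rho> x = 0"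
    using smooth_extension[OF A U(1) W smooth_on_const[OF chart_open_image[OF A U(1) W(1,3)], where c="1::real"]]
    by metis
  have "(\<lambda>x. \<rho> x * f x) = (\<lambda>x. \<rho> x * h x)"
  proof
    fix x show "\<rho> x * f x = \<rho> x * h x" using \<rho>(5)[of x] assms(5)[of x] by (cases "x \<in> N \<inter> U") auto
  qed
  then have "v \<rho> * f p + \<rho> p * v f = v \<rho> * h p + \<rho> p * v h"
    using tangent_mult[OF \<rho>(1) assms(1)] tangent_mult[OF \<rho>(1) assms(2)] by simp
  then show ?thesis using \<rho>(4)[OF \<rho>(2)] assms(5)[OF assms(4)] by simp
qed

end

lemma coordinate_functions:
  fixes A :: "('a::{t2_space,second_countable_topology}, 'e::euclidean_space) atlas"
  assumes A: "smooth_atlas A" and U: "(U, \<phi>) \<in> A" "p \<in> U"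
  obtains e N where "\<And>b. b \<in> Basis \<Longrightarrow> smooth_fun A (e b)" "open N" "p \<in> N" "N \<subseteq> U"
    "\<And>b x. b \<in> Basis \<Longrightarrow> x \<in> N \<Longrightarrow> e b x = \<phi> x \<bullet> b"
proof -
  have "\<exists>f N. smooth_fun A f \<and> open N \<and> p \<in> N \<and> N \<subseteq> U \<and> (\<forall>x\<in>N. f x = \<phi> x \<bullet> b)" for b
  proof -
    have "smooth_on (\<phi> ` U) (\<lambda>x. x \<bullet> b)"
      by (rule smooth_on_bounded_linear[OF bounded_linear_inner_left chart_image_open[OF A U(1)]])
    then show ?thesis
      by (rule smooth_extension[OF A U(1) chart_open[OF A U(1)] U(2) subset_refl]) blast
  qed
  then obtain e N where eN: "\<And>b. smooth_fun A (e b) \<and> open (N b) \<and> p \<in> N b \<and> N b \<subseteq> U \<and>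
      (\<forall>x\<in>N b. e b x = \<phi> x \<bullet> b)" by metis
  show ?thesis
  proof
    show "open (\<Inter>b\<in>Basis. N b)" using eN by (intro open_INT) auto
    show "(\<Inter>b\<in>Basis. N b) \<subseteq> U" using eN nonempty_Basis by blast
    show "smooth_fun A (e b)" for b by (rule eN[THEN conjunct1])
    show "p \<in> (\<Inter>b\<in>Basis. N b)" using eN by blast
    show "e b x = \<phi> x \<bullet> b" if "b \<in> Basis" "x \<in> (\<Inter>b\<in>Basis. N b)" for b x
      using eN[of b] that by blast
  qed
qed

text \<open>Hadamard's lemma writes \<open>f\<close> near \<open>p\<close> as a constant plus
  products of coordinate increments, which vanish at \<open>p\<close>, with smooth coefficients. The
  Leibniz rule leaves the values of \<open>v\<close> on the coordinates times the partial
  derivatives of \<open>f\<close>, so those values are the vector \<open>\<xi>\<close>.\<close>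

lemma tangent_is_chart_vec:
  fixes A :: "('a::{t2_space,second_countable_topology}, 'e::euclidean_space) atlas"
  assumes A: "smooth_atlas A" and U: "(U, \<phi>) \<in> A" "p \<in> U" and v: "v \<in> tangent_space A p"
  obtains \<xi> where "v = chart_vec A U \<phi> p \<xi>"
proof -
  obtain e N where e: "\<And>b. b \<in> Basis \<Longrightarrow> smooth_fun A (e b)" and N: "open N" "p \<in> N" "N \<subseteq> U"
    and eN: "\<And>b x. b \<in> Basis \<Longrightarrow> x \<in> N \<Longrightarrow> e b x = \<phi> x \<bullet> b"
    using coordinate_functions[OF A U] by metis
  define \<xi> where "\<xi> = (\<Sum>b\<in>Basis. v (e b) *\<^sub>R b)"
  have "v f = chart_vec A U \<phi> p \<xi> f" if f: "smooth_fun A f" for f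
  proof -
    let ?F = "\<lambda>x. f (inv_into U \<phi> x)"
    have op: "open (\<phi> ` N)" by (rule chart_open_image[OF A U(1) N(1,3)])
    obtain r where r: "r > 0" "ball (\<phi> p) r \<subseteq> \<phi> ` N"
      using op N(2) open_contains_ball by blast
    have "smooth_on (ball (\<phi> p) r) ?F"
      by (rule smooth_on_subset[OF smooth_fun_chart[OF f U(1)]]) (use r N in auto)
    then obtain h where h: "\<And>b. smooth_on (ball (\<phi> p) r) (h b)"
      "\<And>x. x \<in> ball (\<phi> p) r \<Longrightarrow> ?F x = ?F (\<phi> p) + (\<Sum>b\<in>Basis. ((x - \<phi> p) \<bullet> b) * h b x)"
      "\<And>b. h b (\<phi> p) = frechet_derivative ?F (at (\<phi> p)) b"
      using hadamard by blast
    define W where "W = N \<inter> (U \<inter> \<phi> -` ball (\<phi> p) r)"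
    have W: "open W" "p \<in> W" "W \<subseteq> U" unfolding W_def
      using N r U continuous_open_preimage[OF chart_cont[OF A U(1)] chart_open[OF A U(1)] open_ball]
      by (auto intro: open_Int)
    have "\<exists>k M. smooth_fun A k \<and> open M \<and> p \<in> M \<and> M \<subseteq> W \<and> (\<forall>x\<in>M. k x = h b (\<phi> x))" for b
    proof -
      have "smooth_on (\<phi> ` W) (h b)" by (rule smooth_on_subset[OF h(1)]) (auto simp: W_def)
      then show ?thesis by (rule smooth_extension[OF A U(1) W]) blast
    qed
    then obtain k M where kM: "\<And>b. smooth_fun A (k b) \<and> open (M b) \<and> p \<in> M b \<and> M b \<subseteq> W \<and>
        (\<forall>x\<in>M b. k b x = h b (\<phi> x))" by metis
    define M' where "M' = (\<Inter>b\<in>Basis. M b)"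
    have M': "open M'" "p \<in> M'" "M' \<subseteq> W" "\<And>x b. x \<in> M' \<Longrightarrow> b \<in> Basis \<Longrightarrow> k b x = h b (\<phi> x)"
    proof -
      show "open M'" unfolding M'_def using kM by (intro open_INT) auto
      show "M' \<subseteq> W" unfolding M'_def using kM nonempty_Basis by blast
    qed (use kM in \<open>auto simp: M'_def\<close>)
    have sm1: "smooth_fun A (\<lambda>x. e b x + - (\<phi> p \<bullet> b))" if "b \<in> Basis" for b
      by (rule smooth_fun_add[OF A e[OF that] smooth_fun_const[OF A]])
    have sm2: "smooth_fun A (\<lambda>x. (e b x + - (\<phi> p \<bullet> b)) * k b x)" if "b \<in> Basis" for b
      using kM by (intro smooth_fun_mult[OF A sm1[OF that]]) simp
    have sm3: "smooth_fun A (\<lambda>x. \<Sum>b\<in>Basis. (e b x + - (\<phi> p \<bullet> b)) * k b x)"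
      by (rule smooth_fun_sum[OF A finite_Basis sm2])
    have "v f = v (\<lambda>x. f p + (\<Sum>b\<in>Basis. (e b x + - (\<phi> p \<bullet> b)) * k b x))"
    proof (rule tangent_local[OF A v f smooth_fun_add[OF A smooth_fun_const[OF A] sm3] M'(1,2)])
      fix x assume "x \<in> M'"
      then have x: "x \<in> N" "x \<in> U" "\<phi> x \<in> ball (\<phi> p) r" using M'(3) by (auto simp: W_def)
      have "f x = f p + (\<Sum>b\<in>Basis. ((\<phi> x - \<phi> p) \<bullet> b) * h b (\<phi> x))"
        using h(2)[OF x(3)] chart_inv[OF A U(1)] x U by simp
      also have "\<dots> = f p + (\<Sum>b\<in>Basis. (e b x + - (\<phi> p \<bullet> b)) * k b x)"
        using M'(4)[OF \<open>x \<in> M'\<close>] eN[OF _ x(1)] by (simp add: inner_diff_left)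
      finally show "f x = f p + (\<Sum>b\<in>Basis. (e b x + - (\<phi> p \<bullet> b)) * k b x)" .
    qed
    also have "\<dots> = (\<Sum>b\<in>Basis. v (\<lambda>x. (e b x + - (\<phi> p \<bullet> b)) * k b x))"
      using tangent_add[OF A v smooth_fun_const[OF A] sm3] tangent_const[OF A v]
        tangent_sum[OF A v finite_Basis sm2] by simp
    also have "\<dots> = (\<Sum>b\<in>Basis. v (e b) * frechet_derivative ?F (at (\<phi> p)) b)"
    proof (rule sum.cong[OF refl])
      fix b :: 'e assume b: "b \<in> Basis"
      have "v (\<lambda>x. e b x + - (\<phi> p \<bullet> b)) = v (e b)"
        using tangent_add[OF A v e[OF b] smooth_fun_const[OF A, where c="- (\<phi> p \<bullet> b)"]]
          tangent_const[OF A v] by simp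
      then show "v (\<lambda>x. (e b x + - (\<phi> p \<bullet> b)) * k b x) = v (e b) * frechet_derivative ?F (at (\<phi> p)) b"
        using tangent_mult[OF A v sm1[OF b], of "k b"] kM eN[OF b N(2)] M'(4)[OF M'(2) b] h(3) by simp
    qed
    also have "\<dots> = frechet_derivative ?F (at (\<phi> p)) \<xi>"
      using has_derivative_linear[OF smooth_fun_chart_derivative[OF A U f]]
      unfolding \<xi>_def by (simp add: linear_sum linear_scale)
    finally show ?thesis using f by (simp add: chart_vec_def)
  qed
  then have "v = chart_vec A U \<phi> p \<xi>"
    using tangent_nonsmooth[OF A v] by (auto simp: fun_eq_iff chart_vec_def)
  then show ?thesis by (rule that)
qed

lemma chart_vec_coordinate:
  assumes A: "smooth_atlas A" and U: "(U, \<phi>) \<in> A" and "smooth_fun A f" "open N" "p \<in> N" "N \<subseteq> U"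
    and "\<And>x. x \<in> N \<Longrightarrow> f x = \<phi> x \<bullet> b"
  shows "chart_vec A U \<phi> p \<xi> f = \<xi> \<bullet> b"
proof (rule chart_vecI[OF assms(3)])
  have "((\<lambda>x. x \<bullet> b) has_derivative (\<lambda>x. x \<bullet> b)) (at (\<phi> p))"
    by (rule bounded_linear_imp_has_derivative[OF bounded_linear_inner_left])
  then show "((\<lambda>x. f (inv_into U \<phi> x)) has_derivative (\<lambda>x. x \<bullet> b)) (at (\<phi> p))"
    by (rule has_derivative_transform_within_open[OF _ chart_open_image[OF A U assms(4,6)]])
      (use assms chart_inv[OF A U] in auto)
qed

section \<open>Velocities and partial derivatives\<close>

text \<open>A relational counterpart of \<open>velocity\<close>: it asserts that smooth functions
  are differentiable along the curve, which \<open>deriv\<close> does not.\<close>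

definition has_velocity ::
    "('a::topological_space, 'e::euclidean_space) atlas \<Rightarrow> (real \<Rightarrow> 'a) \<Rightarrow> real \<Rightarrow> 'a tangent \<Rightarrow> bool" where
  "has_velocity A \<gamma> t w \<longleftrightarrow>
     (\<forall>f. smooth_fun A f \<longrightarrow> ((\<lambda>s. f (\<gamma> s)) has_real_derivative w f) (at t))"

lemma has_velocityD:
  "has_velocity A \<gamma> t w \<Longrightarrow> smooth_fun A f \<Longrightarrow> ((\<lambda>s. f (\<gamma> s)) has_real_derivative w f) (at t)"
  by (simp add: has_velocity_def)

text \<open>The curve is tested by smooth functions only, but a bump function at
  \<open>\<gamma> t\<close> supported in a given neighbourhood stays positive along the curve near
  \<open>t\<close>.\<close>

lemma has_velocity_continuous:
  fixes A :: "('a::{t2_space,second_countable_topology}, 'e::euclidean_space) atlas"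
  assumes A: "smooth_atlas A" and vel: "has_velocity A \<gamma> t w"
  shows "isCont \<gamma> t"
  unfolding isCont_def
proof (rule topological_tendstoI)
  fix S assume S: "open S" "\<gamma> t \<in> S"
  obtain U \<phi> where U: "(U, \<phi>) \<in> A" "\<gamma> t \<in> U" using atlas_cover[OF A] .
  have W: "open (S \<inter> U)" "\<gamma> t \<in> S \<inter> U" "S \<inter> U \<subseteq> U" using S U chart_open[OF A U(1)] by auto
  obtain \<rho> N' where \<rho>: "smooth_fun A \<rho>" "\<gamma> t \<in> N'" "N' \<subseteq> S \<inter> U"
    "\<And>x. x \<in> N' \<Longrightarrow> \<rho> x = 1" "\<And>x. x \<notin> S \<inter> U \<Longrightarrow> \<rho> x = 0"
    using smooth_extension[OF A U(1) W smooth_on_const[OF chart_open_image[OF A U(1) W(1,3)], where c="1::real"]]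
    by metis
  have "((\<lambda>s. \<rho> (\<gamma> s)) has_real_derivative w \<rho>) (at t)"
    using vel \<rho>(1) by (simp add: has_velocity_def)
  then have "((\<lambda>s. \<rho> (\<gamma> s)) \<longlongrightarrow> \<rho> (\<gamma> t)) (at t)"
    using DERIV_isCont isCont_def by blast
  then have "\<forall>\<^sub>F s in at t. \<rho> (\<gamma> s) > 0"
    by (rule order_tendstoD(1)) (use \<rho> in simp)
  then show "\<forall>\<^sub>F s in at t. \<gamma> s \<in> S"
    by (rule eventually_mono) (use \<rho>(5) in force)
qed

lemma isCont_eventually_open:
  fixes \<gamma> :: "real \<Rightarrow> 'a::topological_space"
  assumes "isCont \<gamma> t" "open N" "\<gamma> t \<in> N"
  obtains S where "open S" "t \<in> S" "\<And>s. s \<in> S \<Longrightarrow> \<gamma> s \<in> N"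
proof -
  have "\<forall>\<^sub>F s in at t. \<gamma> s \<in> N"
    using assms unfolding isCont_def by (intro topological_tendstoD)
  then obtain S where S: "open S" "t \<in> S" "\<forall>s\<in>S. s \<noteq> t \<longrightarrow> \<gamma> s \<in> N"
    unfolding eventually_at_topological by blast
  show ?thesis by (rule that[OF S(1,2)]) (metis S(3) assms(3))
qed

lemma has_velocity_chart:
  fixes A :: "('a::{t2_space,second_countable_topology}, 'e::euclidean_space) atlas"
  assumes A: "smooth_atlas A" and vel: "has_velocity A \<gamma> t w" and U: "(U, \<phi>) \<in> A" "\<gamma> t \<in> U"
  obtains \<eta> where "((\<lambda>s. \<phi> (\<gamma> s)) has_vector_derivative \<eta>) (at t)"
    "\<And>f. smooth_fun A f \<Longrightarrow> w f = chart_vec A U \<phi> (\<gamma> t) \<eta> f"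
proof -
  obtain e N where e: "\<And>b. b \<in> Basis \<Longrightarrow> smooth_fun A (e b)" and N: "open N" "\<gamma> t \<in> N" "N \<subseteq> U"
    and eN: "\<And>b x. b \<in> Basis \<Longrightarrow> x \<in> N \<Longrightarrow> e b x = \<phi> x \<bullet> b"
    using coordinate_functions[OF A U] by metis
  obtain S where S: "open S" "t \<in> S" "\<And>s. s \<in> S \<Longrightarrow> \<gamma> s \<in> N"
    using isCont_eventually_open[OF has_velocity_continuous[OF A vel] N(1,2)] by metis
  define \<eta> where "\<eta> = (\<Sum>b\<in>Basis. w (e b) *\<^sub>R b)"
  have "((\<lambda>s. \<Sum>b\<in>Basis. e b (\<gamma> s) *\<^sub>R b) has_vector_derivative \<eta>) (at t)"
    unfolding \<eta>_def
  proof (intro has_vector_derivative_sum)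
    fix b :: 'e assume "b \<in> Basis"
    then have "((\<lambda>s. e b (\<gamma> s)) has_real_derivative w (e b)) (at t)"
      using vel e by (simp add: has_velocity_def)
    then show "((\<lambda>s. e b (\<gamma> s) *\<^sub>R b) has_vector_derivative w (e b) *\<^sub>R b) (at t)"
      using has_vector_derivative_scaleR[OF _ has_vector_derivative_const] by fastforce
  qed
  then have 1: "((\<lambda>s. \<phi> (\<gamma> s)) has_vector_derivative \<eta>) (at t)"
    by (rule has_vector_derivative_transform_within_open[OF _ S(1,2)])
      (use S(3) eN in \<open>simp add: euclidean_representation\<close>)
  show ?thesis
  proof (rule that[OF 1])
    fix f assume f: "smooth_fun A f"
    let ?D = "frechet_derivative (\<lambda>x. f (inv_into U \<phi> x)) (at (\<phi> (\<gamma> t)))"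
    have D: "((\<lambda>x. f (inv_into U \<phi> x)) has_derivative ?D) (at (\<phi> (\<gamma> t)))"
      by (rule smooth_fun_chart_derivative[OF A U f])
    have "((\<lambda>s. f (inv_into U \<phi> (\<phi> (\<gamma> s)))) has_derivative (\<lambda>d. ?D (d *\<^sub>R \<eta>))) (at t)"
      using has_derivative_compose[OF 1[unfolded has_vector_derivative_def] D] .
    then have "((\<lambda>s. f (inv_into U \<phi> (\<phi> (\<gamma> s)))) has_real_derivative ?D \<eta>) (at t)"
      using linear_scale[OF has_derivative_linear[OF D]]
      by (simp add: has_field_derivative_def mult_commute_abs)
    then have "((\<lambda>s. f (\<gamma> s)) has_real_derivative ?D \<eta>) (at t)"
      by (rule has_field_derivative_transform_within_open[OF _ S(1,2)])
        (use S(3) N chart_inv[OF A U(1)] in \<open>simp add: subset_iff\<close>)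
    moreover have "((\<lambda>s. f (\<gamma> s)) has_real_derivative w f) (at t)"
      using vel f by (simp add: has_velocity_def)
    ultimately show "w f = chart_vec A U \<phi> (\<gamma> t) \<eta> f"
      using DERIV_unique f by (auto simp: chart_vec_def)
  qed
qed

lemma has_velocity_chart_vec:
  assumes A: "smooth_atlas A" and U: "(U, \<phi>) \<in> A" "\<gamma> t \<in> U"
    and S: "open S" "t \<in> S" "\<And>s. s \<in> S \<Longrightarrow> \<gamma> s \<in> U"
    and der: "((\<lambda>s. \<phi> (\<gamma> s)) has_vector_derivative \<eta>) (at t)"
  shows "has_velocity A \<gamma> t (chart_vec A U \<phi> (\<gamma> t) \<eta>)"
  unfolding has_velocity_def
proof (intro allI impI)
  fix f assume f: "smooth_fun A f"
  let ?D = "frechet_derivative (\<lambda>x. f (inv_into U \<phi> x)) (at (\<phi> (\<gamma> t)))"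
  have D: "((\<lambda>x. f (inv_into U \<phi> x)) has_derivative ?D) (at (\<phi> (\<gamma> t)))"
    by (rule smooth_fun_chart_derivative[OF A U f])
  have "((\<lambda>s. f (inv_into U \<phi> (\<phi> (\<gamma> s)))) has_derivative (\<lambda>d. ?D (d *\<^sub>R \<eta>))) (at t)"
    using has_derivative_compose[OF der[unfolded has_vector_derivative_def] D] .
  then have "((\<lambda>s. f (inv_into U \<phi> (\<phi> (\<gamma> s)))) has_real_derivative ?D \<eta>) (at t)"
    using linear_scale[OF has_derivative_linear[OF D]]
    by (simp add: has_field_derivative_def mult_commute_abs)
  then have "((\<lambda>s. f (\<gamma> s)) has_real_derivative ?D \<eta>) (at t)"
    by (rule has_field_derivative_transform_within_open[OF _ S(1,2)])
      (use S(3) chart_inv[OF A U(1)] in simp)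
  then show "((\<lambda>s. f (\<gamma> s)) has_real_derivative chart_vec A U \<phi> (\<gamma> t) \<eta> f) (at t)"
    using f by (simp add: chart_vec_def)
qed

lemma chart_vec_velocity:
  assumes A: "smooth_atlas A" and U: "(U, \<phi>) \<in> A" "p \<in> U"
  obtains \<gamma> where "\<gamma> 0 = p" "has_velocity A \<gamma> 0 (chart_vec A U \<phi> p \<xi>)"
proof -
  define \<gamma> where "\<gamma> s = inv_into U \<phi> (\<phi> p + s *\<^sub>R \<xi>)" for s :: real
  define S where "S = (\<lambda>s::real. \<phi> p + s *\<^sub>R \<xi>) -` (\<phi> ` U)"
  have \<gamma>0: "\<gamma> 0 = p" using chart_inv[OF A U(1,2)] by (simp add: \<gamma>_def)
  have S: "open S" "0 \<in> S" unfolding S_def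
    using U by (auto intro!: open_vimage chart_image_open[OF A U(1)] continuous_intros)
  have eq: "\<phi> (\<gamma> s) = \<phi> p + s *\<^sub>R \<xi>" "\<gamma> s \<in> U" if "s \<in> S" for s
    using that unfolding \<gamma>_def S_def by (auto intro: f_inv_into_f inv_into_into)
  have "((\<lambda>s. \<phi> p + s *\<^sub>R \<xi>) has_vector_derivative \<xi>) (at 0)"
    by (auto intro!: derivative_eq_intros)
  then have "((\<lambda>s. \<phi> (\<gamma> s)) has_vector_derivative \<xi>) (at 0)"
    by (rule has_vector_derivative_transform_within_open[OF _ S]) (simp add: eq)
  from has_velocity_chart_vec[OF A U(1) _ S eq(2) this] show ?thesis
    using U \<gamma>0 by (intro that[of \<gamma>]) simp_all
qed

section \<open>Functions on a product and their partial derivatives\<close>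

lemma smooth_fun_prod_chart:
  assumes A: "smooth_atlas A" and B: "smooth_atlas B" and K: "smooth_fun (prod_atlas A B) K"
    and U: "(U, \<phi>) \<in> A" and V: "(V, \<psi>) \<in> B"
  shows "smooth_on (\<phi> ` U \<times> \<psi> ` V) (\<lambda>z. K (inv_into U \<phi> (fst z), inv_into V \<psi> (snd z)))"
proof -
  have "(U \<times> V, map_prod \<phi> \<psi>) \<in> prod_atlas A B" using U V by (auto simp: prod_atlas_def)
  from smooth_fun_chart[OF K this]
  have "smooth_on (\<phi> ` U \<times> \<psi> ` V) (\<lambda>z. K (inv_into (U \<times> V) (map_prod \<phi> \<psi>) z))"
    by (simp add: map_prod_surj_on)
  then show ?thesis
    by (rule smooth_on_cong[OF open_Times[OF chart_image_open[OF A U] chart_image_open[OF B V]], rotated])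
      (auto simp: inv_into_map_prod chart_inj[OF A U] chart_inj[OF B V])
qed

context
  fixes A :: "('a::{t2_space,second_countable_topology}, 'd::euclidean_space) atlas"
    and B :: "('b::{t2_space,second_countable_topology}, 'e::euclidean_space) atlas"
    and K :: "'a \<times> 'b \<Rightarrow> real"
  assumes A: "smooth_atlas A" and B: "smooth_atlas B" and K: "smooth_fun (prod_atlas A B) K"
begin

lemma smooth_fun_slice1: "smooth_fun A (\<lambda>a. K (a, b))"
  by (rule smooth_fun_compose[OF A smooth_atlas_prod[OF A B] smooth_map_Pair[OF A A B smooth_map_id[OF A]
          smooth_map_const[OF A B]] K])

lemma smooth_fun_slice2: "smooth_fun B (\<lambda>b. K (a, b))"
  by (rule smooth_fun_compose[OF B smooth_atlas_prod[OF A B] smooth_map_Pair[OF B A B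
          smooth_map_const[OF B A] smooth_map_id[OF B]] K])

context
  fixes U \<phi> V \<psi>
  assumes U: "(U, \<phi>) \<in> A" and V: "(V, \<psi>) \<in> B"
begin

private abbreviation "Kc \<equiv> \<lambda>z. K (inv_into U \<phi> (fst z), inv_into V \<psi> (snd z))"

lemma chart_vec_slice1:
  assumes p: "p \<in> U" and q: "q \<in> V"
  shows "chart_vec A U \<phi> p \<xi> (\<lambda>a. K (a, q)) = frechet_derivative Kc (at (\<phi> p, \<psi> q)) (\<xi>, 0)"
proof (rule chart_vecI[OF smooth_fun_slice1])
  have "(Kc has_derivative frechet_derivative Kc (at (\<phi> p, \<psi> q))) (at (\<phi> p, \<psi> q))"
    by (rule smooth_on_has_derivative[OF smooth_fun_prod_chart[OF A B K U V]]) (use p q in auto)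
  moreover have "((\<lambda>x. (x, \<psi> q)) has_derivative (\<lambda>x. (x, 0))) (at (\<phi> p))"
    by (auto intro!: derivative_eq_intros)
  ultimately show "((\<lambda>x. K (inv_into U \<phi> x, q)) has_derivative
      (\<lambda>\<xi>. frechet_derivative Kc (at (\<phi> p, \<psi> q)) (\<xi>, 0))) (at (\<phi> p))"
    using has_derivative_compose[of "\<lambda>x. (x, \<psi> q)" "\<lambda>x. (x, 0)" "\<phi> p" UNIV Kc] chart_inv[OF B V q] by simp
qed

lemma chart_vec_slice2:
  assumes p: "p \<in> U" and q: "q \<in> V"
  shows "chart_vec B V \<psi> q \<eta> (\<lambda>b. K (p, b)) = frechet_derivative Kc (at (\<phi> p, \<psi> q)) (0, \<eta>)"
proof (rule chart_vecI[OF smooth_fun_slice2])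
  have "(Kc has_derivative frechet_derivative Kc (at (\<phi> p, \<psi> q))) (at (\<phi> p, \<psi> q))"
    by (rule smooth_on_has_derivative[OF smooth_fun_prod_chart[OF A B K U V]]) (use p q in auto)
  moreover have "((\<lambda>x. (\<phi> p, x)) has_derivative (\<lambda>x. (0, x))) (at (\<psi> q))"
    by (auto intro!: derivative_eq_intros)
  ultimately show "((\<lambda>x. K (p, inv_into V \<psi> x)) has_derivative
      (\<lambda>\<xi>. frechet_derivative Kc (at (\<phi> p, \<psi> q)) (0, \<xi>))) (at (\<psi> q))"
    using has_derivative_compose[of "\<lambda>x. (\<phi> p, x)" "\<lambda>x. (0, x)" "\<psi> q" UNIV Kc] chart_inv[OF A U p] by simp
qed

lemma smooth_on_slice_derivative:
  shows "p \<in> U \<Longrightarrow> smooth_on (\<psi> ` V) (\<lambda>y. frechet_derivative Kc (at (\<phi> p, y)) \<zeta>)"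
    and "q \<in> V \<Longrightarrow> smooth_on (\<phi> ` U) (\<lambda>x. frechet_derivative Kc (at (x, \<psi> q)) \<zeta>)"
proof -
  note op = chart_image_open[OF A U] chart_image_open[OF B V]
  note sm = smooth_on_frechet_derivative[OF smooth_fun_prod_chart[OF A B K U V], of \<zeta>]
  show "smooth_on (\<psi> ` V) (\<lambda>y. frechet_derivative Kc (at (\<phi> p, y)) \<zeta>)" if "p \<in> U"
    by (rule smooth_on_compose[OF op(2) open_Times[OF op] _ sm, where g="\<lambda>y. (\<phi> p, y)"])
      (rule smooth_on_Pair[OF op(2) smooth_on_const[OF op(2)] smooth_on_bounded_linear[OF bounded_linear_ident op(2)]],
       use that in auto)
  show "smooth_on (\<phi> ` U) (\<lambda>x. frechet_derivative Kc (at (x, \<psi> q)) \<zeta>)" if "q \<in> V"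
    by (rule smooth_on_compose[OF op(1) open_Times[OF op] _ sm, where g="\<lambda>x. (x, \<psi> q)"])
      (rule smooth_on_Pair[OF op(1) smooth_on_bounded_linear[OF bounded_linear_ident op(1)] smooth_on_const[OF op(1)]],
       use that in auto)
qed

end

lemma smooth_fun_chart_vec1:
  assumes U: "(U, \<phi>) \<in> A" "p \<in> U"
  shows "smooth_fun B (\<lambda>b. chart_vec A U \<phi> p \<xi> (\<lambda>a. K (a, b)))"
proof (rule smooth_funI[OF B])
  fix V \<psi> assume V: "(V, \<psi>) \<in> B"
  show "smooth_on (\<psi> ` V) (\<lambda>y. chart_vec A U \<phi> p \<xi> (\<lambda>a. K (a, inv_into V \<psi> y)))"
    by (rule smooth_on_cong[OF chart_image_open[OF B V] _
          smooth_on_slice_derivative(1)[OF U(1) V U(2), of "(\<xi>, 0)"]])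
      (auto simp: chart_vec_slice1[OF U(1) V U(2)] chart_inv[OF B V])
qed

lemma smooth_fun_chart_vec2:
  assumes V: "(V, \<psi>) \<in> B" "q \<in> V"
  shows "smooth_fun A (\<lambda>a. chart_vec B V \<psi> q \<eta> (\<lambda>b. K (a, b)))"
proof (rule smooth_funI[OF A])
  fix U \<phi> assume U: "(U, \<phi>) \<in> A"
  show "smooth_on (\<phi> ` U) (\<lambda>x. chart_vec B V \<psi> q \<eta> (\<lambda>b. K (inv_into U \<phi> x, b)))"
    by (rule smooth_on_cong[OF chart_image_open[OF A U] _
          smooth_on_slice_derivative(2)[OF U V(1) V(2), of "(0, \<eta>)"]])
      (auto simp: chart_vec_slice2[OF U V(1) _ V(2)] chart_inv[OF A U])
qed

text \<open>In a product chart this is the symmetry of one second derivative in the directions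
  \<open>(\<xi>, 0)\<close> and \<open>(0, \<eta>)\<close>.\<close>

lemma chart_vec_commute:
  assumes U: "(U, \<phi>) \<in> A" "p \<in> U" and V: "(V, \<psi>) \<in> B" "q \<in> V"
  shows "chart_vec A U \<phi> p \<xi> (\<lambda>a. chart_vec B V \<psi> q \<eta> (\<lambda>b. K (a, b))) =
    chart_vec B V \<psi> q \<eta> (\<lambda>b. chart_vec A U \<phi> p \<xi> (\<lambda>a. K (a, b)))"
proof -
  let ?Kc = "\<lambda>z. K (inv_into U \<phi> (fst z), inv_into V \<psi> (snd z))"
  let ?D = "\<lambda>\<zeta> z. frechet_derivative ?Kc (at z) \<zeta>"
  note op = open_Times[OF chart_image_open[OF A U(1)] chart_image_open[OF B V(1)]]
  note sm = smooth_fun_prod_chart[OF A B K U(1) V(1)]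
  have D2: "(?D \<zeta> has_derivative frechet_derivative (?D \<zeta>) (at (\<phi> p, \<psi> q))) (at (\<phi> p, \<psi> q))" for \<zeta>
    by (rule smooth_on_has_derivative[OF smooth_on_frechet_derivative[OF sm]]) (use U V in auto)
  have "chart_vec A U \<phi> p \<xi> (\<lambda>a. chart_vec B V \<psi> q \<eta> (\<lambda>b. K (a, b))) =
      frechet_derivative (?D (0, \<eta>)) (at (\<phi> p, \<psi> q)) (\<xi>, 0)"
  proof (rule chart_vecI[OF smooth_fun_chart_vec2[OF V]])
    have "((\<lambda>x. (x, \<psi> q)) has_derivative (\<lambda>x. (x, 0))) (at (\<phi> p))"
      by (auto intro!: derivative_eq_intros)
    from has_derivative_compose[OF this D2, of "(0, \<eta>)"]
    show "((\<lambda>x. chart_vec B V \<psi> q \<eta> (\<lambda>b. K (inv_into U \<phi> x, b))) has_derivative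
        (\<lambda>\<xi>. frechet_derivative (?D (0, \<eta>)) (at (\<phi> p, \<psi> q)) (\<xi>, 0))) (at (\<phi> p))"
      by (rule has_derivative_transform_within_open[OF _ chart_image_open[OF A U(1)]])
        (use U chart_inv[OF A U(1)] in \<open>auto simp: chart_vec_slice2[OF U(1) V(1) _ V(2)]\<close>)
  qed
  also have "\<dots> = frechet_derivative (?D (\<xi>, 0)) (at (\<phi> p, \<psi> q)) (0, \<eta>)"
    by (rule second_derivative_symmetric[OF op sm]) (use U V in auto)
  also have "\<dots> = chart_vec B V \<psi> q \<eta> (\<lambda>b. chart_vec A U \<phi> p \<xi> (\<lambda>a. K (a, b)))"
  proof (rule chart_vecI[symmetric, OF smooth_fun_chart_vec1[OF U]])
    have "((\<lambda>x. (\<phi> p, x)) has_derivative (\<lambda>x. (0, x))) (at (\<psi> q))"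
      by (auto intro!: derivative_eq_intros)
    from has_derivative_compose[OF this D2, of "(\<xi>, 0)"]
    show "((\<lambda>x. chart_vec A U \<phi> p \<xi> (\<lambda>a. K (a, inv_into V \<psi> x))) has_derivative
        (\<lambda>\<eta>. frechet_derivative (?D (\<xi>, 0)) (at (\<phi> p, \<psi> q)) (0, \<eta>))) (at (\<psi> q))"
      by (rule has_derivative_transform_within_open[OF _ chart_image_open[OF B V(1)]])
        (use V chart_inv[OF B V(1)] in \<open>auto simp: chart_vec_slice1[OF U(1) V(1) U(2)]\<close>)
  qed
  finally show ?thesis .
qed

text \<open>The total derivative in a product chart splits into its two partial ones. This serves as
  the product rule of the group, for inverses, quotients of curves and conjugation.\<close>

lemma has_velocity_two_variables:
  assumes v1: "has_velocity A \<gamma>1 t w1" and v2: "has_velocity B \<gamma>2 t w2"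
  shows "((\<lambda>s. K (\<gamma>1 s, \<gamma>2 s)) has_real_derivative
    w1 (\<lambda>a. K (a, \<gamma>2 t)) + w2 (\<lambda>b. K (\<gamma>1 t, b))) (at t)"
proof -
  obtain U \<phi> where U: "(U, \<phi>) \<in> A" "\<gamma>1 t \<in> U" using atlas_cover[OF A] .
  obtain V \<psi> where V: "(V, \<psi>) \<in> B" "\<gamma>2 t \<in> V" using atlas_cover[OF B] .
  obtain \<eta>1 where \<eta>1: "((\<lambda>s. \<phi> (\<gamma>1 s)) has_vector_derivative \<eta>1) (at t)"
    "\<And>f. smooth_fun A f \<Longrightarrow> w1 f = chart_vec A U \<phi> (\<gamma>1 t) \<eta>1 f"
    using has_velocity_chart[OF A v1 U] by metis
  obtain \<eta>2 where \<eta>2: "((\<lambda>s. \<psi> (\<gamma>2 s)) has_vector_derivative \<eta>2) (at t)"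
    "\<And>f. smooth_fun B f \<Longrightarrow> w2 f = chart_vec B V \<psi> (\<gamma>2 t) \<eta>2 f"
    using has_velocity_chart[OF B v2 V] by metis
  obtain S1 where S1: "open S1" "t \<in> S1" "\<And>s. s \<in> S1 \<Longrightarrow> \<gamma>1 s \<in> U"
    using isCont_eventually_open[OF has_velocity_continuous[OF A v1] chart_open[OF A U(1)] U(2)] by metis
  obtain S2 where S2: "open S2" "t \<in> S2" "\<And>s. s \<in> S2 \<Longrightarrow> \<gamma>2 s \<in> V"
    using isCont_eventually_open[OF has_velocity_continuous[OF B v2] chart_open[OF B V(1)] V(2)] by metis
  let ?Kc = "\<lambda>z. K (inv_into U \<phi> (fst z), inv_into V \<psi> (snd z))"
  let ?D = "frechet_derivative ?Kc (at (\<phi> (\<gamma>1 t), \<psi> (\<gamma>2 t)))"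
  have D: "(?Kc has_derivative ?D) (at (\<phi> (\<gamma>1 t), \<psi> (\<gamma>2 t)))"
    by (rule smooth_on_has_derivative[OF smooth_fun_prod_chart[OF A B K U(1) V(1)]]) (use U V in auto)
  have "((\<lambda>s. (\<phi> (\<gamma>1 s), \<psi> (\<gamma>2 s))) has_derivative (\<lambda>d. (d *\<^sub>R \<eta>1, d *\<^sub>R \<eta>2))) (at t)"
    by (intro has_derivative_Pair \<eta>1(1)[unfolded has_vector_derivative_def] \<eta>2(1)[unfolded has_vector_derivative_def])
  from has_derivative_compose[OF this D]
  have "((\<lambda>s. ?Kc (\<phi> (\<gamma>1 s), \<psi> (\<gamma>2 s))) has_derivative (\<lambda>d. ?D (d *\<^sub>R (\<eta>1, \<eta>2)))) (at t)" by simp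
  then have "((\<lambda>s. ?Kc (\<phi> (\<gamma>1 s), \<psi> (\<gamma>2 s))) has_real_derivative ?D (\<eta>1, \<eta>2)) (at t)"
    unfolding linear_scale[OF has_derivative_linear[OF D]]
    by (simp add: has_field_derivative_def mult_commute_abs)
  then have "((\<lambda>s. K (\<gamma>1 s, \<gamma>2 s)) has_real_derivative ?D (\<eta>1, \<eta>2)) (at t)"
    by (rule has_field_derivative_transform_within_open[of _ _ _ "S1 \<inter> S2"])
      (use S1 S2 chart_inv[OF A U(1)] chart_inv[OF B V(1)] in auto)
  moreover have "?D (\<eta>1, \<eta>2) = ?D (\<eta>1, 0) + ?D (0, \<eta>2)"
    using linear_add[OF has_derivative_linear[OF D], of "(\<eta>1, 0)" "(0, \<eta>2)"] by simp
  ultimately show ?thesis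
    using \<eta>1(2)[OF smooth_fun_slice1] \<eta>2(2)[OF smooth_fun_slice2]
      chart_vec_slice1[OF U(1) V(1) U(2) V(2)] chart_vec_slice2[OF U(1) V(1) U(2) V(2)] by simp
qed

end

lemma has_velocity_push_forward:
  assumes "smooth_atlas A" "smooth_atlas B" "smooth_map A B F" "has_velocity A \<gamma> t w"
  shows "has_velocity B (\<lambda>s. F (\<gamma> s)) t (push_forward B F w)"
  using assms smooth_fun_compose[OF assms(1-3)]
  by (auto simp: has_velocity_def push_forward_def o_def)

lemma push_forward_tangent:
  assumes A: "smooth_atlas A" and B: "smooth_atlas B" and F: "smooth_map A B F"
    and v: "v \<in> tangent_space A p"
  shows "push_forward B F v \<in> tangent_space B (F p)"
proof -
  note sm = smooth_fun_compose[OF A B F]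
  have "smooth_fun B (\<lambda>x. f x + h x)" "smooth_fun B (\<lambda>x. f x * h x)" "smooth_fun B (\<lambda>x. c * f x)"
    if "smooth_fun B f" "smooth_fun B h" for f h c
    using smooth_fun_add[OF B that] smooth_fun_mult[OF B that] smooth_fun_mult[OF B smooth_fun_const[OF B] that(1)]
    by auto
  then show ?thesis
    using tangent_add[OF A v sm sm] tangent_mult[OF A v sm sm] tangent_scale[OF A v sm]
    unfolding tangent_space_def push_forward_def o_def by auto
qed

lemma has_velocity_shift:
  assumes "has_velocity A \<gamma> (t + c) w"
  shows "has_velocity A (\<lambda>s. \<gamma> (s + c)) t w"
  unfolding has_velocity_def
proof (intro allI impI)
  fix f assume "smooth_fun A f"
  then have "((\<lambda>s. f (\<gamma> s)) has_real_derivative w f) (at (t + c))"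
    using assms unfolding has_velocity_def by blast
  then show "((\<lambda>s. f (\<gamma> (s + c))) has_real_derivative w f) (at t)"
    by (rule DERIV_shift[THEN iffD1])
qed

lemma smooth_functions_separate_points:
  fixes A :: "('a::{t2_space,second_countable_topology}, 'd::euclidean_space) atlas"
  assumes A: "smooth_atlas A" and eq: "\<And>f. smooth_fun A f \<Longrightarrow> f p = f q"
  shows "p = q"
proof (rule ccontr)
  assume "p \<noteq> q"
  obtain U \<phi> where U: "(U, \<phi>) \<in> A" "p \<in> U" using atlas_cover[OF A] .
  have W: "open (U - {q})" "p \<in> U - {q}" "U - {q} \<subseteq> U"
    using U \<open>p \<noteq> q\<close> chart_open[OF A U(1)] by auto
  obtain \<rho> N where "smooth_fun A \<rho>" "p \<in> N" "\<And>x. x \<in> N \<Longrightarrow> \<rho> x = 1" "\<And>x. x \<notin> U - {q} \<Longrightarrow> \<rho> x = 0"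
    using smooth_extension[OF A U(1) W smooth_on_const[OF chart_open_image[OF A U(1) W(1,3)], where c="1::real"]]
    by metis
  then show False using eq[of \<rho>] by force
qed

text \<open>For curves assembled from pieces: at a junction the one-sided derivatives agree.\<close>

lemma has_real_derivative_glue:
  assumes "(h1 has_real_derivative D) (at t)" "(h2 has_real_derivative D) (at t)" "h1 t = h2 t" "0 < d"
    and "\<And>s. t \<le> s \<Longrightarrow> s < t + d \<Longrightarrow> f s = h1 s" "\<And>s. t - d < s \<Longrightarrow> s < t \<Longrightarrow> f s = h2 s"
  shows "(f has_real_derivative D) (at t)"
proof -
  have "(f has_real_derivative D) (at t within {t..})"
    by (rule has_field_derivative_transform_within[OF has_field_derivative_at_within[OF assms(1)] assms(4)])
      (use assms in \<open>auto simp: dist_real_def\<close>)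
  moreover have "(f has_real_derivative D) (at t within {..t})"
  proof (rule has_field_derivative_transform_within[OF has_field_derivative_at_within[OF assms(2)] assms(4)])
    fix s assume "s \<in> {..t}" "dist s t < d"
    then show "h2 s = f s" using assms(3,4) assms(5)[of s] assms(6)[of s] by (cases "s = t") (auto simp: dist_real_def)
  qed simp
  ultimately have "(f has_real_derivative D) (at t within {t..} \<union> {..t})"
    unfolding has_field_derivative_iff by (rule Lim_Un)
  moreover have "{t..} \<union> {..t} = UNIV" by auto
  ultimately show ?thesis by simp
qed

section \<open>Lie groups\<close>

locale lie_grp = group G
  for A :: "('g::{t2_space,second_countable_topology}, 'd::euclidean_space) atlas" and G :: "'g monoid" (structure) +
  assumes lie: "lie_group A G"
begin

lemma atlas: "smooth_atlas A" and carrier: "carrier G = UNIV"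
  and smooth_mult: "smooth_map (prod_atlas A A) A (\<lambda>(a, b). a \<otimes> b)"
  and smooth_inv: "smooth_map A A (\<lambda>a. inv a)"
  using lie by (auto simp: lie_group_def)

lemma in_carrier [simp]: "x \<in> carrier G" by (simp add: carrier)

lemma smooth_map_mult:
  assumes "smooth_atlas B" "smooth_map B A F" "smooth_map B A H"
  shows "smooth_map B A (\<lambda>x. F x \<otimes> H x)"
  using smooth_map_compose[OF assms(1) smooth_atlas_prod[OF atlas atlas] atlas
      smooth_map_Pair[OF assms(1) atlas atlas assms(2,3)] smooth_mult] by simp

lemma smooth_map_inv:
  assumes "smooth_atlas B" "smooth_map B A F" shows "smooth_map B A (\<lambda>x. inv (F x))"
  using smooth_map_compose[OF assms(1) atlas atlas assms(2) smooth_inv] .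

lemmas smooth_intros = smooth_map_mult smooth_map_inv smooth_map_id[OF atlas] smooth_map_const[OF _ atlas]
  smooth_map_fst[OF atlas atlas] smooth_map_snd[OF atlas atlas] atlas smooth_atlas_prod[OF atlas atlas]

lemma smooth_fun_comp: "smooth_fun A f \<Longrightarrow> smooth_atlas B \<Longrightarrow> smooth_map B A F \<Longrightarrow> smooth_fun B (\<lambda>x. f (F x))"
  by (rule smooth_fun_compose[OF _ atlas])

lemma smooth_fun_translate:
  assumes "smooth_fun A f"
  shows "smooth_fun A (\<lambda>c. f (a \<otimes> c))" "smooth_fun A (\<lambda>c. f (c \<otimes> a))" "smooth_fun A (\<lambda>c. f (inv c))"
    "smooth_fun A (\<lambda>c. f (a \<otimes> c \<otimes> b))"
  by (rule smooth_fun_comp[OF assms atlas], intro smooth_intros)+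

definition "U0 = fst (SOME c. c \<in> A \<and> \<one> \<in> fst c)"
definition "\<phi>0 = snd (SOME c. c \<in> A \<and> \<one> \<in> fst c)"

lemma U0: "(U0, \<phi>0) \<in> A" "\<one> \<in> U0"
proof -
  obtain U \<phi> where "(U, \<phi>) \<in> A" "\<one> \<in> U" using atlas_cover[OF atlas] .
  then have "\<exists>c. c \<in> A \<and> \<one> \<in> fst c" by force
  from someI_ex[OF this] show "(U0, \<phi>0) \<in> A" "\<one> \<in> U0" by (auto simp: U0_def \<phi>0_def)
qed

text \<open>Identifies the model space with the tangent space at the identity through one fixed
  chart. Lie algebra elements are represented by vectors of the model space from here on.\<close>

definition evec :: "'d \<Rightarrow> 'g tangent" where "evec \<xi> = chart_vec A U0 \<phi>0 \<one> \<xi>"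

definition lfield :: "'d \<Rightarrow> 'g vfield" where
  "lfield \<xi> b = (\<lambda>f. if smooth_fun A f then evec \<xi> (\<lambda>c. f (b \<otimes> c)) else 0)"

lemma evec_tangent: "evec \<xi> \<in> tangent_space A \<one>"
  unfolding evec_def by (rule chart_vec_tangent[OF atlas U0])

lemmas evec_add = tangent_add[OF atlas evec_tangent]
  and evec_scale = tangent_scale[OF atlas evec_tangent]
  and evec_const = tangent_const[OF atlas evec_tangent]
  and evec_nonsmooth = tangent_nonsmooth[OF atlas evec_tangent]
  and evec_sum = tangent_sum[OF atlas evec_tangent]

lemma evec_diff:
  assumes "smooth_fun A f" "smooth_fun A h" shows "evec \<xi> (\<lambda>x. f x - h x) = evec \<xi> f - evec \<xi> h"
  using evec_add[OF assms(1) smooth_fun_mult[OF atlas smooth_fun_const[OF atlas, where c="- 1"] assms(2)]]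
    evec_scale[OF assms(2), where c="- 1"] by simp

lemma evec_linear: "linear (\<lambda>\<xi>. evec \<xi> f)"
  unfolding evec_def by (rule chart_vec_linear[OF atlas U0])

lemma lfield_one: "lfield \<xi> \<one> = evec \<xi>"
  by (auto simp: lfield_def fun_eq_iff evec_nonsmooth)

lemma lfield_tangent: "lfield \<xi> b \<in> tangent_space A b"
proof -
  have "smooth_map A A (\<lambda>c. b \<otimes> c)" by (intro smooth_intros)
  from push_forward_tangent[OF atlas atlas this evec_tangent[of \<xi>]]
  show ?thesis unfolding lfield_def push_forward_def o_def by simp
qed

lemma smooth_fun_lfield: "smooth_fun A f \<Longrightarrow> smooth_fun A (\<lambda>b. lfield \<xi> b f)"
  using smooth_fun_chart_vec1[OF atlas atlas smooth_fun_comp[where F="\<lambda>z. snd z \<otimes> fst z"] U0, of f \<xi>]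
  by (simp add: lfield_def evec_def) (metis smooth_intros)

lemma lfield_translate: "smooth_fun A f \<Longrightarrow> lfield \<xi> b (\<lambda>c. f (a \<otimes> c)) = lfield \<xi> (a \<otimes> b) f"
  by (simp add: lfield_def smooth_fun_translate m_assoc)

lemma lfield_in_lie_algebra: "lfield \<xi> \<in> lie_algebra A G"
  using lfield_tangent smooth_fun_lfield lfield_translate
  by (auto simp: lie_algebra_def vector_field_def push_forward_def o_def fun_eq_iff lfield_def)

lemma lie_algebra_lfield:
  assumes "X \<in> lie_algebra A G" obtains \<xi> where "X = lfield \<xi>"
proof -
  have X: "vector_field A X" "\<And>a b. push_forward A (\<lambda>c. a \<otimes> c) (X b) = X (a \<otimes> b)"
    using assms by (auto simp: lie_algebra_def)
  then have "X \<one> \<in> tangent_space A \<one>" by (simp add: vector_field_def)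
  then obtain \<xi> where \<xi>: "X \<one> = evec \<xi>" unfolding evec_def by (rule tangent_is_chart_vec[OF atlas U0])
  have "X b = lfield \<xi> b" for b
    using X(2)[of b \<one>] unfolding push_forward_def lfield_def o_def \<xi> by simp
  then have "X = lfield \<xi>" by (rule ext)
  then show ?thesis by (rule that)
qed

lemma lfield_linear: "linear lfield"
proof (rule linearI)
  show "lfield (x + y) = lfield x + lfield y" for x y
    using linear_add[OF evec_linear] by (auto simp: lfield_def fun_eq_iff)
  show "lfield (c *\<^sub>R x) = c *\<^sub>R lfield x" for c x
    using linear_scale[OF evec_linear] by (auto simp: lfield_def fun_eq_iff scaleR_fun_def)
qed

text \<open>Global smooth functions that agree with the chart coordinates near the identity, so that
  \<open>evec\<close> can be evaluated on them.\<close>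

definition "coords = (SOME e. (\<forall>b\<in>Basis. smooth_fun A (e b)) \<and>
  (\<exists>N. open N \<and> \<one> \<in> N \<and> N \<subseteq> U0 \<and> (\<forall>b\<in>Basis. \<forall>x\<in>N. e b x = \<phi>0 x \<bullet> b)))"

lemma coords:
  assumes "b \<in> Basis" shows smooth_coords: "smooth_fun A (coords b)" and evec_coords: "evec \<xi> (coords b) = \<xi> \<bullet> b"
proof -
  obtain e N where "\<And>b. b \<in> Basis \<Longrightarrow> smooth_fun A (e b)" "open N" "\<one> \<in> N" "N \<subseteq> U0"
    "\<And>b x. b \<in> Basis \<Longrightarrow> x \<in> N \<Longrightarrow> e b x = \<phi>0 x \<bullet> b"
    using coordinate_functions[OF atlas U0] by metis
  then have "\<exists>e. (\<forall>b\<in>Basis. smooth_fun A (e b)) \<and>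
      (\<exists>N. open N \<and> \<one> \<in> N \<and> N \<subseteq> U0 \<and> (\<forall>b\<in>Basis. \<forall>x\<in>N. e b x = \<phi>0 x \<bullet> b))" by blast
  from someI_ex[OF this] obtain N where *: "\<forall>b\<in>Basis. smooth_fun A (coords b)"
    "open N" "\<one> \<in> N" "N \<subseteq> U0" "\<forall>b\<in>Basis. \<forall>x\<in>N. coords b x = \<phi>0 x \<bullet> b"
    unfolding coords_def[symmetric] by blast
  then show "smooth_fun A (coords b)" using assms by blast
  then show "evec \<xi> (coords b) = \<xi> \<bullet> b"
    unfolding evec_def by (rule chart_vec_coordinate[OF atlas U0(1) _ *(2,3,4)]) (use *(5) assms in blast)
qed

lemma evec_inj: "evec \<xi> = evec \<eta> \<Longrightarrow> \<xi> = \<eta>"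
  by (rule euclidean_eqI) (metis evec_coords)

lemma lfield_inj: "inj lfield"
  by (rule injI) (metis lfield_one evec_inj)

text \<open>Differentiate the constant \<open>\<gamma> s \<otimes> inv (\<gamma> s)\<close> by the
  product rule.\<close>

lemma evec_inverse:
  assumes h: "smooth_fun A h" shows "evec \<xi> (\<lambda>c. h (inv c)) = - evec \<xi> h"
proof -
  obtain \<gamma> where \<gamma>: "\<gamma> 0 = \<one>" "has_velocity A \<gamma> 0 (evec \<xi>)"
    unfolding evec_def by (rule chart_vec_velocity[OF atlas U0])
  have "smooth_fun (prod_atlas A A) (\<lambda>z. h (fst z \<otimes> snd z))"
    by (rule smooth_fun_comp[OF h]) (intro smooth_intros)+
  from has_velocity_two_variables[OF atlas atlas this \<gamma>(2)
      has_velocity_push_forward[OF atlas atlas smooth_inv \<gamma>(2)]]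
  have "((\<lambda>s. h \<one>) has_real_derivative evec \<xi> h + evec \<xi> (\<lambda>c. h (inv c))) (at 0)"
    using \<gamma>(1) h by (simp add: push_forward_def o_def r_inv)
  then have "evec \<xi> h + evec \<xi> (\<lambda>c. h (inv c)) = 0"
    using DERIV_const DERIV_unique by blast
  then show ?thesis by simp
qed

section \<open>One-parameter subgroups and the exponential map\<close>

lemma has_velocity_translate:
  assumes "has_velocity A \<gamma> t (lfield \<xi> (\<gamma> t))"
  shows "has_velocity A (\<lambda>s. a \<otimes> \<gamma> s) t (lfield \<xi> (a \<otimes> \<gamma> t))"
  unfolding has_velocity_def
proof (intro allI impI)
  fix f assume f: "smooth_fun A f"
  then have "((\<lambda>s. f (a \<otimes> \<gamma> s)) has_real_derivative lfield \<xi> (\<gamma> t) (\<lambda>c. f (a \<otimes> c))) (at t)"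
    using assms smooth_fun_translate(1)[OF f, of a] unfolding has_velocity_def by blast
  then show "((\<lambda>s. f (a \<otimes> \<gamma> s)) has_real_derivative lfield \<xi> (a \<otimes> \<gamma> t) f) (at t)"
    by (simp add: lfield_translate[OF f])
qed

text \<open>In the chart the left-invariant field is the map \<open>F\<close> below, the derivative
  of the multiplication \<open>\<mu>\<close> in its second argument at the identity; the curve is a
  solution of \<open>x' = F x\<close> read back through the chart.\<close>

lemma local_integral_curve:
  obtains \<gamma> \<delta> where "\<delta> > 0" "\<gamma> 0 = \<one>" "\<And>t. \<bar>t\<bar> < \<delta> \<Longrightarrow> has_velocity A \<gamma> t (lfield \<xi> (\<gamma> t))"
proof -
  let ?inv = "inv_into U0 \<phi>0"
  note cinv = chart_inv[OF atlas U0(1)]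
  define \<Omega> where "\<Omega> = map_prod \<phi>0 \<phi>0 ` ((U0 \<times> U0) \<inter> (\<lambda>(a, b). a \<otimes> b) -` U0)"
  define \<mu> where "\<mu> z = \<phi>0 (?inv (fst z) \<otimes> ?inv (snd z))" for z
  have ch2: "(U0 \<times> U0, map_prod \<phi>0 \<phi>0) \<in> prod_atlas A A" using U0 by (auto simp: prod_atlas_def)
  have op: "open \<Omega>" unfolding \<Omega>_def
    by (rule chart_open_image[OF smooth_atlas_prod[OF atlas atlas] ch2])
      (auto intro!: open_Int open_Times chart_open[OF atlas U0(1)] smooth_map_open_vimage[OF smooth_mult])
  have sm: "smooth_on \<Omega> \<mu>"
    by (rule smooth_on_cong[OF op _ smooth_map_chart[OF smooth_mult ch2 U0(1), folded \<Omega>_def]])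
      (auto simp: \<Omega>_def \<mu>_def inv_into_map_prod chart_inj[OF atlas U0(1)])
  have mem: "(x, \<phi>0 \<one>) \<in> \<Omega>" if "x \<in> \<phi>0 ` U0" for x
    using that U0 unfolding \<Omega>_def by (auto intro!: image_eqI[of _ _ "(?inv x, \<one>)"] simp: cinv)
  define F where "F x = frechet_derivative \<mu> (at (x, \<phi>0 \<one>)) (0, \<xi>)" for x
  have opU: "open (\<phi>0 ` U0)" by (rule chart_image_open[OF atlas U0(1)])
  have F: "smooth_on (\<phi>0 ` U0) F" unfolding F_def
    by (rule smooth_on_compose[OF opU op _ smooth_on_frechet_derivative[OF sm], where g="\<lambda>x. (x, \<phi>0 \<one>)"])
      (rule smooth_on_Pair[OF opU smooth_on_bounded_linear[OF bounded_linear_ident opU] smooth_on_const[OF opU]],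
       use mem in auto)
  have "\<phi>0 \<one> \<in> \<phi>0 ` U0" using U0 by simp
  then obtain x \<delta> where x: "\<delta> > 0" "x 0 = \<phi>0 \<one>" "\<And>t. \<bar>t\<bar> < \<delta> \<Longrightarrow> x t \<in> \<phi>0 ` U0"
    "\<And>t. \<bar>t\<bar> < \<delta> \<Longrightarrow> (x has_vector_derivative F (x t)) (at t)"
    using ode_local[OF opU _ F] by metis
  define \<gamma> where "\<gamma> t = ?inv (x t)" for t
  have \<gamma>: "\<gamma> t \<in> U0" "\<phi>0 (\<gamma> t) = x t" if "\<bar>t\<bar> < \<delta>" for t
    using x(3)[OF that] by (auto simp: \<gamma>_def inv_into_into f_inv_into_f)
  show ?thesis
  proof (rule that[OF x(1)])
    show "\<gamma> 0 = \<one>" using x(2) cinv[OF U0(2)] by (simp add: \<gamma>_def)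
    fix t :: real assume t: "\<bar>t\<bar> < \<delta>"
    have S: "open {- \<delta><..<\<delta>}" "t \<in> {- \<delta><..<\<delta>}" "\<And>s. s \<in> {- \<delta><..<\<delta>} \<Longrightarrow> \<gamma> s \<in> U0"
      using t \<gamma>(1) by auto
    have "((\<lambda>s. \<phi>0 (\<gamma> s)) has_vector_derivative F (x t)) (at t)"
      by (rule has_vector_derivative_transform_within_open[OF x(4)[OF t] S(1,2)]) (use \<gamma>(2) in auto)
    note vel = has_velocity_chart_vec[OF atlas U0(1) \<gamma>(1)[OF t] S this]
    have "chart_vec A U0 \<phi>0 (\<gamma> t) (F (x t)) f = lfield \<xi> (\<gamma> t) f" if f: "smooth_fun A f" for f
    proof -
      let ?D = "frechet_derivative (\<lambda>x. f (?inv x)) (at (\<phi>0 (\<gamma> t)))"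
      have D: "((\<lambda>x. f (?inv x)) has_derivative ?D) (at (\<phi>0 (\<gamma> t)))"
        by (rule smooth_fun_chart_derivative[OF atlas U0(1) \<gamma>(1)[OF t] f])
      have "evec \<xi> (\<lambda>c. f (\<gamma> t \<otimes> c)) = ?D (frechet_derivative \<mu> (at (x t, \<phi>0 \<one>)) (0, \<xi>))"
        unfolding evec_def
      proof (rule chart_vecI[OF smooth_fun_translate(1)[OF f]])
        have m: "(\<mu> has_derivative frechet_derivative \<mu> (at (x t, \<phi>0 \<one>))) (at (x t, \<phi>0 \<one>))"
          by (rule smooth_on_has_derivative[OF sm mem[OF x(3)[OF t]]])
        have p: "((\<lambda>y. (x t, y)) has_derivative (\<lambda>y. (0, y))) (at (\<phi>0 \<one>))"
          by (auto intro!: derivative_eq_intros)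
        have \<mu>1: "\<mu> (x t, \<phi>0 \<one>) = \<phi>0 (\<gamma> t)" by (simp add: \<mu>_def \<gamma>_def cinv[OF U0(2)])
        have comp: "((\<lambda>y. f (?inv (\<mu> (x t, y)))) has_derivative
            (\<lambda>y. ?D (frechet_derivative \<mu> (at (x t, \<phi>0 \<one>)) (0, y)))) (at (\<phi>0 \<one>))"
          by (rule has_derivative_compose[OF has_derivative_compose[OF p m]]) (use D \<mu>1 in simp)
        have op': "open ((\<lambda>y. (x t, y)) -` \<Omega>)"
          by (rule open_vimage[OF op]) (intro continuous_intros)
        have eq: "f (?inv (\<mu> (x t, y))) = f (\<gamma> t \<otimes> ?inv y)" if "y \<in> (\<lambda>y. (x t, y)) -` \<Omega>" for y
          using that by (auto simp: \<mu>_def \<gamma>_def \<Omega>_def cinv)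
        show "((\<lambda>y. f (\<gamma> t \<otimes> ?inv y)) has_derivative
            (\<lambda>y. ?D (frechet_derivative \<mu> (at (x t, \<phi>0 \<one>)) (0, y)))) (at (\<phi>0 \<one>))"
          by (rule has_derivative_transform_within_open[OF comp op' _ eq]) (use mem[OF x(3)[OF t]] in auto)
      qed
      then show ?thesis using f by (simp add: chart_vec_def lfield_def F_def)
    qed
    then show "has_velocity A \<gamma> t (lfield \<xi> (\<gamma> t))"
      using vel by (simp add: has_velocity_def)
  qed
qed

text \<open>Left translates of integral curves are integral curves, so the local curve can be
  continued by powers of its own value \<open>g\<close> at time \<open>\<epsilon>\<close>: on the
  \<open>k\<close>-th interval of length \<open>\<epsilon>\<close> the curve is
  \<open>h k\<close>.\<close>

lemma global_integral_curve:
  obtains \<gamma> where "\<gamma> 0 = \<one>" "\<And>t. has_velocity A \<gamma> t (lfield \<xi> (\<gamma> t))"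
proof -
  obtain \<gamma>0 \<delta> where g0: "\<delta> > 0" "\<gamma>0 0 = \<one>" "\<And>t. \<bar>t\<bar> < \<delta> \<Longrightarrow> has_velocity A \<gamma>0 t (lfield \<xi> (\<gamma>0 t))"
    by (rule local_integral_curve[where \<xi>=\<xi>]) blast
  \<comment> \<open>Being smaller than \<open>\<delta>\<close>, it lets every piece remain an
    integral curve slightly beyond both ends of its interval, so both pieces meeting at a junction
    are differentiable there.\<close>
  define \<epsilon> where "\<epsilon> = \<delta> / 2"
  have \<epsilon>: "0 < \<epsilon>" "\<epsilon> < \<delta>" using g0 by (auto simp: \<epsilon>_def)
  define g where "g = \<gamma>0 \<epsilon>"
  define h where "h k s = g [^] (k::int) \<otimes> \<gamma>0 (s - real_of_int k * \<epsilon>)" for k s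
  define \<gamma> where "\<gamma> t = h \<lfloor>t / \<epsilon>\<rfloor> t" for t
  have hvel: "has_velocity A (h k) t (lfield \<xi> (h k t))" if "\<bar>t - real_of_int k * \<epsilon>\<bar> < \<delta>" for k t
  proof -
    have "has_velocity A (\<lambda>s. \<gamma>0 (s - real_of_int k * \<epsilon>)) t (lfield \<xi> (\<gamma>0 (t - real_of_int k * \<epsilon>)))"
      using has_velocity_shift[of A \<gamma>0 t "- (real_of_int k * \<epsilon>)"] g0(3)[OF that] by simp
    from has_velocity_translate[OF this] show ?thesis unfolding h_def[abs_def] .
  qed
  have hnext: "h (k + 1) (real_of_int (k + 1) * \<epsilon>) = h k (real_of_int (k + 1) * \<epsilon>)" for k
  proof -
    have "g [^] (k + 1) = g [^] k \<otimes> g" using int_pow_mult[of g k 1] by simp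
    then show ?thesis by (simp add: h_def g0(2) algebra_simps g_def)
  qed
  have fl: "\<gamma> s = h k s" if "real_of_int k * \<epsilon> \<le> s" "s < real_of_int (k + 1) * \<epsilon>" for k s
  proof -
    have "\<lfloor>s / \<epsilon>\<rfloor> = k" using that \<epsilon>(1) by (intro floor_unique) (simp_all add: field_simps)
    then show ?thesis by (simp add: \<gamma>_def)
  qed
  have "has_velocity A \<gamma> t (lfield \<xi> (\<gamma> t))" for t
    unfolding has_velocity_def
  proof (intro allI impI)
    fix f assume f: "smooth_fun A f"
    define k where "k = \<lfloor>t / \<epsilon>\<rfloor>"
    have "real_of_int k \<le> t / \<epsilon>" "t / \<epsilon> < real_of_int k + 1" unfolding k_def by linarith+
    then have k: "real_of_int k * \<epsilon> \<le> t" "t < real_of_int (k + 1) * \<epsilon>" using \<epsilon>(1) by (auto simp: field_simps)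
    have kt: "\<gamma> t = h k t" using fl[OF k] .
    have d1: "((\<lambda>s. f (h k s)) has_real_derivative lfield \<xi> (\<gamma> t) f) (at t)"
      using hvel[of t k] k \<epsilon> f unfolding kt has_velocity_def by (auto simp: algebra_simps)
    show "((\<lambda>s. f (\<gamma> s)) has_real_derivative lfield \<xi> (\<gamma> t) f) (at t)"
    proof (cases "real_of_int k * \<epsilon> = t")
      case False
      show ?thesis
        by (rule has_field_derivative_transform_within_open[OF d1, of "{real_of_int k * \<epsilon><..<real_of_int (k + 1) * \<epsilon>}"])
          (use False k fl[of k] in auto)
    next
      case True
      have eq: "h k t = h (k - 1) t" using hnext[of "k - 1"] True by simp
      have d2: "((\<lambda>s. f (h (k - 1) s)) has_real_derivative lfield \<xi> (\<gamma> t) f) (at t)"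
        using hvel[of t "k - 1"] True \<epsilon> f unfolding kt eq has_velocity_def by (auto simp: algebra_simps)
      show ?thesis
      proof (rule has_real_derivative_glue[OF d1 d2 _ \<epsilon>(1)])
        show "f (\<gamma> s) = f (h k s)" if "t \<le> s" "s < t + \<epsilon>" for s
          using fl[of k s] that True by (simp add: algebra_simps)
        show "f (\<gamma> s) = f (h (k - 1) s)" if "t - \<epsilon> < s" "s < t" for s
          using fl[of "k - 1" s] that True by (simp add: algebra_simps)
      qed (simp add: eq)
    qed
  qed
  moreover have "\<gamma> 0 = \<one>" by (simp add: \<gamma>_def h_def g0(2))
  ultimately show ?thesis by (rule that[rotated])
qed

text \<open>Along \<open>\<gamma>1 s \<otimes> inv (\<gamma>2 s)\<close> the two contributions to
  the derivative of a smooth function are \<open>evec \<xi>\<close> and its negative, applied to the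
  same function \<open>?h\<close>. So all smooth functions are constant there, and they separate
  points.\<close>

lemma integral_curve_unique:
  assumes "\<gamma>1 0 = \<one>" "\<gamma>2 0 = \<one>"
    and v1: "\<And>t. has_velocity A \<gamma>1 t (lfield \<xi> (\<gamma>1 t))"
    and v2: "\<And>t. has_velocity A \<gamma>2 t (lfield \<xi> (\<gamma>2 t))"
  shows "\<gamma>1 = \<gamma>2"
proof
  fix t
  have "\<gamma>1 t \<otimes> inv (\<gamma>2 t) = \<one>"
  proof (rule smooth_functions_separate_points[OF atlas])
    fix f assume f: "smooth_fun A f"
    have K: "smooth_fun (prod_atlas A A) (\<lambda>z. f (fst z \<otimes> inv (snd z)))"
      by (rule smooth_fun_comp[OF f]) (intro smooth_intros)+
    have "((\<lambda>s. f (\<gamma>1 s \<otimes> inv (\<gamma>2 s))) has_real_derivative 0) (at s)" for s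
    proof -
      let ?h = "\<lambda>c. f (\<gamma>1 s \<otimes> c \<otimes> inv (\<gamma>2 s))"
      have h: "smooth_fun A ?h" by (rule smooth_fun_translate(4)[OF f])
      have s1: "smooth_fun A (\<lambda>a. f (a \<otimes> inv (\<gamma>2 s)))" by (rule smooth_fun_translate(2)[OF f])
      have s2: "smooth_fun A (\<lambda>b. f (\<gamma>1 s \<otimes> inv b))"
        by (rule smooth_fun_comp[OF f atlas]) (intro smooth_intros)
      have "lfield \<xi> (\<gamma>1 s) (\<lambda>a. f (a \<otimes> inv (\<gamma>2 s))) = evec \<xi> ?h"
        using s1 by (simp add: lfield_def)
      moreover have "lfield \<xi> (\<gamma>2 s) (\<lambda>b. f (\<gamma>1 s \<otimes> inv b)) = - evec \<xi> ?h"
        using s2 evec_inverse[OF h] by (simp add: lfield_def inv_mult_group m_assoc)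
      ultimately show ?thesis
        using has_velocity_two_variables[OF atlas atlas K v1[of s] v2[of s]] by simp
    qed
    then have "f (\<gamma>1 t \<otimes> inv (\<gamma>2 t)) = f (\<gamma>1 0 \<otimes> inv (\<gamma>2 0))"
      by (intro DERIV_isconst_all) auto
    then show "f (\<gamma>1 t \<otimes> inv (\<gamma>2 t)) = f \<one>" using assms(1,2) by simp
  qed
  then show "\<gamma>1 t = \<gamma>2 t" by (metis in_carrier inv_closed inv_equality inv_inv)
qed

definition expc :: "'d \<Rightarrow> real \<Rightarrow> 'g" where
  "expc \<xi> = (SOME \<gamma>. \<gamma> 0 = \<one> \<and> (\<forall>t. has_velocity A \<gamma> t (lfield \<xi> (\<gamma> t))))"

lemma expc_zero [simp]: "expc \<xi> 0 = \<one>"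
  and expc_velocity: "has_velocity A (expc \<xi>) t (lfield \<xi> (expc \<xi> t))"
proof -
  have "\<exists>\<gamma>. \<gamma> 0 = \<one> \<and> (\<forall>t. has_velocity A \<gamma> t (lfield \<xi> (\<gamma> t)))"
    by (rule global_integral_curve) blast
  from someI_ex[OF this] show "expc \<xi> 0 = \<one>" "has_velocity A (expc \<xi>) t (lfield \<xi> (expc \<xi> t))"
    by (auto simp: expc_def)
qed

lemma expc_add: "expc \<xi> (s + t) = expc \<xi> s \<otimes> expc \<xi> t"
proof -
  have "has_velocity A (\<lambda>t. expc \<xi> (s + t)) t (lfield \<xi> (expc \<xi> (s + t)))" for t
    using has_velocity_shift[of A "expc \<xi>" t s] expc_velocity[of \<xi> "t + s"] by (simp add: add.commute)
  from has_velocity_translate[OF this, of "inv (expc \<xi> s)"]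
  have "(\<lambda>t. inv (expc \<xi> s) \<otimes> expc \<xi> (s + t)) = expc \<xi>"
    by (intro integral_curve_unique[where \<xi>=\<xi>] expc_velocity) simp_all
  then have "inv (expc \<xi> s) \<otimes> expc \<xi> (s + t) = expc \<xi> t" by (rule fun_cong)
  then show ?thesis by (metis in_carrier inv_solve_left)
qed

lemma expc_scale: "expc (c *\<^sub>R \<xi>) t = expc \<xi> (c * t)"
proof -
  have "has_velocity A (\<lambda>t. expc \<xi> (c * t)) t (lfield (c *\<^sub>R \<xi>) (expc \<xi> (c * t)))" for t
    unfolding has_velocity_def
  proof (intro allI impI)
    fix f assume "smooth_fun A f"
    then have "((\<lambda>s. f (expc \<xi> s)) has_real_derivative lfield \<xi> (expc \<xi> (c * t)) f) (at (c * t))"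
      using expc_velocity by (simp add: has_velocity_def)
    moreover have "((\<lambda>t. c * t) has_real_derivative c) (at t)" by (auto intro!: derivative_eq_intros)
    ultimately have "((\<lambda>t. f (expc \<xi> (c * t))) has_real_derivative lfield \<xi> (expc \<xi> (c * t)) f * c) (at t)"
      by (rule DERIV_chain2)
    then show "((\<lambda>t. f (expc \<xi> (c * t))) has_real_derivative lfield (c *\<^sub>R \<xi>) (expc \<xi> (c * t)) f) (at t)"
      by (simp add: linear_scale[OF lfield_linear] scaleR_fun_def mult.commute)
  qed
  then have "expc (c *\<^sub>R \<xi>) = (\<lambda>t. expc \<xi> (c * t))"
    by (intro integral_curve_unique[where \<xi>="c *\<^sub>R \<xi>"] expc_velocity) simp_all
  then show ?thesis by (rule fun_cong)
qed

text \<open>\<open>lie_exp\<close> is a definite description over curves defined for all times, so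
  it takes global existence as well as uniqueness.\<close>

lemma lie_exp_lfield: "lie_exp A G (lfield \<xi>) = expc \<xi> 1"
proof -
  have ic: "integral_curve A (lfield \<xi>) \<gamma> \<longleftrightarrow> (\<forall>t. has_velocity A \<gamma> t (lfield \<xi> (\<gamma> t)))" for \<gamma>
    by (simp add: integral_curve_def has_velocity_def)
  have "(THE \<gamma>. integral_curve A (lfield \<xi>) \<gamma> \<and> \<gamma> 0 = \<one>) = expc \<xi>"
    unfolding ic
    by (rule the_equality) (auto intro: expc_velocity integral_curve_unique[where \<xi>=\<xi>])
  then show ?thesis by (simp add: lie_exp_def)
qed

lemma lie_exp_scaleR: "lie_exp A G (t *\<^sub>R lfield \<xi>) = expc \<xi> t"
  using lie_exp_lfield[of "t *\<^sub>R \<xi>"] by (simp add: linear_scale[OF lfield_linear] expc_scale)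

end

section \<open>The adjoint representation\<close>

context lie_grp
begin

lemma evec_eqI:
  assumes "\<And>f. smooth_fun A f \<Longrightarrow> evec \<xi> f = evec \<eta> f" shows "\<xi> = \<eta>"
proof (rule evec_inj, rule ext)
  fix f show "evec \<xi> f = evec \<eta> f"
    by (cases "smooth_fun A f") (simp_all add: assms evec_nonsmooth)
qed

lemma smooth_fun_evec:
  assumes "smooth_atlas B" "smooth_fun (prod_atlas A B) K"
  shows "smooth_fun B (\<lambda>b. evec \<xi> (\<lambda>a. K (a, b)))"
  unfolding evec_def by (rule smooth_fun_chart_vec1[OF atlas assms U0])

lemma evec_commute:
  assumes "smooth_fun (prod_atlas A A) K"
  shows "evec \<xi> (\<lambda>a. evec \<eta> (\<lambda>b. K (a, b))) = evec \<eta> (\<lambda>b. evec \<xi> (\<lambda>a. K (a, b)))"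
  unfolding evec_def by (rule chart_vec_commute[OF atlas atlas assms U0 U0])

lemma evec_expand: "evec \<xi> f = (\<Sum>b\<in>Basis. (\<xi> \<bullet> b) * evec b f)"
  using linear_euclidean_expand[OF evec_linear[of f], of \<xi>] by simp

text \<open>The differential of conjugation at the identity, in coordinates. \<open>evec_Ad\<close>
  extends the formula from the coordinate functions to all smooth functions.\<close>

definition Ad :: "'g \<Rightarrow> 'd \<Rightarrow> 'd" where
  "Ad a \<xi> = (\<Sum>b\<in>Basis. evec \<xi> (\<lambda>c. coords b (a \<otimes> c \<otimes> inv a)) *\<^sub>R b)"

lemma Ad_inner: "b \<in> Basis \<Longrightarrow> Ad a \<xi> \<bullet> b = evec \<xi> (\<lambda>c. coords b (a \<otimes> c \<otimes> inv a))"
  by (simp add: Ad_def)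

lemma evec_Ad:
  assumes f: "smooth_fun A f" shows "evec (Ad a \<xi>) f = evec \<xi> (\<lambda>c. f (a \<otimes> c \<otimes> inv a))"
proof -
  let ?F = "\<lambda>c. a \<otimes> c \<otimes> inv a"
  have F: "smooth_map A A ?F" by (intro smooth_intros)
  have "push_forward A ?F (evec \<xi>) \<in> tangent_space A \<one>"
    using push_forward_tangent[OF atlas atlas F evec_tangent[of \<xi>]] by simp
  then obtain \<zeta> where \<zeta>: "push_forward A ?F (evec \<xi>) = evec \<zeta>"
    unfolding evec_def[of \<zeta> for \<zeta>] using tangent_is_chart_vec[OF atlas U0] by metis
  have eq: "evec \<zeta> f = evec \<xi> (\<lambda>c. f (?F c))" if "smooth_fun A f" for f
    using fun_cong[OF \<zeta>, of f] that by (simp add: push_forward_def o_def)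
  have "\<zeta> = Ad a \<xi>"
    by (rule euclidean_eqI) (simp add: Ad_inner eq[symmetric] smooth_coords evec_coords)
  then show ?thesis using eq[OF f] by simp
qed

lemma Ad_linear: "linear (Ad a)"
proof (rule linearI)
  show "Ad a (x + y) = Ad a x + Ad a y" for x y
    by (rule euclidean_eqI) (simp add: Ad_inner inner_add_left linear_add[OF evec_linear])
  show "Ad a (c *\<^sub>R x) = c *\<^sub>R Ad a x" for c x
    by (rule euclidean_eqI) (simp add: Ad_inner linear_scale[OF evec_linear])
qed

lemma Ad_one: "Ad \<one> \<xi> = \<xi>"
  by (rule evec_eqI) (simp add: evec_Ad)

lemma Ad_mult: "Ad (a \<otimes> b) \<xi> = Ad a (Ad b \<xi>)"
proof (rule evec_eqI)
  fix f assume f: "smooth_fun A f"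
  show "evec (Ad (a \<otimes> b) \<xi>) f = evec (Ad a (Ad b \<xi>)) f"
    using evec_Ad[OF smooth_fun_translate(4)[OF f, of a "inv a"], of b \<xi>] f
    by (simp add: evec_Ad inv_mult_group m_assoc)
qed

lemma smooth_fun_evec_Ad:
  assumes "smooth_fun A f" shows "smooth_fun A (\<lambda>a. evec (Ad a \<xi>) f)"
proof -
  have "smooth_fun (prod_atlas A A) (\<lambda>z. f (snd z \<otimes> fst z \<otimes> inv (snd z)))"
    by (rule smooth_fun_comp[OF assms]) (intro smooth_intros)+
  from smooth_fun_evec[OF atlas this, of \<xi>] show ?thesis by (simp add: evec_Ad[OF assms])
qed

lemma smooth_fun_Ad: "b \<in> Basis \<Longrightarrow> smooth_fun A (\<lambda>a. Ad a \<xi> \<bullet> b)"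
  using smooth_fun_evec_Ad[OF smooth_coords] by (simp add: evec_coords)

lemma continuous_Ad: "continuous_on UNIV (\<lambda>a. Ad a \<xi>)"
proof -
  have "continuous_on UNIV (\<lambda>a. \<Sum>b\<in>Basis. (Ad a \<xi> \<bullet> b) *\<^sub>R b)"
    by (intro continuous_on_sum continuous_on_scaleR continuous_on_const
        smooth_map_continuous[OF smooth_fun_Ad])
  then show ?thesis by (simp add: euclidean_representation)
qed

text \<open>The derivative of \<open>Ad\<close> at the identity, that is \<open>ad\<close>.
  \<open>lfield_br\<close> identifies it with the bracket of left-invariant fields.\<close>

definition br :: "'d \<Rightarrow> 'd \<Rightarrow> 'd" where
  "br \<xi> \<eta> = (\<Sum>b\<in>Basis. evec \<xi> (\<lambda>a. Ad a \<eta> \<bullet> b) *\<^sub>R b)"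

lemma br_inner: "b \<in> Basis \<Longrightarrow> br \<xi> \<eta> \<bullet> b = evec \<xi> (\<lambda>a. Ad a \<eta> \<bullet> b)"
  by (simp add: br_def)

lemma evec_br_Ad:
  assumes f: "smooth_fun A f" shows "evec (br \<xi> \<eta>) f = evec \<xi> (\<lambda>a. evec (Ad a \<eta>) f)"
proof -
  have sm: "smooth_fun A (\<lambda>a. evec b f * (Ad a \<eta> \<bullet> b))" if "b \<in> Basis" for b
    by (rule smooth_fun_mult[OF atlas smooth_fun_const[OF atlas] smooth_fun_Ad[OF that]])
  have "evec \<xi> (\<lambda>a. evec (Ad a \<eta>) f) = evec \<xi> (\<lambda>a. \<Sum>b\<in>Basis. evec b f * (Ad a \<eta> \<bullet> b))"
    by (simp add: evec_expand[of "Ad _ \<eta>"] mult.commute)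
  also have "\<dots> = (\<Sum>b\<in>Basis. evec \<xi> (\<lambda>a. evec b f * (Ad a \<eta> \<bullet> b)))"
    by (rule evec_sum[OF finite_Basis sm])
  also have "\<dots> = (\<Sum>b\<in>Basis. (br \<xi> \<eta> \<bullet> b) * evec b f)"
    by (rule sum.cong) (simp_all add: evec_scale[OF smooth_fun_Ad] br_inner)
  finally show ?thesis by (simp add: evec_expand[of "br \<xi> \<eta>"])
qed

text \<open>The two places where \<open>a\<close> enters a conjugation are made independent in
  \<open>f (a \<otimes> c \<otimes> inv b)\<close>, differentiated in \<open>c\<close>. Along the
  diagonal the left place contributes the derivative of \<open>lfield \<eta>\<close>; the right one
  gets a minus sign from the inverse and becomes the derivative of \<open>lfield \<xi>\<close> once
  the mixed derivatives are exchanged.\<close>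

lemma evec_br:
  assumes f: "smooth_fun A f"
  shows "evec (br \<xi> \<eta>) f = evec \<xi> (\<lambda>a. lfield \<eta> a f) - evec \<eta> (\<lambda>a. lfield \<xi> a f)"
proof -
  obtain \<gamma> where \<gamma>: "\<gamma> 0 = \<one>" "has_velocity A \<gamma> 0 (evec \<xi>)"
    unfolding evec_def by (rule chart_vec_velocity[OF atlas U0])
  define \<Psi> where "\<Psi> z = evec \<eta> (\<lambda>c. f (fst z \<otimes> c \<otimes> inv (snd z)))" for z
  have AA: "smooth_atlas (prod_atlas A A)" and AAA: "smooth_atlas (prod_atlas A (prod_atlas A A))"
    by (intro smooth_atlas_prod atlas)+
  have fs: "smooth_map (prod_atlas A (prod_atlas A A)) A (\<lambda>z. fst (snd z))"
    "smooth_map (prod_atlas A (prod_atlas A A)) A (\<lambda>z. snd (snd z))"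
    by (rule smooth_map_compose[OF AAA AA atlas smooth_map_snd[OF atlas AA] smooth_map_fst[OF atlas atlas]],
        rule smooth_map_compose[OF AAA AA atlas smooth_map_snd[OF atlas AA] smooth_map_snd[OF atlas atlas]])
  have "smooth_fun (prod_atlas A (prod_atlas A A)) (\<lambda>z. f (fst (snd z) \<otimes> fst z \<otimes> inv (snd (snd z))))"
    by (rule smooth_fun_comp[OF f AAA]) (intro smooth_map_mult smooth_map_inv AAA fs smooth_map_fst[OF atlas AA])
  from smooth_fun_evec[OF AA this, of \<eta>] have \<Psi>: "smooth_fun (prod_atlas A A) \<Psi>"
    by (simp add: \<Psi>_def[abs_def])
  have "((\<lambda>s. \<Psi> (\<gamma> s, \<gamma> s)) has_real_derivative evec \<xi> (\<lambda>a. \<Psi> (a, \<one>)) + evec \<xi> (\<lambda>b. \<Psi> (\<one>, b))) (at 0)"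
    using has_velocity_two_variables[OF atlas atlas \<Psi> \<gamma>(2) \<gamma>(2)] \<gamma>(1) by simp
  moreover have "smooth_fun A (\<lambda>a. \<Psi> (a, a))"
    by (rule smooth_fun_compose[OF atlas AA smooth_map_Pair[OF atlas atlas atlas smooth_map_id[OF atlas]
            smooth_map_id[OF atlas]] \<Psi>])
  then have "((\<lambda>s. \<Psi> (\<gamma> s, \<gamma> s)) has_real_derivative evec \<xi> (\<lambda>a. \<Psi> (a, a))) (at 0)"
    by (rule has_velocityD[OF \<gamma>(2)])
  ultimately have "evec \<xi> (\<lambda>a. \<Psi> (a, a)) = evec \<xi> (\<lambda>a. \<Psi> (a, \<one>)) + evec \<xi> (\<lambda>b. \<Psi> (\<one>, b))"
    using DERIV_unique by blast
  moreover have "evec \<xi> (\<lambda>a. \<Psi> (a, a)) = evec (br \<xi> \<eta>) f"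
    by (simp add: evec_br_Ad[OF f] evec_Ad[OF f] \<Psi>_def)
  moreover have "(\<lambda>a. \<Psi> (a, \<one>)) = (\<lambda>a. lfield \<eta> a f)"
    using f by (simp add: \<Psi>_def lfield_def)
  moreover have "evec \<xi> (\<lambda>b. \<Psi> (\<one>, b)) = - evec \<eta> (\<lambda>c. lfield \<xi> c f)"
  proof -
    define k where "k b = evec \<eta> (\<lambda>c. f (c \<otimes> b))" for b
    have sm: "smooth_fun (prod_atlas A A) (\<lambda>z. f (fst z \<otimes> snd z))"
      "smooth_fun (prod_atlas A A) (\<lambda>z. f (snd z \<otimes> fst z))"
      by (rule smooth_fun_comp[OF f]; intro smooth_intros)+
    have "smooth_fun A k" unfolding k_def[abs_def] using smooth_fun_evec[OF atlas sm(1)] by simp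
    from evec_inverse[OF this, of \<xi>] have "evec \<xi> (\<lambda>b. \<Psi> (\<one>, b)) = - evec \<xi> k"
      by (simp add: \<Psi>_def k_def)
    also have "evec \<xi> k = evec \<eta> (\<lambda>c. evec \<xi> (\<lambda>b. f (c \<otimes> b)))"
      unfolding k_def[abs_def] using evec_commute[OF sm(2), of \<xi> \<eta>] by simp
    finally show ?thesis using f by (simp add: lfield_def)
  qed
  ultimately show ?thesis by simp
qed

lemma lfield_apply: "smooth_fun A f \<Longrightarrow> lfield \<xi> b f = evec \<xi> (\<lambda>c. f (b \<otimes> c))"
  by (simp add: lfield_def)

lemma lfield_br_apply:
  assumes f: "smooth_fun A f"
  shows "lfield (br \<xi> \<eta>) b f = lfield \<xi> b (\<lambda>a. lfield \<eta> a f) - lfield \<eta> b (\<lambda>a. lfield \<xi> a f)"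
  using evec_br[OF smooth_fun_translate(1)[OF f, of b], of \<xi> \<eta>]
  by (simp add: lfield_apply[OF f, of "br \<xi> \<eta>"] lfield_translate[OF f]
      lfield_apply[OF smooth_fun_lfield[OF f]])

lemma lfield_br: "lfield (br \<xi> \<eta>) = lie_bracket (lfield \<xi>) (lfield \<eta>)"
proof (intro ext)
  fix b f
  show "lfield (br \<xi> \<eta>) b f = lie_bracket (lfield \<xi>) (lfield \<eta>) b f"
  proof (cases "smooth_fun A f")
    case True
    then show ?thesis by (simp add: lfield_br_apply lie_bracket_def)
  next
    case False
    then show ?thesis
      using tangent_const[OF atlas lfield_tangent] by (simp add: lie_bracket_def lfield_def evec_const)
  qed
qed

lemma br_linear_right: "linear (br \<xi>)"
proof (rule linearI)
  show "br \<xi> (x + y) = br \<xi> x + br \<xi> y" for x y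
    by (rule euclidean_eqI)
      (simp add: br_inner inner_add_left linear_add[OF Ad_linear] evec_add[OF smooth_fun_Ad smooth_fun_Ad])
  show "br \<xi> (c *\<^sub>R x) = c *\<^sub>R br \<xi> x" for c x
    by (rule euclidean_eqI)
      (simp add: br_inner linear_scale[OF Ad_linear] evec_scale[OF smooth_fun_Ad])
qed

lemma br_antisym: "br \<xi> \<eta> = - br \<eta> \<xi>"
  by (rule evec_eqI) (simp add: evec_br linear_neg[OF evec_linear])

lemma br_jacobi: "br \<xi> (br \<eta> \<zeta>) = br (br \<xi> \<eta>) \<zeta> + br \<eta> (br \<xi> \<zeta>)"
proof (rule evec_eqI)
  fix f assume f: "smooth_fun A f"
  note sm = smooth_fun_lfield[OF f] smooth_fun_lfield[OF smooth_fun_lfield[OF f]]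
  have expand: "evec (br x (br y z)) f =
      evec x (\<lambda>b. lfield y b (\<lambda>a. lfield z a f)) - evec x (\<lambda>b. lfield z b (\<lambda>a. lfield y a f))
      - (evec y (\<lambda>b. lfield z b (\<lambda>a. lfield x a f)) - evec z (\<lambda>b. lfield y b (\<lambda>a. lfield x a f)))" for x y z
    by (simp add: evec_br[OF f, of x] evec_br[OF sm(1)] lfield_br_apply[OF f] evec_diff[OF sm(2) sm(2)])
  have "evec (br (br \<xi> \<eta>) \<zeta>) f = - evec (br \<zeta> (br \<xi> \<eta>)) f"
    by (subst br_antisym) (simp add: linear_neg[OF evec_linear])
  then show "evec (br \<xi> (br \<eta> \<zeta>)) f = evec (br (br \<xi> \<eta>) \<zeta> + br \<eta> (br \<xi> \<zeta>)) f"
    by (simp add: linear_add[OF evec_linear] expand)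
qed

text \<open>At time \<open>0\<close> this is the definition of \<open>br\<close>; the one-parameter
  subgroup property moves it to any other time.\<close>

lemma Ad_expc_derivative: "((\<lambda>s. Ad (expc \<xi> s) \<eta>) has_vector_derivative br \<xi> (Ad (expc \<xi> t) \<eta>)) (at t)"
proof -
  have 0: "((\<lambda>s. Ad (expc \<xi> s) \<zeta>) has_vector_derivative br \<xi> \<zeta>) (at 0)" for \<zeta>
  proof -
    have "((\<lambda>s. \<Sum>b\<in>Basis. (Ad (expc \<xi> s) \<zeta> \<bullet> b) *\<^sub>R b) has_vector_derivative
        (\<Sum>b\<in>Basis. (br \<xi> \<zeta> \<bullet> b) *\<^sub>R b)) (at 0)"
    proof (rule has_vector_derivative_sum)
      fix b :: 'd assume b: "b \<in> Basis"
      have "((\<lambda>s. Ad (expc \<xi> s) \<zeta> \<bullet> b) has_real_derivative br \<xi> \<zeta> \<bullet> b) (at 0)"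
        using has_velocityD[OF expc_velocity[of \<xi> 0] smooth_fun_Ad[OF b, of \<zeta>]] b
        by (simp add: lfield_one br_inner)
      then show "((\<lambda>s. (Ad (expc \<xi> s) \<zeta> \<bullet> b) *\<^sub>R b) has_vector_derivative (br \<xi> \<zeta> \<bullet> b) *\<^sub>R b) (at 0)"
        using has_vector_derivative_scaleR[OF _ has_vector_derivative_const] by fastforce
    qed
    then show ?thesis by (simp add: euclidean_representation)
  qed
  have "((\<lambda>s. Ad (expc \<xi> (s - t)) (Ad (expc \<xi> t) \<eta>)) has_vector_derivative
      1 *\<^sub>R br \<xi> (Ad (expc \<xi> t) \<eta>)) (at t)"
  proof (rule vector_diff_chain_at[where f="\<lambda>s. s - t" and g="\<lambda>s. Ad (expc \<xi> s) (Ad (expc \<xi> t) \<eta>)",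
        unfolded o_def])
    show "((\<lambda>s. s - t) has_vector_derivative 1) (at t)" by (auto intro!: derivative_eq_intros)
  qed (use 0 in simp)
  moreover have "Ad (expc \<xi> (s - t)) (Ad (expc \<xi> t) \<eta>) = Ad (expc \<xi> s) \<eta>" for s
    using expc_add[of \<xi> "s - t" t] by (simp add: Ad_mult[symmetric])
  ultimately show ?thesis by simp
qed

text \<open>Left translation carries every chart vector to the identity, so vanishing along all
  left-invariant fields makes the differential vanish in a chart.\<close>

lemma locally_constant:
  assumes F: "smooth_fun A F" and zero: "\<And>\<xi> a. lfield \<xi> a F = 0"
  obtains N where "open N" "p \<in> N" "\<And>x. x \<in> N \<Longrightarrow> F x = F p"
proof -
  obtain U \<phi> where U: "(U, \<phi>) \<in> A" "p \<in> U" using atlas_cover[OF atlas] .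
  have vec0: "chart_vec A U \<phi> q \<eta> F = 0" if q: "q \<in> U" for q \<eta>
  proof -
    let ?L = "\<lambda>c. inv q \<otimes> c"
    have L: "smooth_map A A ?L" by (intro smooth_intros)
    have "push_forward A ?L (chart_vec A U \<phi> q \<eta>) \<in> tangent_space A \<one>"
      using push_forward_tangent[OF atlas atlas L chart_vec_tangent[OF atlas U(1) q]] by simp
    then obtain \<zeta> where \<zeta>: "push_forward A ?L (chart_vec A U \<phi> q \<eta>) = evec \<zeta>"
      unfolding evec_def[of \<zeta> for \<zeta>] using tangent_is_chart_vec[OF atlas U0] by metis
    have "chart_vec A U \<phi> q \<eta> F = evec \<zeta> (\<lambda>c. F (q \<otimes> c))"
      using fun_cong[OF \<zeta>, of "\<lambda>c. F (q \<otimes> c)"] smooth_fun_translate(1)[OF F, of q]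
      by (simp add: push_forward_def o_def m_assoc[symmetric])
    then show ?thesis using zero[of \<zeta> q] F by (simp add: lfield_def)
  qed
  let ?F = "\<lambda>x. F (inv_into U \<phi> x)"
  obtain r where r: "r > 0" "ball (\<phi> p) r \<subseteq> \<phi> ` U"
    using chart_image_open[OF atlas U(1)] U(2) open_contains_ball by blast
  have "(?F has_derivative (\<lambda>v. 0)) (at x within ball (\<phi> p) r)" if x: "x \<in> ball (\<phi> p) r" for x
  proof -
    obtain q where q: "q \<in> U" "x = \<phi> q" using x r by blast
    have "frechet_derivative ?F (at x) = (\<lambda>v. 0)"
      using vec0[OF q(1)] F q(2) by (auto simp: chart_vec_def)
    then show ?thesis
      using smooth_fun_chart_derivative[OF atlas U(1) q(1) F] q(2) has_derivative_at_withinI by metis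
  qed
  then have const: "?F x = ?F (\<phi> p)" if "x \<in> ball (\<phi> p) r" for x
    using has_derivative_zero_unique[OF convex_ball, of "\<phi> p" r ?F "\<phi> p" x] that r(1) by simp
  show ?thesis
  proof
    show "open (U \<inter> \<phi> -` ball (\<phi> p) r)"
      by (rule continuous_open_preimage[OF chart_cont[OF atlas U(1)] chart_open[OF atlas U(1)] open_ball])
    show "p \<in> U \<inter> \<phi> -` ball (\<phi> p) r" using U r by simp
    show "F x = F p" if "x \<in> U \<inter> \<phi> -` ball (\<phi> p) r" for x
      using const[of "\<phi> x"] that chart_inv[OF atlas U(1)] U(2) by simp
  qed
qed

end

section \<open>Invariant inner products\<close>

text \<open>Gram-Schmidt for the form \<open>Q x \<bullet> y\<close>, indexed by
  \<open>Basis\<close>: while an index is missing, some nonzero vector is orthogonal to all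
  \<open>Q (u i)\<close> found so far.\<close>

lemma orthonormal_frame:
  fixes Q :: "'d::euclidean_space \<Rightarrow> 'd"
  assumes lin: "linear Q" and sym: "\<And>x y. Q x \<bullet> y = Q y \<bullet> x" and pos: "\<And>x. x \<noteq> 0 \<Longrightarrow> Q x \<bullet> x > 0"
  obtains u :: "'d \<Rightarrow> 'd" where "\<And>i j. i \<in> Basis \<Longrightarrow> j \<in> Basis \<Longrightarrow> Q (u i) \<bullet> u j = (if i = j then 1 else 0)"
proof -
  have "\<exists>u :: 'd \<Rightarrow> 'd. \<forall>i\<in>S. \<forall>j\<in>S. Q (u i) \<bullet> u j = (if i = j then 1 else 0)" if "finite S" "S \<subseteq> Basis" for S :: "'d set"
    using that
  proof (induction S rule: finite_induct)
    case empty
    then show ?case by simp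
  next
    case (insert k S)
    then obtain u where u: "\<And>i j. i \<in> S \<Longrightarrow> j \<in> S \<Longrightarrow> Q (u i) \<bullet> u j = (if i = j then 1 else 0)" by blast
    let ?V = "(\<lambda>i. Q (u i)) ` S"
    have "S \<subset> Basis" using insert by blast
    then have "card S < DIM('d)" by (intro psubset_card_mono) auto
    then have "dim ?V < DIM('d)"
      using dim_le_card[of ?V ?V] card_image_le[OF insert(1), of "\<lambda>i. Q (u i)"] insert(1)
      by (auto simp: span_superset)
    then obtain x where x: "x \<noteq> 0" "\<And>y. y \<in> span ?V \<Longrightarrow> orthogonal x y"
      using orthogonal_to_subspace_exists[of ?V] by metis
    have xi: "Q (u i) \<bullet> x = 0" if "i \<in> S" for i
      using x(2)[OF span_base, of "Q (u i)"] that by (simp add: orthogonal_def inner_commute)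
    define n where "n = sqrt (Q x \<bullet> x)"
    have n: "n > 0" "n * n = Q x \<bullet> x" using pos[OF x(1)] by (auto simp: n_def)
    define w where "w = (1 / n) *\<^sub>R x"
    have w1: "Q w \<bullet> w = 1" using n by (simp add: w_def linear_scale[OF lin] n(2)[symmetric])
    have w0: "Q (u i) \<bullet> w = 0" "Q w \<bullet> u i = 0" if "i \<in> S" for i
      using xi[OF that] sym[of w "u i"] by (auto simp: w_def)
    show ?case
    proof (intro exI[of _ "u(k := w)"] ballI)
      fix i j assume "i \<in> insert k S" "j \<in> insert k S"
      then consider "i = k" "j = k" | "i = k" "j \<in> S" "j \<noteq> k" | "j = k" "i \<in> S" "i \<noteq> k"
        | "i \<in> S" "j \<in> S" "i \<noteq> k" "j \<noteq> k" by blast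
      then show "Q ((u(k := w)) i) \<bullet> (u(k := w)) j = (if i = j then 1 else 0)"
        by cases (simp_all add: w0 w1 u)
    qed
  qed
  from this[OF finite_Basis subset_refl] obtain u :: "'d \<Rightarrow> 'd"
    where u: "\<forall>i\<in>Basis. \<forall>j\<in>Basis. Q (u i) \<bullet> u j = (if i = j then 1 else 0)" by blast
  show ?thesis by (rule that[of u]) (simp add: u)
qed

lemma square_midpoint:
  fixes x y c :: real
  shows "((x + y) / 2)\<^sup>2 = x\<^sup>2 / 2 + y\<^sup>2 / 2 - (x - y)\<^sup>2 / 4"
  by (simp add: power2_eq_square field_simps)

text \<open>Haar measure is avoided: on the invariant closed convex set \<open>S\<close> of forms bounded below along
  the group, the supremum over the group of a strictly convex function has a unique minimiser, which
  is therefore invariant.\<close>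

lemma invariant_form:
  fixes R :: "'g::topological_space \<Rightarrow> 'd::euclidean_space \<Rightarrow> 'd"
    and mul :: "'g \<Rightarrow> 'g \<Rightarrow> 'g" and inver :: "'g \<Rightarrow> 'g"
  assumes comp: "compact (UNIV :: 'g set)" and lin: "\<And>a. linear (R a)"
    and cont: "\<And>x. continuous_on UNIV (\<lambda>a. R a x)"
    and mul: "\<And>a b x. R (mul a b) x = R a (R b x)"
    and inver: "\<And>a x. R a (R (inver a) x) = x" "\<And>a x. R (inver a) (R a x) = x"
    and e: "\<And>x. R e x = x"
  obtains Q :: "'d \<Rightarrow> 'd" where "linear Q" "\<And>x y. Q x \<bullet> y = Q y \<bullet> x" "\<And>x. x \<noteq> 0 \<Longrightarrow> Q x \<bullet> x > 0"
    "\<And>a x y. Q (R a x) \<bullet> R a y = Q x \<bullet> y"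
proof -
  have "\<exists>C. \<forall>a. norm (R a i) \<le> C" for i
  proof -
    have "bounded (range (\<lambda>a. R a i))"
      by (intro compact_imp_bounded compact_continuous_image cont comp)
    then show ?thesis by (auto simp: bounded_iff)
  qed
  then obtain C where C: "\<And>i a. norm (R a i) \<le> C i" by metis
  have C0: "C i \<ge> 0" for i using order_trans[OF norm_ge_zero C] .
  define M where "M = (\<Sum>i\<in>Basis. C i) + 1"
  have M: "M > 0" using sum_nonneg[of Basis C] C0 by (simp add: M_def add_nonneg_pos)
  have bound: "norm (R a x) \<le> M * norm x" for a x
  proof -
    have "norm (R a x) = norm (\<Sum>b\<in>Basis. (x \<bullet> b) *\<^sub>R R a b)"
      using linear_euclidean_expand[OF lin] by metis
    also have "\<dots> \<le> (\<Sum>b\<in>Basis. norm x * C b)"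
      by (rule order_trans[OF norm_sum]) (auto intro!: sum_mono mult_mono simp: Basis_le_norm C)
    also have "\<dots> = norm x * sum C Basis" by (rule sum_distrib_left[symmetric])
    also have "\<dots> \<le> M * norm x" by (simp add: M_def algebra_simps)
    finally show ?thesis .
  qed
  have lower: "norm x \<le> M * norm (R a x)" for a x
    using bound[of "inver a" "R a x"] by (simp add: inver)
  define q where "q Q a x y = blinfun_apply Q (R a x) \<bullet> R a y" for Q :: "'d \<Rightarrow>\<^sub>L 'd" and a x y
  \<comment> \<open>The squared Hilbert-Schmidt norm of the form \<open>Q\<close> pulled back by
    \<open>R a\<close>. Its supremum over \<open>a\<close> is the function to be minimised, and
    \<open>P c\<close> says that some admissible \<open>Q\<close> keeps it below
    \<open>c\<close>.\<close>
  define H where "H Q a = (\<Sum>i\<in>Basis. \<Sum>j\<in>Basis. (q Q a i j)\<^sup>2)" for Q a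
  \<comment> \<open>The lower bound holds for the identity by \<open>lower\<close>, passes to
    limits, and forces the minimiser to be positive definite.\<close>
  define S where "S = {Q. (\<forall>x y. blinfun_apply Q x \<bullet> y = blinfun_apply Q y \<bullet> x) \<and>
      (\<forall>a x. (norm x)\<^sup>2 \<le> M\<^sup>2 * q Q a x x)}"
  define P where "P c \<longleftrightarrow> (\<exists>Q\<in>S. \<forall>a. H Q a \<le> c)" for c
  have contQ: "continuous_on UNIV (\<lambda>Q. q Q a x y)" for a x y
    unfolding q_def by (intro continuous_intros)
  have contH: "continuous_on UNIV (\<lambda>Q. H Q a)" for a
    unfolding H_def by (intro continuous_intros contQ)
  have contHa: "continuous_on UNIV (\<lambda>a. H Q a)" for Q
    unfolding H_def q_def by (intro continuous_intros cont)
  have H_nonneg: "H Q a \<ge> 0" for Q a unfolding H_def by (intro sum_nonneg) auto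
  have idS: "id_blinfun \<in> S"
  proof -
    have "(norm x)\<^sup>2 \<le> M\<^sup>2 * (R a x \<bullet> R a x)" for a x
      using power_mono[OF lower[of x a] norm_ge_zero, of 2] by (simp add: power_mult_distrib power2_norm_eq_inner)
    then show ?thesis by (simp add: S_def q_def inner_commute)
  qed
  obtain c1 where c1: "P c1"
  proof -
    have "bounded (range (\<lambda>a. H id_blinfun a))"
      by (intro compact_imp_bounded compact_continuous_image contHa comp)
    then obtain c where "\<And>a. \<bar>H id_blinfun a\<bar> \<le> c" by (auto simp: bounded_iff)
    then have "P c" unfolding P_def using idS by (meson abs_le_D1)
    then show ?thesis by (rule that)
  qed
  define c0 where "c0 = Inf {c. P c}"
  have Pnn: "0 \<le> c" if "P c" for c using that H_nonneg order_trans unfolding P_def by blast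
  then have bdd: "bdd_below {c. P c}" by (auto simp: bdd_below_def)
  have c0_le: "c0 \<le> c" if "P c" for c unfolding c0_def by (rule cInf_lower[OF _ bdd]) (use that in simp)
  have "\<exists>Q\<in>S. \<forall>a. H Q a \<le> c0 + 1 / real (Suc n)" for n
  proof -
    have "Inf {c. P c} < c0 + 1 / real (Suc n)" by (simp add: c0_def)
    then obtain c where "P c" "c < c0 + 1 / real (Suc n)"
      using cInf_lessD[of "{c. P c}"] c1 by blast
    then show ?thesis unfolding P_def by (meson less_imp_le order_trans)
  qed
  then obtain Qs where Qs: "\<And>n. Qs n \<in> S" "\<And>n a. H (Qs n) a \<le> c0 + 1 / real (Suc n)" by metis
  \<comment> \<open>The entries at \<open>e\<close> alone bound the norm, so a minimising sequence
    is bounded and has a convergent subsequence in finite dimension.\<close>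
  have normH: "norm Q \<le> (\<Sum>i\<in>(Basis::'d set). \<Sum>j\<in>(Basis::'d set). sqrt (H Q e))" for Q
  proof -
    have 1: "\<bar>blinfun_apply Q i \<bullet> j\<bar> \<le> sqrt (H Q e)" if "i \<in> Basis" "j \<in> Basis" for i j
    proof -
      have "(q Q e i j)\<^sup>2 \<le> (\<Sum>j\<in>(Basis::'d set). (q Q e i j)\<^sup>2)" by (rule member_le_sum[OF that(2)]) auto
      also have "\<dots> \<le> H Q e" unfolding H_def
        by (rule member_le_sum[OF that(1), of "\<lambda>i. \<Sum>j\<in>(Basis::'d set). (q Q e i j)\<^sup>2"]) (auto intro: sum_nonneg)
      finally have "sqrt ((q Q e i j)\<^sup>2) \<le> sqrt (H Q e)" by (rule real_sqrt_le_mono)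
      then show ?thesis by (simp add: q_def e)
    qed
    have "norm (blinfun_apply Q x) \<le> norm x * (\<Sum>i\<in>(Basis::'d set). \<Sum>j\<in>(Basis::'d set). sqrt (H Q e))" for x
    proof -
      have n: "norm (blinfun_apply Q i) \<le> (\<Sum>j\<in>(Basis::'d set). sqrt (H Q e))" if "i \<in> Basis" for i
        by (rule order_trans[OF norm_le_l1 sum_mono]) (rule 1[OF that])
      have "norm (\<Sum>i\<in>(Basis::'d set). (x \<bullet> i) *\<^sub>R blinfun_apply Q i) \<le>
          (\<Sum>i\<in>(Basis::'d set). norm x * (\<Sum>j\<in>(Basis::'d set). sqrt (H Q e)))"
      proof (rule order_trans[OF norm_sum], rule sum_mono)
        fix i :: 'd assume i: "i \<in> Basis"
        show "norm ((x \<bullet> i) *\<^sub>R blinfun_apply Q i) \<le> norm x * (\<Sum>j\<in>(Basis::'d set). sqrt (H Q e))"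
          unfolding norm_scaleR by (rule mult_mono[OF Basis_le_norm[OF i] n[OF i]]) auto
      qed
      then show ?thesis
        using linear_euclidean_expand[of "blinfun_apply Q" x] blinfun.bounded_linear_right[of Q]
        by (simp add: sum_distrib_left bounded_linear.linear mult.left_commute)
    qed
    then show ?thesis
      by (intro norm_blinfun_bound) (auto intro!: sum_nonneg mult_nonneg_nonneg H_nonneg simp: mult.commute)
  qed
  have "bounded (range Qs)"
  proof (rule boundedI)
    fix Q assume "Q \<in> range Qs"
    then obtain n where n: "Q = Qs n" by auto
    have "H Q e \<le> c0 + 1" using Qs(2)[of n e] by (auto simp: n intro: order_trans)
    then have "(\<Sum>i\<in>(Basis::'d set). \<Sum>j\<in>(Basis::'d set). sqrt (H Q e)) \<le>
        (\<Sum>i\<in>(Basis::'d set). \<Sum>j\<in>(Basis::'d set). sqrt (c0 + 1))"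
      by (intro sum_mono real_sqrt_le_mono)
    then show "norm Q \<le> (\<Sum>i\<in>(Basis::'d set). \<Sum>j\<in>(Basis::'d set). sqrt (c0 + 1))"
      using normH[of Q] by linarith
  qed
  then obtain Q r where r: "strict_mono (r :: nat \<Rightarrow> nat)" and lim: "(Qs \<circ> r) \<longlonglongrightarrow> Q"
    using bounded_imp_convergent_subsequence by blast
  have lim_q: "(\<lambda>n. F ((Qs \<circ> r) n)) \<longlonglongrightarrow> F Q" if "continuous_on UNIV F" for F :: "('d \<Rightarrow>\<^sub>L 'd) \<Rightarrow> real"
  proof -
    have "isCont F Q" using that by (simp add: continuous_on_eq_continuous_at)
    then show ?thesis using lim by (rule isCont_tendsto_compose)
  qed
  have QS: "Q \<in> S"
  proof -
    have "blinfun_apply Q x \<bullet> y = blinfun_apply Q y \<bullet> x" for x y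
    proof (rule LIMSEQ_unique)
      show "(\<lambda>n. blinfun_apply ((Qs \<circ> r) n) x \<bullet> y) \<longlonglongrightarrow> blinfun_apply Q x \<bullet> y"
        by (rule lim_q) (intro continuous_intros)
      have "(\<lambda>n. blinfun_apply ((Qs \<circ> r) n) y \<bullet> x) \<longlonglongrightarrow> blinfun_apply Q y \<bullet> x"
        by (rule lim_q) (intro continuous_intros)
      then show "(\<lambda>n. blinfun_apply ((Qs \<circ> r) n) x \<bullet> y) \<longlonglongrightarrow> blinfun_apply Q y \<bullet> x"
        using Qs(1) by (simp add: S_def)
    qed
    moreover have "(norm x)\<^sup>2 \<le> M\<^sup>2 * q Q a x x" for a x
    proof (rule LIMSEQ_le_const[OF lim_q])
      show "continuous_on UNIV (\<lambda>Q. M\<^sup>2 * q Q a x x)" by (intro continuous_intros contQ)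
      show "\<exists>N. \<forall>n\<ge>N. (norm x)\<^sup>2 \<le> M\<^sup>2 * q ((Qs \<circ> r) n) a x x" using Qs(1) by (simp add: S_def)
    qed
    ultimately show ?thesis by (simp add: S_def)
  qed
  have QH: "H Q a \<le> c0" for a
  proof (rule LIMSEQ_le[OF lim_q[OF contH]])
    have "(\<lambda>n. 1 / real (Suc n)) \<longlonglongrightarrow> 0" using LIMSEQ_inverse_real_of_nat by (simp add: inverse_eq_divide)
    from LIMSEQ_subseq_LIMSEQ[OF this r] have "(\<lambda>n. c0 + 1 / real (Suc (r n))) \<longlonglongrightarrow> c0 + 0"
      by (intro tendsto_intros) (simp add: o_def)
    then show "(\<lambda>n. c0 + 1 / real (Suc (r n))) \<longlonglongrightarrow> c0" by simp
    show "\<exists>N. \<forall>n\<ge>N. H ((Qs \<circ> r) n) a \<le> c0 + 1 / real (Suc (r n))" using Qs(2) by auto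
  qed
  have unique: "Q' = Q" if Q': "Q' \<in> S" "\<And>a. H Q' a \<le> c0" for Q'
  proof (rule ccontr)
    assume ne: "Q' \<noteq> Q"
    \<comment> \<open>If two minimisers differed, \<open>H E\<close> would be bounded below on the
      compact group by a positive number, and by \<open>square_midpoint\<close> their mean would
      push the supremum below \<open>c0\<close>.\<close>
    define E where "E = Q' - Q"
    have "\<exists>a\<in>UNIV. \<forall>b\<in>UNIV. H E a \<le> H E b"
      by (rule continuous_attains_inf[OF comp _ contHa]) simp
    then obtain a where a: "\<And>b. H E a \<le> H E b" by blast
    have Epos: "H E a > 0"
    proof (rule ccontr)
      assume "\<not> H E a > 0"
      then have "H E a = 0" using H_nonneg[of E a] by simp
      then have z: "q E a i j = 0" if "i \<in> Basis" "j \<in> Basis" for i j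
        using that unfolding H_def by (simp add: sum_nonneg_eq_0_iff sum_nonneg)
      have z1: "blinfun_apply E (R a i) = 0" if i: "i \<in> Basis" for i
      proof -
        have linR: "linear (\<lambda>y. blinfun_apply E (R a i) \<bullet> R a y)"
          using linear_compose[OF lin bounded_linear.linear[OF bounded_linear_inner_right]] by (simp add: o_def)
        have "blinfun_apply E (R a i) \<bullet> R a y = 0" for y
          using linear_euclidean_expand[OF linR, of y] z[OF i] by (simp add: q_def)
        from this[of "R (inver a) (blinfun_apply E (R a i))"] show ?thesis by (simp add: inver)
      qed
      have linE: "linear (\<lambda>x. blinfun_apply E (R a x))"
        using linear_compose[OF lin bounded_linear.linear[OF blinfun.bounded_linear_right]] by (simp add: o_def)
      have "blinfun_apply E (R a x) = 0" for x
        using linear_euclidean_expand[OF linE, of x] z1 by simp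
      from this[of "R (inver a) _"] have "E = 0" by (intro blinfun_eqI) (simp add: inver)
      then show False using ne by (simp add: E_def)
    qed
    define m where "m = (1 / 2) *\<^sub>R (Q' + Q)"
    have qm: "q m b x y = (q Q' b x y + q Q b x y) / 2" "q E b x y = q Q' b x y - q Q b x y" for b x y
      by (simp_all add: q_def m_def E_def blinfun.scaleR_left blinfun.add_left blinfun.diff_left
          inner_add_left inner_diff_left)
    have "m \<in> S"
      unfolding S_def
    proof (intro CollectI conjI allI)
      show "blinfun_apply m x \<bullet> y = blinfun_apply m y \<bullet> x" for x y
        using Q' QS by (simp add: S_def m_def blinfun.scaleR_left blinfun.add_left inner_add_left)
      show "(norm x)\<^sup>2 \<le> M\<^sup>2 * q m b x x" for b x
      proof -
        have "(norm x)\<^sup>2 \<le> M\<^sup>2 * q Q' b x x" "(norm x)\<^sup>2 \<le> M\<^sup>2 * q Q b x x"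
          using Q' QS by (auto simp: S_def)
        then show ?thesis by (simp add: qm algebra_simps)
      qed
    qed
    moreover have "H m b \<le> c0 - H E a / 4" for b
    proof -
      have "H m b = (\<Sum>i\<in>Basis. \<Sum>j\<in>Basis. (q Q' b i j)\<^sup>2 / 2 + (q Q b i j)\<^sup>2 / 2 - (q E b i j)\<^sup>2 / 4)"
        unfolding H_def qm square_midpoint ..
      also have "\<dots> = H Q' b / 2 + H Q b / 2 - H E b / 4"
        by (simp add: H_def sum.distrib sum_subtractf sum_divide_distrib)
      finally show ?thesis using Q'(2)[of b] QH[of b] a[of b] by linarith
    qed
    ultimately have "P (c0 - H E a / 4)" unfolding P_def by blast
    from c0_le[OF this] Epos show False by simp
  qed
  have inv: "blinfun_apply Q (R b x) \<bullet> R b y = blinfun_apply Q x \<bullet> y" for b x y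
  proof -
    have adj: "adjoint (R b) u \<bullet> v = u \<bullet> R b v" for u v
      using adjoint_works[OF lin[of b], of v u] by (simp add: inner_commute)
    \<comment> \<open>Pulling \<open>Q\<close> back by \<open>R b\<close> only reindexes the values
      of \<open>H Q\<close> over the group, so the result is again a minimiser and equals
      \<open>Q\<close>.\<close>
    define Qb where "Qb = Blinfun (\<lambda>x. adjoint (R b) (blinfun_apply Q (R b x)))"
    have "linear (\<lambda>x. adjoint (R b) (blinfun_apply Q (R b x)))"
      using linear_compose[OF linear_compose[OF lin bounded_linear.linear[OF blinfun.bounded_linear_right]]
          adjoint_linear[OF lin]] by (simp add: o_def)
    then have Qb: "blinfun_apply Qb x = adjoint (R b) (blinfun_apply Q (R b x))" for x
      unfolding Qb_def by (simp add: bounded_linear_Blinfun_apply linear_conv_bounded_linear)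
    have qb: "q Qb a x y = q Q (mul b a) x y" for a x y by (simp add: q_def Qb adj mul)
    have "blinfun_apply Qb x \<bullet> y = blinfun_apply Qb y \<bullet> x" for x y
      unfolding Qb adj using QS by (simp add: S_def)
    then have "Qb \<in> S" using QS by (simp add: S_def qb)
    moreover have "H Qb a \<le> c0" for a using QH[of "mul b a"] by (simp add: H_def qb)
    ultimately have "Qb = Q" by (rule unique)
    then show ?thesis using Qb[of x] adj by metis
  qed
  show ?thesis
  proof
    show "linear (blinfun_apply Q)" by (rule bounded_linear.linear[OF blinfun.bounded_linear_right])
    show "blinfun_apply Q x \<bullet> y = blinfun_apply Q y \<bullet> x" for x y using QS by (simp add: S_def)
    show "blinfun_apply Q x \<bullet> x > 0" if "x \<noteq> 0" for x
    proof -
      have "(norm x)\<^sup>2 \<le> M\<^sup>2 * q Q e x x" using QS by (simp add: S_def)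
      moreover have "(norm x)\<^sup>2 > 0" using that by simp
      ultimately have "0 < M\<^sup>2 * q Q e x x" by linarith
      then show ?thesis using M by (simp add: q_def e zero_less_mult_iff)
    qed
  qed (rule inv)
qed

text \<open>A linear change of coordinates with \<open>L x \<bullet> L y = Q x \<bullet> y\<close>
  turns the invariant inner product into the standard one, so that norms, adjoints and orthogonal
  complements of the type class can be used.\<close>

lemma orthogonalization:
  fixes R :: "'g::topological_space \<Rightarrow> 'd::euclidean_space \<Rightarrow> 'd"
    and mul :: "'g \<Rightarrow> 'g \<Rightarrow> 'g" and inver :: "'g \<Rightarrow> 'g"
  assumes "compact (UNIV :: 'g set)" "\<And>a. linear (R a)" "\<And>x. continuous_on UNIV (\<lambda>a. R a x)"
    "\<And>a b x. R (mul a b) x = R a (R b x)"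
    "\<And>a x. R a (R (inver a) x) = x" "\<And>a x. R (inver a) (R a x) = x" "\<And>x. R e x = x"
  obtains L L' :: "'d \<Rightarrow> 'd" where "linear L" "linear L'" "\<And>x. L (L' x) = x" "\<And>x. L' (L x) = x"
    "\<And>a x y. L (R a x) \<bullet> L (R a y) = L x \<bullet> L y"
proof -
  obtain Q :: "'d \<Rightarrow> 'd" where Q: "linear Q" "\<And>x y. Q x \<bullet> y = Q y \<bullet> x" "\<And>x. x \<noteq> 0 \<Longrightarrow> Q x \<bullet> x > 0"
    "\<And>a x y. Q (R a x) \<bullet> R a y = Q x \<bullet> y"
    using invariant_form[of R mul inver e, OF assms] by metis
  obtain u :: "'d \<Rightarrow> 'd" where u: "\<And>i j. i \<in> Basis \<Longrightarrow> j \<in> Basis \<Longrightarrow> Q (u i) \<bullet> u j = (if i = j then 1 else 0)"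
    using orthonormal_frame[OF Q(1-3)] by metis
  define L' where "L' x = (\<Sum>i\<in>Basis. (x \<bullet> i) *\<^sub>R u i)" for x
  define L where "L x = (\<Sum>i\<in>Basis. (Q (u i) \<bullet> x) *\<^sub>R (i :: 'd))" for x
  have L: "linear L" unfolding L_def[abs_def]
    by (rule linearI) (simp_all add: inner_add_right scaleR_add_left sum.distrib scaleR_sum_right)
  have L': "linear L'" unfolding L'_def[abs_def]
    by (rule linearI) (simp_all add: inner_add_left scaleR_add_left sum.distrib scaleR_sum_right)
  have LL': "L (L' x) = x" for x
  proof (rule euclidean_eqI)
    fix i :: 'd assume i: "i \<in> Basis"
    have "L (L' x) \<bullet> i = Q (u i) \<bullet> L' x" using i by (simp add: L_def)
    also have "\<dots> = (\<Sum>j\<in>Basis. (x \<bullet> j) * (if i = j then 1 else 0))"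
      unfolding L'_def inner_sum_right inner_scaleR_right using u[OF i] by simp
    also have "\<dots> = x \<bullet> i" using i by (simp add: if_distrib cong: if_cong)
    finally show "L (L' x) \<bullet> i = x \<bullet> i" .
  qed
  have L'L: "L' (L x) = x" for x
    using linear_inverse_left[OF L L'] LL' by (metis comp_apply id_apply ext)
  have "L x \<bullet> L y = Q x \<bullet> y" for x y
  proof -
    have "Q x \<bullet> y = Q y \<bullet> L' (L x)" using Q(2)[of x y] by (simp add: L'L)
    also have "\<dots> = (\<Sum>i\<in>Basis. (L x \<bullet> i) * (Q (u i) \<bullet> y))"
      unfolding L'_def inner_sum_right inner_scaleR_right using Q(2) by simp
    also have "\<dots> = (\<Sum>i\<in>Basis. (L x \<bullet> i) * (L y \<bullet> i))"
      by (rule sum.cong) (simp_all add: L_def)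
    also have "\<dots> = L x \<bullet> L y" by (rule euclidean_inner[symmetric])
    finally show ?thesis by simp
  qed
  then show ?thesis using that[OF L L' LL' L'L] Q(4) by simp
qed

section \<open>Lie algebras with an invariant inner product\<close>

lemma orthogonal_projection:
  fixes S :: "'a::euclidean_space set"
  assumes "subspace S"
  obtains p where "linear p" "\<And>x. p x \<in> S" "\<And>x s. s \<in> S \<Longrightarrow> (x - p x) \<bullet> s = 0"
proof -
  have "\<exists>y. y \<in> S \<and> (\<forall>s\<in>S. (x - y) \<bullet> s = 0)" for x
  proof -
    obtain y z where "y \<in> span S" "\<And>w. w \<in> span S \<Longrightarrow> orthogonal z w" "x = y + z"
      using orthogonal_subspace_decomp_exists[of S x] by metis
    then show ?thesis
      using assms by (intro exI[of _ y]) (auto simp: span_eq_iff[THEN iffD2, OF assms] orthogonal_def)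
  qed
  then obtain p where p: "\<And>x. p x \<in> S" "\<And>x s. s \<in> S \<Longrightarrow> (x - p x) \<bullet> s = 0" by metis
  have unique: "p x = y" if "y \<in> S" "\<And>s. s \<in> S \<Longrightarrow> (x - y) \<bullet> s = 0" for x y
  proof -
    have m: "p x - y \<in> S" using p(1) that(1) assms by (simp add: subspace_diff)
    have "(p x - y) \<bullet> (p x - y) = (x - y) \<bullet> (p x - y) - (x - p x) \<bullet> (p x - y)"
      by (simp add: inner_diff_left)
    then show ?thesis using p(2)[OF m] that(2)[OF m] by simp
  qed
  have "linear p"
  proof (rule linearI)
    show "p (x + y) = p x + p y" for x y
    proof (rule unique)
      show "p x + p y \<in> S" using p(1) assms by (simp add: subspace_add)
      show "(x + y - (p x + p y)) \<bullet> s = 0" if "s \<in> S" for s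
        using p(2)[OF that, of x] p(2)[OF that, of y] by (simp add: inner_diff_left inner_add_left)
    qed
    show "p (c *\<^sub>R x) = c *\<^sub>R p x" for c x
    proof (rule unique)
      show "c *\<^sub>R p x \<in> S" using p(1) assms by (simp add: subspace_scale)
      show "(c *\<^sub>R x - c *\<^sub>R p x) \<bullet> s = 0" if "s \<in> S" for s
        using p(2)[OF that, of x] by (simp add: inner_diff_left scaleR_diff_right[symmetric])
    qed
  qed
  then show ?thesis using p by (rule that)
qed

locale metric_lie_algebra =
  fixes br :: "'d::euclidean_space \<Rightarrow> 'd \<Rightarrow> 'd"
  assumes br_right: "linear (br x)"
    and br_anti: "br x y = - br y x"
    and jacobi: "br x (br y z) = br (br x y) z + br y (br x z)"
    and invariant: "br x y \<bullet> z = - (y \<bullet> br x z)"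
begin

lemma br_left: "linear (\<lambda>x. br x y)"
proof -
  have "(\<lambda>x. br x y) = (\<lambda>x. - br y x)" by (rule ext) (rule br_anti)
  then show ?thesis using linear_compose_neg[OF br_right] by simp
qed

lemmas br_simps = linear_add[OF br_right] linear_add[OF br_left] linear_diff[OF br_right]
  linear_diff[OF br_left] linear_scale[OF br_right] linear_scale[OF br_left]
  linear_0[OF br_right] linear_0[OF br_left] linear_neg[OF br_right] linear_neg[OF br_left]

lemma invariant': "x \<bullet> br y z = - (br y x \<bullet> z)"
  using invariant[of y x z] by simp

definition "ker z = {x. br z x = 0}"

lemma subspace_ker: "subspace (ker z)"
  by (auto simp: subspace_def ker_def br_simps)

lemma derivation_commute: "u \<in> ker z \<Longrightarrow> br z (br u x) = br u (br z x)"
  using jacobi[of z u x] by (simp add: ker_def br_simps)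

lemma ker_bracket: "x \<in> ker z \<Longrightarrow> y \<in> ker z \<Longrightarrow> br x y \<in> ker z"
  using derivation_commute[of x z y] by (simp add: ker_def br_simps)

text \<open>Since \<open>br z\<close> is skew, the orthogonal complement of its range is its
  kernel.\<close>

lemma ker_range_decomp:
  obtains y p where "y \<in> ker z" "x = y + br z p"
proof -
  have sub: "subspace (range (br z))" by (intro linear_subspace_image br_right subspace_UNIV)
  obtain y w where yw: "y \<in> span (range (br z))" "\<And>v. v \<in> span (range (br z)) \<Longrightarrow> orthogonal w v" "x = y + w"
    using orthogonal_subspace_decomp_exists[of "range (br z)" x] by metis
  then obtain p where p: "y = br z p" using span_eq_iff[THEN iffD2, OF sub] by auto
  have "br z w \<bullet> br z w = 0"
    using yw(2)[of "br z (br z w)"] by (simp add: orthogonal_def span_base invariant[of z w])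
  then have "w \<in> ker z" by (simp add: ker_def)
  then show ?thesis by (rule that) (use yw p in simp)
qed

lemma ker_orthogonal: "u \<in> ker z \<Longrightarrow> u \<bullet> br z p = 0"
  by (simp add: invariant' ker_def)

lemma br_sq_zero: assumes "br z (br z p) = 0" shows "br z p = 0"
proof -
  have "br z p \<bullet> br z p = - (p \<bullet> br z (br z p))" by (rule invariant)
  then show ?thesis using assms by simp
qed

text \<open>For small \<open>e\<close> the kernel of \<open>z + e *\<^sub>R u\<close> in
  \<open>h\<close> lies in that of \<open>z\<close>: \<open>br z\<close> is bounded below on its
  range and \<open>br u\<close> scaled by \<open>e\<close> cannot compensate it. Minimality of the
  dimension makes the two kernels in \<open>h\<close> equal, and what \<open>z\<close> and
  \<open>z + e *\<^sub>R u\<close> both kill is killed by \<open>u\<close>.\<close>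

lemma regular_centralizer_abelian:
  assumes h: "subspace h" and ideal: "\<And>x y. y \<in> h \<Longrightarrow> br x y \<in> h" and z: "z \<in> h"
    and reg: "\<And>v. v \<in> h \<Longrightarrow> dim (ker z \<inter> h) \<le> dim (ker v \<inter> h)"
    and u: "u \<in> ker z \<inter> h" and y: "y \<in> ker z \<inter> h"
  shows "br u y = 0"
proof -
  have sub: "subspace (range (br z))" by (intro linear_subspace_image br_right subspace_UNIV)
  obtain k where k: "k > 0" "\<And>x. x \<in> range (br z) \<Longrightarrow> norm (br z x) \<ge> k * norm x"
    using injective_imp_isometric[OF closed_subspace[OF sub] sub, of "br z"] br_sq_zero
    by (auto simp: linear_conv_bounded_linear[symmetric] br_right)
  obtain K where K: "K > 0" "\<And>x. norm (br u x) \<le> norm x * K"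
    using bounded_linear.pos_bounded[of "br u"] br_right by (auto simp: linear_conv_bounded_linear)
  \<comment> \<open>\<open>k\<close> bounds \<open>br z\<close> from below on its range and
    \<open>K\<close> bounds \<open>br u\<close> from above; the factor \<open>2\<close> secures
    \<open>e * K < k\<close>.\<close>
  define e where "e = k / (2 * K)"
  have e: "e > 0" "e * K < k" using k K by (auto simp: e_def)
  have "ker (z + e *\<^sub>R u) \<inter> h \<subseteq> ker z \<inter> h"
  proof
    fix x assume x: "x \<in> ker (z + e *\<^sub>R u) \<inter> h"
    obtain y p where yp: "y \<in> ker z" "x = y + br z p" by (rule ker_range_decomp)
    define w where "w = br z (br z p) + e *\<^sub>R br u (br z p)"
    \<comment> \<open>This form puts \<open>w\<close> into the range of \<open>br z\<close>. The
      equation for \<open>x\<close> puts it into the kernel as well, so it is orthogonal to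
      itself.\<close>
    have w: "w = br z (br z p + e *\<^sub>R br u p)"
      using u derivation_commute[of u z p] by (simp add: w_def br_simps)
    have "e *\<^sub>R br u y + w = 0"
      using x yp by (simp add: ker_def br_simps w_def scaleR_add_right add_ac)
    then have "w = - (e *\<^sub>R br u y)" by (simp add: eq_neg_iff_add_eq_0 add.commute)
    moreover have "br u y \<in> ker z" using ker_bracket u yp by blast
    ultimately have "w \<in> ker z" by (simp add: ker_def br_simps)
    then have "w \<bullet> w = 0" using ker_orthogonal w by metis
    then have "br z (br z p) = - (e *\<^sub>R br u (br z p))" by (simp add: w_def eq_neg_iff_add_eq_0)
    then have "norm (br z (br z p)) = e * norm (br u (br z p))" using e by simp
    also have "\<dots> \<le> e * (norm (br z p) * K)" using K(2) e by (intro mult_left_mono) auto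
    also have "\<dots> = e * K * norm (br z p)" by simp
    finally have "k * norm (br z p) \<le> e * K * norm (br z p)" using k(2)[of "br z p"] by (rule order_trans[rotated]) simp
    then have "br z p = 0" using e(2) by (simp add: mult_le_cancel_right)
    then show "x \<in> ker z \<inter> h" using yp x by simp
  qed
  moreover have "z + e *\<^sub>R u \<in> h" using h z u by (auto intro: subspace_add subspace_scale)
  ultimately have "ker (z + e *\<^sub>R u) \<inter> h = ker z \<inter> h"
    using reg h subspace_ker by (intro subspace_dim_equal subspace_inter) auto
  then have "br (z + e *\<^sub>R u) y = 0" using y by (auto simp: ker_def)
  then show ?thesis using y e by (simp add: ker_def br_simps)
qed

section \<open>The infinitesimal argument for a single form \<open>B\<close>\<close>

context
  fixes h z0 z1 and B :: "'d \<Rightarrow> 'd \<Rightarrow> real"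
  assumes h: "subspace h" and ideal: "\<And>x y. y \<in> h \<Longrightarrow> br x y \<in> h"
    and centerless: "\<And>x. x \<in> h \<Longrightarrow> (\<And>y. y \<in> h \<Longrightarrow> br x y = 0) \<Longrightarrow> x = 0"
    and z1: "z1 \<in> h" and z0: "\<And>x. br z0 x = 0"
    and abelian: "\<And>x y. x \<in> ker z1 \<inter> h \<Longrightarrow> y \<in> ker z1 \<inter> h \<Longrightarrow> br x y = 0"
    and B_lin: "\<And>x. linear (B x)" and B_sym: "\<And>x y. B x y = B y x"
    and B1: "\<And>x. B (br x (z0 + z1)) (z0 + z1) = 0"
    and B2: "\<And>x y. B (br y (br x (z0 + z1))) (z0 + z1) + B (br x (z0 + z1)) (br y (z0 + z1)) = 0"
    and B3: "\<And>x y v. B (br v (br y (br x (z0 + z1)))) (z0 + z1) + B (br y (br x (z0 + z1))) (br v (z0 + z1))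
      + B (br v (br x (z0 + z1))) (br y (z0 + z1)) + B (br x (z0 + z1)) (br v (br y (z0 + z1))) = 0"
begin

text \<open>\<open>z0\<close> is central, so bracketing with the whole field \<open>z\<close> is
  bracketing with \<open>z1\<close>. The assumptions \<open>B1\<close> to \<open>B3\<close> express
  the first three derivatives of the constant length of \<open>z\<close> along the group and are
  rewritten below in terms of \<open>D\<close>.\<close>

private definition "D x = br z1 x"
private definition "z = z0 + z1"

private lemma brz: "br x z = - D x" "br z x = D x"
  using br_anti[of x z] by (simp_all add: z_def D_def br_simps z0)

private lemma D_lin: "linear D" using br_right[of z1] by (simp add: D_def[abs_def])

private lemma B_left: "linear (\<lambda>x. B x y)"
proof -
  have "(\<lambda>x. B x y) = B y" by (rule ext) (rule B_sym)
  then show ?thesis using B_lin by simp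
qed

private lemmas lin = linear_add[OF D_lin] linear_diff[OF D_lin] linear_scale[OF D_lin] linear_0[OF D_lin]
  linear_neg[OF D_lin] linear_add[OF B_lin] linear_diff[OF B_lin] linear_scale[OF B_lin] linear_0[OF B_lin]
  linear_neg[OF B_lin] linear_add[OF B_left] linear_diff[OF B_left] linear_scale[OF B_left]
  linear_0[OF B_left] linear_neg[OF B_left] br_simps

private lemma B_z: "B (D x) z = 0"
  using B1[of x, folded z_def] by (simp add: brz lin)

private lemma B_zz: "B (br y (D x)) z = B (D x) (D y)"
  using B2[of y x, folded z_def] by (simp add: brz lin)

private lemma B_zzz:
  "B (br v (br y (D x))) z = B (br y (D x)) (D v) + B (br v (D x)) (D y) + B (D x) (br v (D y))"
  using B3[of v y x, folded z_def] by (simp add: brz lin)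

private lemma D_der: "D (br x y) = br (D x) y + br x (D y)"
  unfolding D_def by (rule jacobi)

private lemma D_skew: "D x \<bullet> y = - (x \<bullet> D y)"
  unfolding D_def by (rule invariant)

text \<open>By \<open>B_zz\<close> the number \<open>B (D x) (D (D y))\<close> is the pairing of the
  bracket of \<open>D y\<close> and \<open>D x\<close> with \<open>z\<close>, which changes sign
  when the two are exchanged.\<close>

private lemma B_D_skew: "B (D (D x)) (D y) + B (D x) (D (D y)) = 0"
proof -
  have "B (br (D y) (D x)) z = B (D x) (D (D y))" by (rule B_zz)
  moreover have "B (br (D x) (D y)) z = B (D y) (D (D x))" by (rule B_zz)
  moreover have "B (br (D x) (D y)) z = - B (br (D y) (D x)) z"
    by (subst br_anti) (simp add: lin)
  ultimately show ?thesis using B_sym by simp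
qed

private abbreviation "T \<equiv> ker z1"

private lemma D_T: "u \<in> T \<Longrightarrow> D u = 0" by (simp add: ker_def D_def)

private definition "tp = (SOME p. linear p \<and> (\<forall>x. p x \<in> T) \<and> (\<forall>x. \<forall>s\<in>T. (x - p x) \<bullet> s = 0))"

private lemma tp: "linear tp" "tp x \<in> T" "s \<in> T \<Longrightarrow> (x - tp x) \<bullet> s = 0"
proof -
  have "\<exists>p. linear p \<and> (\<forall>x. p x \<in> T) \<and> (\<forall>x. \<forall>s\<in>T. (x - p x) \<bullet> s = 0)"
    using orthogonal_projection[OF subspace_ker[of z1]] by metis
  from someI_ex[OF this] show "linear tp" "tp x \<in> T" "s \<in> T \<Longrightarrow> (x - tp x) \<bullet> s = 0"
    unfolding tp_def[symmetric] by blast+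
qed

private lemma tp_unique: assumes "x = y + D p" "y \<in> T" shows "tp x = y"
proof -
  have d: "tp x - y \<in> T" using tp(2) assms(2) subspace_ker by (simp add: subspace_diff)
  have "(tp x - y) \<bullet> (tp x - y) = D p \<bullet> (tp x - y) - (x - tp x) \<bullet> (tp x - y)"
    using assms(1) by (simp add: inner_diff_left inner_add_left)
  also have "\<dots> = 0"
    using tp(3)[OF d] ker_orthogonal[OF d, of p] by (simp add: D_def inner_commute)
  finally show ?thesis by simp
qed

private lemma tp_decomp: obtains p where "x = tp x + D p"
proof -
  obtain y p where "y \<in> T" "x = y + D p" unfolding D_def by (rule ker_range_decomp)
  then show ?thesis using tp_unique that by metis
qed

private lemma tp_D [simp]: "tp (D p) = 0"
  by (rule tp_unique[of _ _ p]) (auto simp: ker_def br_simps)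

private lemma T_br: "u \<in> T \<Longrightarrow> br u (D x) = D (br u x)"
  unfolding D_def by (rule derivation_commute[symmetric])

private definition "t = T \<inter> h"

private lemma D_h: "D x \<in> h"
  unfolding D_def using ideal[OF z1, of x] br_anti[of z1 x] h by (simp add: subspace_neg)

private lemma subspace_t: "subspace t"
  unfolding t_def by (intro subspace_inter subspace_ker h)

private lemma z1_t: "z1 \<in> t"
proof -
  have "br z1 z1 + br z1 z1 = 0" using br_anti[of z1 z1] by (simp only: eq_neg_iff_add_eq_0[symmetric])
  then have "br z1 z1 = 0" by (simp add: scaleR_2[symmetric])
  then show ?thesis using z1 by (simp add: t_def ker_def)
qed

text \<open>\<open>T\<close> may be larger than \<open>t\<close>. The part of \<open>x\<close>
  orthogonal to the ideal commutes with the ideal, and the rest lies in the abelian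
  \<open>t\<close>.\<close>

private lemma t_T_commute: assumes "u \<in> t" "x \<in> T" shows "br u x = 0"
proof -
  obtain ph where ph: "linear ph" "\<And>x. ph x \<in> h" "\<And>x s. s \<in> h \<Longrightarrow> (x - ph x) \<bullet> s = 0"
    using orthogonal_projection[OF h] by metis
  \<comment> \<open>This bracket lies in the ideal and, by invariance of the inner product, is also
    orthogonal to it.\<close>
  have perp: "br v (x - ph x) = 0" if v: "v \<in> h" for v
  proof -
    have "br v (x - ph x) \<in> h"
      using ideal[OF v, of "x - ph x"] br_anti[of v "x - ph x"] h by (simp add: subspace_neg)
    moreover have "br v (x - ph x) \<bullet> s = 0" if "s \<in> h" for s
      using ph(3)[OF ideal[OF that, of v], of x] by (simp add: invariant[of v])
    ultimately have "br v (x - ph x) \<bullet> br v (x - ph x) = 0" by blast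
    then show ?thesis by simp
  qed
  have "D (ph x) = D x - D (x - ph x)" by (simp add: lin)
  then have "ph x \<in> t" using ph(2) perp[OF z1] D_T[OF assms(2)] by (simp add: t_def ker_def D_def)
  then have "br u (ph x) = 0" using abelian assms(1) by (simp add: t_def)
  moreover have "br u (x - ph x) = 0" using perp assms(1) by (simp add: t_def)
  ultimately show ?thesis by (simp add: br_simps)
qed

private definition "c v x = tp (br v x)"

private lemma c_lin: "linear (c v)" "linear (\<lambda>v. c v x)"
  unfolding c_def[abs_def]
  using linear_compose[OF br_right tp(1)] linear_compose[OF br_left tp(1)] by (simp_all add: o_def)

private lemma c_D: "c (D v) x + c v (D x) = 0"
proof -
  have "tp (D (br v x)) = c (D v) x + c v (D x)"
    by (simp add: D_der c_def linear_add[OF tp(1)])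
  then show ?thesis by simp
qed

private lemma c_inner: "u \<in> T \<Longrightarrow> c v x \<bullet> u = br v x \<bullet> u"
  using tp(3)[of u "br v x"] by (simp add: c_def inner_diff_left)

private lemma c_T: "v \<in> T \<Longrightarrow> c v (D x) = 0"
  by (simp add: c_def T_br)

private lemma c_t: "c v (D y) \<in> t"
proof -
  obtain p where p: "br v (D y) = c v (D y) + D p" unfolding c_def by (rule tp_decomp)
  have "br v (D y) \<in> h" by (rule ideal[OF D_h])
  then have "c v (D y) \<in> h" using p D_h h by (metis add_diff_cancel_right' subspace_diff)
  then show ?thesis using tp(2) by (simp add: t_def c_def)
qed

text \<open>For \<open>u\<close> in \<open>T\<close> a product of two commuting skew maps, hence
  symmetric. For \<open>u\<close> in \<open>t\<close> it acts on a root space as the scalar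
  \<open>- \<beta>(u) * \<beta>(z1)\<close>, where \<open>\<beta>\<close> is the root, so it carries
  the root data without complex eigenvectors.\<close>

private definition "S u x = br u (D x)"

private lemma S_lin: "linear (S u)" "linear (\<lambda>u. S u x)"
  unfolding S_def[abs_def] using linear_compose[OF D_lin br_right] br_left by (simp_all add: o_def)

private lemma S_sym: assumes "u \<in> T" shows "S u x \<bullet> y = x \<bullet> S u y"
proof -
  have "br u (D x) \<bullet> y = - (D x \<bullet> br u y)" by (rule invariant)
  also have "\<dots> = x \<bullet> D (br u y)" by (simp add: D_skew[of x])
  finally show ?thesis by (simp add: S_def T_br[OF assms])
qed

private lemma S_commute: assumes "u \<in> t" "v \<in> t" shows "S u (S v x) = S v (S u x)"
proof -
  have uv: "u \<in> T" "v \<in> T" using assms by (auto simp: t_def)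
  have "br u (br v y) = br v (br u y)" for y
    using jacobi[of u v y] t_T_commute[OF assms(1) uv(2)] by (simp add: br_simps)
  then show ?thesis by (simp add: S_def T_br[OF uv(1)] T_br[OF uv(2)])
qed

private lemma c_S: "u \<in> T \<Longrightarrow> c v (D y) \<bullet> u = - (S u y \<bullet> v)"
proof -
  assume u: "u \<in> T"
  have "br v (D y) \<bullet> u = - (D y \<bullet> br v u)" by (rule invariant)
  also have "\<dots> = D y \<bullet> br u v" by (subst br_anti) simp
  also have "\<dots> = - (br u (D y) \<bullet> v)" by (rule invariant')
  finally show ?thesis using c_inner[OF u] by (simp add: S_def)
qed

text \<open>If \<open>S u\<close> vanishes, \<open>u\<close> commutes with the range of
  \<open>D\<close>; it commutes with \<open>T\<close> anyway, and the ideal has no center.\<close>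

private lemma S_inj: assumes "u \<in> t" "\<And>x. S u x = 0" shows "u = 0"
proof (rule centerless)
  show "u \<in> h" using assms by (simp add: t_def)
  fix y assume "y \<in> h"
  obtain p where "y = tp y + D p" by (rule tp_decomp)
  then have "br u y = br u (tp y) + S u p" by (metis S_def linear_add[OF br_right])
  then show "br u y = 0" using t_T_commute[OF assms(1) tp(2)] assms(2) by simp
qed

text \<open>The first-order identity differentiated once more, with the \<open>T\<close>-components of the brackets
  split off from the rest \<open>\<mu>\<close>.\<close>

private definition "\<mu> v x = br v x - c v x"

private lemma \<mu>_D: "\<exists>p. \<mu> v x = D p"
proof -
  obtain p where "br v x = tp (br v x) + D p" by (rule tp_decomp)
  then have "br v x - tp (br v x) = D p" by (metis add_diff_cancel_left')
  then show ?thesis by (auto simp: \<mu>_def c_def)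
qed

text \<open>The \<open>T\<close>-components drop out: on the left they cancel by \<open>c_D\<close>,
  on the right \<open>D\<close> kills them.\<close>

private lemma \<mu>_der: "\<mu> (D v) x + \<mu> v (D x) = D (\<mu> v x)"
proof -
  have "\<mu> (D v) x + \<mu> v (D x) = (br (D v) x + br v (D x)) - (c (D v) x + c v (D x))" by (simp add: \<mu>_def)
  moreover have "D (c v x) = 0" by (simp add: c_def D_T[OF tp(2)])
  ultimately show ?thesis by (simp add: c_D \<mu>_def linear_diff[OF D_lin] D_der)
qed

text \<open>This is \<open>B_zzz\<close> with its left side reduced by \<open>B_zz\<close>. The
  bracket of \<open>D v\<close> with the \<open>T\<close>-component \<open>?c\<close> lies in the
  range of \<open>D\<close> and pairs to zero with \<open>z\<close>; the remaining component
  \<open>D p\<close> gives \<open>B (D p) (D (D v))\<close>, which cancels against the right side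
  and leaves only \<open>?c\<close> there.\<close>

private lemma trilinear:
  "B (c (D y) (D w)) (D (D v)) + B (br (D v) (D w)) (D (D y)) + B (D w) (br (D v) (D (D y))) = 0"
proof -
  let ?c = "c (D y) (D w)"
  obtain p where p: "\<mu> (D y) (D w) = D p" using \<mu>_D by blast
  have e: "br (D y) (D w) = ?c + D p" using p by (simp add: \<mu>_def diff_eq_eq add.commute)
  have cT: "?c \<in> T" using c_t by (simp add: t_def)
  have "br (D v) ?c = D (- br ?c v)" using T_br[OF cT, of v] br_anti[of "D v" ?c] by (simp add: lin)
  then have "B (br (D v) ?c) z = 0" using B_z by simp
  then have "B (br (D v) (br (D y) (D w))) z = B (D p) (D (D v))"
    unfolding e using B_zz[of "D v" p] by (simp add: lin)
  then show ?thesis using B_zzz[of "D v" "D y" w] e by (simp add: lin)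
qed

text \<open>Let \<open>D\<close> act on the three arguments of \<open>trilinear\<close>. In the
  \<open>\<mu>\<close>-terms it passes through \<open>\<mu>\<close> and is skew for
  \<open>B\<close>, so they cancel. In the \<open>c\<close>-terms the two actions inside
  \<open>c\<close> cancel, and only \<open>D\<close> on the remaining argument survives.\<close>

private lemma trilinear_c:
  "B (c (D y) (D w)) (D (D (D v))) + B (c (D v) (D w)) (D (D (D y))) + B (D (D w)) (c (D v) (D (D y))) = 0"
proof -
  define \<tau> where "\<tau> v y w = B (c (D y) (D w)) (D (D v)) + (B (c (D v) (D w)) (D (D y)) + B (\<mu> (D v) (D w)) (D (D y)))
    + (B (D w) (c (D v) (D (D y))) + B (D w) (\<mu> (D v) (D (D y))))" for v y w
  have \<tau>: "\<tau> v y w = 0" for v y w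
    using trilinear[of y w v] by (simp add: \<tau>_def \<mu>_def lin)
  have skew: "B (D x) y' + B x (D y') = 0" if "x = D p" "y' = D q" for x y' p q
    using B_D_skew that by simp
  obtain p where p: "\<mu> (D v) (D w) = D p" using \<mu>_D by blast
  obtain q where q: "\<mu> (D v) (D (D y)) = D q" using \<mu>_D by blast
  have cneg: "c (D x) y = - c x (D y)" for x y
    using c_D[of x y] by (simp add: eq_neg_iff_add_eq_0)
  have 1: "B (c (D (D y)) (D w)) (D (D v)) + B (c (D y) (D (D w))) (D (D v)) = 0"
    by (subst cneg) (simp add: lin)
  have 2: "B (c (D (D v)) (D w)) (D (D y)) + B (c (D v) (D (D w))) (D (D y)) = 0"
    by (subst cneg) (simp add: lin)
  have 3: "B (D w) (c (D (D v)) (D (D y))) + B (D w) (c (D v) (D (D (D y)))) = 0"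
    by (subst cneg) (simp add: lin)
  have 4: "B (\<mu> (D (D v)) (D w)) (D (D y)) + B (\<mu> (D v) (D (D w))) (D (D y)) + B (\<mu> (D v) (D w)) (D (D (D y))) = 0"
    using skew[OF p, of "D (D y)" "D y"] by (simp add: \<mu>_der[symmetric] linear_add[OF B_left])
  have 5: "B (D w) (\<mu> (D (D v)) (D (D y))) + B (D w) (\<mu> (D v) (D (D (D y)))) + B (D (D w)) (\<mu> (D v) (D (D y))) = 0"
    using skew[OF _ q, of "D w" w] by (simp add: \<mu>_der[symmetric] linear_add[OF B_lin])
  have "\<tau> (D v) y w + \<tau> v (D y) w + \<tau> v y (D w) = 0" using \<tau> by simp
  then show ?thesis using 1 2 3 4 5 unfolding \<tau>_def by linarith
qed

text \<open>In \<open>trilinear_c\<close> the vectors \<open>D v\<close> and \<open>D y\<close> may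
  be replaced by arbitrary ones, because their \<open>T\<close>-components contribute nothing:
  \<open>c\<close> against the range of \<open>D\<close> and \<open>D\<close> itself both kill
  them.\<close>

private lemma symmetric_identity:
  "B (c y (D w)) (D (D v)) + B (c v (D w)) (D (D y)) + B (c v (D y)) (D (D w)) = 0"
proof -
  obtain p where p: "v = tp v + D p" by (rule tp_decomp)
  obtain q where q: "y = tp y + D q" by (rule tp_decomp)
  have cv: "c v (D x) = c (D p) (D x)" for x
    using arg_cong[OF p, of "\<lambda>v. c v (D x)"] by (simp add: linear_add[OF c_lin(2)] c_T[OF tp(2)])
  have cy: "c y (D x) = c (D q) (D x)" for x
    using arg_cong[OF q, of "\<lambda>v. c v (D x)"] by (simp add: linear_add[OF c_lin(2)] c_T[OF tp(2)])
  have Dv: "D v = D (D p)" using arg_cong[OF p, of D] by (simp add: lin D_T[OF tp(2)])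
  have Dy: "D y = D (D q)" using arg_cong[OF q, of D] by (simp add: lin D_T[OF tp(2)])
  show ?thesis
    using trilinear_c[of q w p] B_sym unfolding cv cy Dv Dy by simp
qed

section \<open>The trace argument\<close>

private definition "pt = (SOME p. linear p \<and> (\<forall>x. p x \<in> t) \<and> (\<forall>x. \<forall>s\<in>t. (x - p x) \<bullet> s = 0))"

private lemma pt: "linear pt" "pt x \<in> t" "s \<in> t \<Longrightarrow> (x - pt x) \<bullet> s = 0"
proof -
  have "\<exists>p. linear p \<and> (\<forall>x. p x \<in> t) \<and> (\<forall>x. \<forall>s\<in>t. (x - p x) \<bullet> s = 0)"
    using orthogonal_projection[OF subspace_t] by metis
  from someI_ex[OF this] show "linear pt" "pt x \<in> t" "s \<in> t \<Longrightarrow> (x - pt x) \<bullet> s = 0"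
    unfolding pt_def[symmetric] by blast+
qed

private lemma pt_id: assumes "u \<in> t" shows "pt u = u"
proof -
  have "(u - pt u) \<bullet> (u - pt u) = 0" by (rule pt(3)) (use assms pt(2) subspace_t in \<open>simp add: subspace_diff\<close>)
  then show ?thesis by simp
qed

text \<open>The vector representing \<open>B (pt u) (D (D _))\<close>. Its vanishing is the goal,
  since \<open>D\<close> and its square have the same range; composing with \<open>pt\<close> makes
  \<open>b\<close> an endomorphism of the whole space, which has an adjoint
  \<open>bs\<close>.\<close>

private definition "b u = (\<Sum>i\<in>Basis. B (pt u) (D (D i)) *\<^sub>R i)"

private lemma b_inner: "b u \<bullet> w = B (pt u) (D (D w))"
proof -
  have "linear (\<lambda>w. B (pt u) (D (D w)))"
    using linear_compose[OF linear_compose[OF D_lin D_lin] B_lin] by (simp add: o_def)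
  from linear_euclidean_expand[OF this, of w] show ?thesis
    unfolding b_def inner_sum_left inner_scaleR_left by (simp add: inner_commute mult.commute)
qed

private lemma b_lin: "linear b"
  by (rule linearI; rule vector_eq_rdot[THEN iffD1])
    (simp_all add: b_inner inner_add_left lin linear_add[OF pt(1)] linear_scale[OF pt(1)])

private definition "bs = adjoint b"

private lemma bs: "bs x \<bullet> u = b u \<bullet> x" and bs_lin: "linear bs"
  unfolding bs_def using adjoint_works[OF b_lin, of u x] adjoint_linear[OF b_lin] by (auto simp: inner_commute)

private lemma bs_t: "bs x \<in> t"
proof -
  define d where "d = bs x - pt (bs x)"
  have "pt d = 0" using pt_id[OF pt(2)] by (simp add: d_def linear_diff[OF pt(1)])
  then have "bs x \<bullet> d = 0" by (simp add: bs b_inner lin)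
  moreover have "d \<bullet> pt (bs x) = 0" unfolding d_def by (rule pt(3)[OF pt(2)])
  ultimately have "d \<bullet> d = 0" by (simp add: d_def[of] inner_diff_left inner_diff_right inner_commute)
  then have "bs x = pt (bs x)" by (simp add: d_def)
  then show ?thesis using pt(2) by metis
qed

private lemma bs_T: "bs x \<in> T" using bs_t by (simp add: t_def)

text \<open>\<open>symmetric_identity\<close> as an equation between vectors: tested against
  \<open>w\<close>, two of its terms become inner products with \<open>S\<close> through the adjoint
  \<open>bs\<close>.\<close>

private lemma b_c: "b (c v (D y)) = S (bs v) y + S (bs y) v"
proof (rule vector_eq_rdot[THEN iffD1], rule allI)
  fix w
  have S_bs: "S (bs x) x' \<bullet> w = - B (c x' (D w)) (D (D x))" for x x'
  proof -
    have "S (bs x) x' \<bullet> w = S (bs x) w \<bullet> x'" using S_sym[OF bs_T, of x x' w] by (simp add: inner_commute)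
    also have "\<dots> = - (c x' (D w) \<bullet> bs x)" using c_S[OF bs_T, of x' w x] by simp
    also have "\<dots> = - (b (c x' (D w)) \<bullet> x)" using bs[of x "c x' (D w)"] by (simp add: inner_commute[of "c x' (D w)"])
    finally show ?thesis by (simp add: b_inner pt_id[OF c_t])
  qed
  show "b (c v (D y)) \<bullet> w = (S (bs v) y + S (bs y) v) \<bullet> w"
    using symmetric_identity[of y w v] by (simp add: inner_add_left S_bs b_inner pt_id[OF c_t])
qed

text \<open>Both sides are the trace of \<open>g\<close> against the symmetric matrix of
  \<open>L\<close>.\<close>

private lemma sum_symmetric_operator:
  fixes g :: "'d \<Rightarrow> 'd \<Rightarrow> 'd"
  assumes "\<And>x. linear (g x)" "\<And>y. linear (\<lambda>x. g x y)" "\<And>x y. L x \<bullet> y = x \<bullet> L y"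
  shows "(\<Sum>e\<in>Basis. g (L e) e) = (\<Sum>e\<in>Basis. g e (L e))"
proof -
  have "(\<Sum>e\<in>Basis. g (L e) e) = (\<Sum>e\<in>Basis. \<Sum>k\<in>Basis. (L e \<bullet> k) *\<^sub>R g k e)"
    by (rule sum.cong[OF refl linear_euclidean_expand[OF assms(2)]])
  also have "\<dots> = (\<Sum>k\<in>Basis. \<Sum>e\<in>Basis. (L k \<bullet> e) *\<^sub>R g k e)"
    by (subst sum.swap, intro sum.cong refl, subst assms(3)) (simp add: inner_commute)
  also have "\<dots> = (\<Sum>k\<in>Basis. g k (L k))"
    by (rule sum.cong[OF refl linear_euclidean_expand[OF assms(1), symmetric]])
  finally show ?thesis .
qed

text \<open>Tracing the symmetric identity \<open>b_c\<close> against \<open>S u\<close> expresses \<open>b\<close> through the single vector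
  \<open>w\<close>; inserting \<open>w\<close> itself into the identity forces it to vanish.\<close>

private definition "w = (\<Sum>e\<in>Basis. S (bs e) e)"

text \<open>The trace form of \<open>S u\<close> and \<open>S v\<close> turned into a map, see
  \<open>f_inner\<close>. Written with \<open>c\<close> so that \<open>b_c\<close> applies to each
  summand; by \<open>S_inj\<close> it is positive definite on \<open>t\<close>.\<close>

private definition "f u = - (\<Sum>e\<in>Basis. c (S u e) (D e))"

private lemma f_inner: assumes "u \<in> T" "v \<in> T" shows "f u \<bullet> v = (\<Sum>e\<in>Basis. S v e \<bullet> S u e)"
  by (simp add: f_def inner_sum_left c_S[OF assms(2)] sum_negf)

private lemma f_pos: assumes "u \<in> t" "f u \<bullet> u = 0" shows "u = 0"
proof (rule S_inj[OF assms(1)])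
  have "(\<Sum>e\<in>Basis. S u e \<bullet> S u e) = 0" using f_inner[of u u] assms by (simp add: t_def)
  then have "\<forall>e\<in>Basis. S u e = 0" by (subst (asm) sum_nonneg_eq_0_iff) auto
  then show "S u x = 0" for x
    using linear_euclidean_expand[OF S_lin(1), of u x] by simp
qed

text \<open>Sum \<open>b_c\<close> over the basis with \<open>v = S u e\<close> and
  \<open>y = e\<close>. Moving the symmetric \<open>S u\<close> to the other slot makes the two sums
  equal, hence the factor \<open>2\<close>; commutation of the \<open>S\<close> maps then pulls
  \<open>S u\<close> out and leaves \<open>w\<close>.\<close>

private lemma b_f: assumes "u \<in> t" shows "b (f u) = - 2 *\<^sub>R S u w"
proof -
  have uT: "u \<in> T" using assms by (simp add: t_def)
  have comp: "linear (\<lambda>x. S (bs x) y)" for y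
    using linear_compose[OF bs_lin S_lin(2)] by (simp add: o_def)
  have "b (f u) = - (\<Sum>e\<in>Basis. S (bs (S u e)) e + S (bs e) (S u e))"
    by (simp add: f_def linear_neg[OF b_lin] linear_sum[OF b_lin] b_c)
  also have "\<dots> = - 2 *\<^sub>R (\<Sum>e\<in>Basis. S (bs e) (S u e))"
    by (simp add: sum.distrib sum_symmetric_operator[of "\<lambda>x y. S (bs x) y" "S u", OF S_lin(1) comp S_sym[OF uT]]
        scaleR_2[symmetric])
  also have "(\<Sum>e\<in>Basis. S (bs e) (S u e)) = S u w"
    by (simp add: w_def linear_sum[OF S_lin(1)] S_commute[OF assms bs_t])
  finally show ?thesis .
qed

private lemma b_zero: "b u = 0"
proof -
  \<comment> \<open>\<open>k\<close> represents the functional taking \<open>u\<close> to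
    \<open>S u w \<bullet> w\<close> on \<open>T\<close>, and its image under \<open>b\<close> is
    given by \<open>b_c\<close> at \<open>v = y = w\<close>.\<close>
  define k where "k = - c w (D w)"
  have k_t: "k \<in> t" unfolding k_def using c_t subspace_t by (simp add: subspace_neg)
  have k: "k \<bullet> u = S u w \<bullet> w" if "u \<in> T" for u using c_S[OF that, of w w] by (simp add: k_def)
  have "b k = - 2 *\<^sub>R S (bs w) w" by (simp add: k_def linear_neg[OF b_lin] b_c scaleR_2)
  \<comment> \<open>Pairing \<open>b k\<close> with \<open>w\<close> produces the same number with
    the factors \<open>1\<close> and \<open>- 2\<close>, so it is zero.\<close>
  then have "bs w \<bullet> k = - 2 * (k \<bullet> bs w)" using k[OF bs_T] by (simp add: bs)
  then have 0: "k \<bullet> bs w = 0" by (simp add: inner_commute)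
  have 1: "f u \<bullet> bs w = - 2 * (k \<bullet> u)" if "u \<in> t" for u
    using b_f[OF that] bs[of w "f u"] k[of u] that by (simp add: inner_commute t_def)
  \<comment> \<open>Taking \<open>u = bs w\<close> in \<open>1\<close> makes the right side vanish
    by \<open>0\<close>, and positivity of \<open>f\<close> applies. Taking \<open>u = z1\<close>
    afterwards gives \<open>D (D w) \<bullet> w = 0\<close>, which is minus the squared norm of
    \<open>D w\<close>.\<close>
  have "bs w = 0" by (rule f_pos[OF bs_t]) (simp add: 1[OF bs_t] 0)
  then have "k \<bullet> z1 = 0" using 1[OF z1_t] by simp
  then have "D (D w) \<bullet> w = 0" using k[of z1] z1_t by (simp add: t_def S_def D_def)
  then have "D w = 0" by (simp add: D_skew[of "D w"])
  then have "b (f u) = 0" if "u \<in> t" for u using b_f[OF that] by (simp add: S_def br_simps)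
  then have "bs x = 0" for x
    using f_pos[OF bs_t, of x] bs[of x "f (bs x)"] bs_t by (simp add: inner_commute)
  then have "b u \<bullet> b u = 0" using bs[of "b u" u] by simp
  then show ?thesis by simp
qed

text \<open>\<open>u\<close> commutes with \<open>T\<close>, so only the component of
  \<open>x\<close> in the range of \<open>D\<close> counts. It can be written
  \<open>D (D q)\<close>, and \<open>D\<close> commutes with \<open>br u\<close>, so
  \<open>br u x\<close> has the form to which \<open>b_zero\<close> applies.\<close>

lemma cartan_constant_length: assumes "u \<in> ker z1 \<inter> h" shows "B (br x u) u = 0"
proof -
  have u: "u \<in> t" "u \<in> T" using assms by (auto simp: t_def)
  obtain p where p: "x = tp x + D p" by (rule tp_decomp)
  obtain q where q: "p = tp p + D q" by (rule tp_decomp)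
  have "D p = D (D q)" using arg_cong[OF q, of D] by (simp add: lin D_T[OF tp(2)])
  then have "br u x = br u (tp x) + br u (D (D q))"
    using arg_cong[OF p, of "br u"] by (simp add: br_simps)
  then have "br u x = D (D (br u q))" by (simp add: t_T_commute[OF u(1) tp(2)] T_br[OF u(2)])
  then have "B u (br u x) = 0" using b_inner[of u "br u q"] b_zero pt_id[OF u(1)] by simp
  then show ?thesis using B_sym br_anti[of x u] by (simp add: lin)
qed

end

end

section \<open>Transitive isometric actions\<close>

text \<open>Carries dimensions from the Euclidean model to the space of vector fields, where
  \<open>regular_in\<close> measures centralizers.\<close>

lemma dim_injective_linear_image:
  fixes f :: "'a::euclidean_space \<Rightarrow> 'b::real_vector"
  assumes f: "linear f" "inj f" shows "dim (f ` S) = dim S"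
proof -
  obtain C where C: "C \<subseteq> S" "independent C" "S \<subseteq> span C" "card C = dim S" using basis_exists[of S] by blast
  show ?thesis
  proof (rule dim_unique)
    show "f ` C \<subseteq> f ` S" using C(1) by blast
    show "f ` S \<subseteq> span (f ` C)" unfolding linear_span_image[OF f(1)] using C(3) by blast
    show "independent (f ` C)" by (rule linear_independent_injective_image[OF f(1) C(2)]) (rule inj_on_subset[OF f(2) subset_UNIV])
    show "card (f ` C) = dim S" using card_image[OF inj_on_subset[OF f(2) subset_UNIV], of C] C(4) by simp
  qed
qed

lemma bilinear_vector_derivative:
  fixes P :: "'d::euclidean_space \<Rightarrow> 'd \<Rightarrow> real"
  assumes "\<And>x. linear (P x)" "\<And>y. linear (\<lambda>x. P x y)"
    and "(u has_vector_derivative u') (at t)" "(v has_vector_derivative v') (at t)"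
  shows "((\<lambda>s. P (u s) (v s)) has_real_derivative P (u t) v' + P u' (v t)) (at t)"
proof -
  have "bilinear P" using assms(1,2) by (simp add: bilinear_def)
  then have "bounded_bilinear P" by (simp add: bilinear_conv_bounded_bilinear)
  from bounded_bilinear.has_vector_derivative[OF this assms(3,4)]
  show ?thesis by (simp add: has_real_derivative_iff_has_vector_derivative)
qed

locale isometric_lie_action = lie_grp AG G
  for AG :: "('g::{t2_space,second_countable_topology}, 'd::euclidean_space) atlas" and G :: "'g monoid" (structure) +
  fixes AM :: "('m::{t2_space,second_countable_topology}, 'e::euclidean_space) atlas"
    and g :: "'m \<Rightarrow> 'm tangent \<Rightarrow> 'm tangent \<Rightarrow> real"
    and \<alpha> :: "'g \<Rightarrow> 'm \<Rightarrow> 'm"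
  assumes AM: "smooth_atlas AM" and metric: "riemannian_metric AM g"
    and connected: "connected (UNIV :: 'm set)" and compact: "compact (UNIV :: 'g set)"
    and action: "isometric_action AG G AM g \<alpha>" and transitive: "transitive_action G UNIV \<alpha>"
begin

lemma act_mult: "\<alpha> (a \<otimes> b) x = \<alpha> a (\<alpha> b x)" and act_one [simp]: "\<alpha> \<one> x = x"
  and act_trans: "\<exists>a. \<alpha> a x = y"
proof -
  interpret transitive_action G UNIV \<alpha> by (rule transitive)
  show "\<alpha> (a \<otimes> b) x = \<alpha> a (\<alpha> b x)" by (rule composition_rule) simp_all
  show "\<alpha> \<one> x = x" using fun_cong[OF id_eq_one, of x] by simp
  show "\<exists>a. \<alpha> a x = y" using unique_orbit[of x y] by auto
qed

lemma act_smooth: "smooth_map (prod_atlas AG AM) AM (\<lambda>z. \<alpha> (fst z) (snd z))"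
  using action by (simp add: isometric_action_def case_prod_unfold)

lemma act_isometry: "isometry AM g (\<alpha> a)"
  using action by (simp add: isometric_action_def)

lemma act_smooth_orbit: "smooth_map AG AM (\<lambda>a. \<alpha> a x)"
  using smooth_map_compose[OF atlas smooth_atlas_prod[OF atlas AM] AM
      smooth_map_Pair[OF atlas atlas AM smooth_map_id[OF atlas] smooth_map_const[OF atlas AM]] act_smooth] by simp

lemma act_smooth_map: "smooth_map AM AM (\<alpha> a)"
  using act_isometry by (auto simp: isometry_def diffeomorphism_def)

text \<open>The fundamental field as the differential of the orbit map at the identity; without the
  exponential in it, linearity and equivariance are immediate.\<close>

definition "ff \<xi> x = push_forward AM (\<lambda>a. \<alpha> a x) (evec \<xi>)"

lemma ff_apply: "smooth_fun AM f \<Longrightarrow> ff \<xi> x f = evec \<xi> (\<lambda>a. f (\<alpha> a x))"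
  by (simp add: ff_def push_forward_def o_def)

lemma smooth_fun_orbit: "smooth_fun AM f \<Longrightarrow> smooth_fun AG (\<lambda>a. f (\<alpha> a x))"
  by (rule smooth_fun_compose[OF atlas AM act_smooth_orbit])

lemma fundamental_field_lfield: "fundamental_field AG G AM \<alpha> (lfield \<xi>) = ff \<xi>"
proof (intro ext)
  fix x f
  show "fundamental_field AG G AM \<alpha> (lfield \<xi>) x f = ff \<xi> x f"
  proof (cases "smooth_fun AM f")
    case True
    have "((\<lambda>s. f (\<alpha> (expc \<xi> s) x)) has_real_derivative evec \<xi> (\<lambda>a. f (\<alpha> a x))) (at 0)"
      using has_velocityD[OF expc_velocity[of \<xi> 0] smooth_fun_orbit[OF True, of x]] by (simp add: lfield_one)
    then have "deriv (\<lambda>s. f (\<alpha> (expc \<xi> s) x)) 0 = evec \<xi> (\<lambda>a. f (\<alpha> a x))" by (rule DERIV_imp_deriv)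
    then show ?thesis
      using True by (simp add: fundamental_field_def velocity_def lie_exp_scaleR ff_apply)
  next
    case False
    then show ?thesis by (simp add: fundamental_field_def velocity_def ff_def push_forward_def)
  qed
qed

lemma ff_tangent: "ff \<xi> x \<in> tangent_space AM x"
  using push_forward_tangent[OF atlas AM act_smooth_orbit evec_tangent, of x \<xi>] by (simp add: ff_def)

lemma ff_linear: "ff (\<xi> + \<eta>) x = ff \<xi> x + ff \<eta> x" "ff (c *\<^sub>R \<xi>) x = c *\<^sub>R ff \<xi> x"
  by (auto simp: ff_def push_forward_def fun_eq_iff linear_add[OF evec_linear] linear_scale[OF evec_linear]
      scaleR_fun_def)

text \<open>\<open>b\<close> takes \<open>\<alpha> a x\<close> to the image of
  \<open>\<alpha> b x\<close> under \<open>b \<otimes> a \<otimes> inv b\<close>, and conjugation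
  differentiates to \<open>Ad b\<close>.\<close>

lemma push_forward_ff: "push_forward AM (\<alpha> b) (ff \<xi> x) = ff (Ad b \<xi>) (\<alpha> b x)"
proof
  fix f
  show "push_forward AM (\<alpha> b) (ff \<xi> x) f = ff (Ad b \<xi>) (\<alpha> b x) f"
  proof (cases "smooth_fun AM f")
    case True
    have "push_forward AM (\<alpha> b) (ff \<xi> x) f = evec \<xi> (\<lambda>a. f (\<alpha> b (\<alpha> a x)))"
      using True ff_apply[OF smooth_fun_compose[OF AM AM act_smooth_map True, of b], of \<xi> x]
      by (simp add: push_forward_def o_def)
    also have "\<dots> = evec \<xi> (\<lambda>a. f (\<alpha> (b \<otimes> a \<otimes> inv b) (\<alpha> b x)))"
      by (simp add: act_mult[symmetric] m_assoc)
    also have "\<dots> = ff (Ad b \<xi>) (\<alpha> b x) f"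
      by (simp add: ff_apply[OF True] evec_Ad[OF smooth_fun_orbit[OF True]])
    finally show ?thesis .
  qed (simp add: push_forward_def ff_def)
qed

lemma killing_ff: "killing_field AM g (ff \<xi>)"
  unfolding killing_field_def
proof (intro conjI exI[of _ "\<lambda>t. \<alpha> (expc \<xi> t)"] allI)
  have "smooth_fun AM (\<lambda>x. ff \<xi> x f)" if f: "smooth_fun AM f" for f
    using smooth_fun_evec[OF AM smooth_fun_compose[OF smooth_atlas_prod[OF atlas AM] AM act_smooth f], of \<xi>]
    by (simp add: ff_apply[OF f])
  then show "vector_field AM (ff \<xi>)" using ff_tangent by (simp add: vector_field_def)
  show "isometry AM g (\<alpha> (expc \<xi> t))" for t by (rule act_isometry)
  show "\<alpha> (expc \<xi> 0) p = p" for p by simp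
  show "integral_curve AM (ff \<xi>) (\<lambda>t. \<alpha> (expc \<xi> t) p)" for p
    unfolding integral_curve_def
  proof (intro allI impI)
    fix t f assume f: "smooth_fun AM f"
    let ?q = "\<alpha> (expc \<xi> t) p"
    have "((\<lambda>s. f (\<alpha> (expc \<xi> s) ?q)) has_real_derivative ff \<xi> ?q f) (at 0)"
      using has_velocityD[OF expc_velocity[of \<xi> 0] smooth_fun_orbit[OF f, of ?q]]
      by (simp add: lfield_one ff_apply[OF f])
    then have "((\<lambda>s. f (\<alpha> (expc \<xi> (s + t)) p)) has_real_derivative ff \<xi> ?q f) (at 0)"
      by (simp add: act_mult[symmetric] expc_add[symmetric])
    then show "((\<lambda>s. f (\<alpha> (expc \<xi> s) p)) has_real_derivative ff \<xi> ?q f) (at t)"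
      using DERIV_shift[of "\<lambda>s. f (\<alpha> (expc \<xi> s) p)" "ff \<xi> ?q f" 0 t] by simp
  qed
qed

definition "base = (SOME x :: 'm. True)"

definition "form \<xi> \<eta> = g base (ff \<xi> base) (ff \<eta> base)"

lemma metric_props:
  assumes "u \<in> tangent_space AM p" "v \<in> tangent_space AM p"
  shows "w \<in> tangent_space AM p \<Longrightarrow> g p (u + v) w = g p u w + g p v w"
    "g p (c *\<^sub>R u) v = c * g p u v" "g p u v = g p v u"
  using metric assms by (auto simp: riemannian_metric_def)

lemma form_linear_left: "linear (\<lambda>\<xi>. form \<xi> \<eta>)"
  by (rule linearI) (simp_all add: form_def ff_linear metric_props ff_tangent)

lemma form_sym: "form \<xi> \<eta> = form \<eta> \<xi>"
  unfolding form_def by (rule metric_props(3)[OF ff_tangent ff_tangent])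

lemma form_linear: "linear (form \<xi>)"
proof -
  have "form \<xi> = (\<lambda>\<eta>. form \<eta> \<xi>)" by (rule ext) (rule form_sym)
  then show ?thesis using form_linear_left by simp
qed

text \<open>The isometry \<open>\<alpha> a\<close> brings the point back to \<open>base\<close> at
  the price of the adjoint action, so lengths at all points of the orbit become values of one
  form.\<close>

lemma length_form: "g (\<alpha> (inv a) base) (ff \<xi> (\<alpha> (inv a) base)) (ff \<xi> (\<alpha> (inv a) base)) = form (Ad a \<xi>) (Ad a \<xi>)"
proof -
  let ?x = "\<alpha> (inv a) base"
  have "g (\<alpha> a ?x) (push_forward AM (\<alpha> a) (ff \<xi> ?x)) (push_forward AM (\<alpha> a) (ff \<xi> ?x)) =
      g ?x (ff \<xi> ?x) (ff \<xi> ?x)"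
    using act_isometry[of a] ff_tangent by (simp add: isometry_def)
  moreover have "\<alpha> a ?x = base" by (simp add: act_mult[symmetric])
  ultimately show ?thesis by (simp add: push_forward_ff form_def)
qed

lemma constant_length_iff: "constant_length g (ff \<xi>) \<longleftrightarrow> (\<exists>c. \<forall>a. form (Ad a \<xi>) (Ad a \<xi>) = c)"
proof
  assume "constant_length g (ff \<xi>)"
  then obtain c where "\<And>p. g p (ff \<xi> p) (ff \<xi> p) = c"
    unfolding constant_length_def constant_on_def by blast
  then show "\<exists>c. \<forall>a. form (Ad a \<xi>) (Ad a \<xi>) = c" using length_form by metis
next
  assume "\<exists>c. \<forall>a. form (Ad a \<xi>) (Ad a \<xi>) = c"
  then obtain c where c: "\<And>a. form (Ad a \<xi>) (Ad a \<xi>) = c" by blast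
  have "g p (ff \<xi> p) (ff \<xi> p) = c" for p
  proof -
    obtain a where "\<alpha> a base = p" using act_trans by blast
    then show ?thesis using length_form[of "inv a" \<xi>] c by simp
  qed
  then show "constant_length g (ff \<xi>)" unfolding constant_length_def constant_on_def by blast
qed

lemma smooth_fun_form: "smooth_fun AG (\<lambda>a. form (Ad a \<xi>) (Ad a \<xi>))"
proof -
  have "form u v = (\<Sum>i\<in>Basis. (\<Sum>j\<in>Basis. form i j * (v \<bullet> j)) * (u \<bullet> i))" for u v
    using linear_euclidean_expand[OF form_linear_left, of u v] linear_euclidean_expand[OF form_linear, of _ v]
    by (simp add: mult.commute)
  then have eq: "(\<lambda>a. form (Ad a \<xi>) (Ad a \<xi>)) =
      (\<lambda>a. \<Sum>i\<in>Basis. (\<Sum>j\<in>Basis. form i j * (Ad a \<xi> \<bullet> j)) * (Ad a \<xi> \<bullet> i))" by blast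
  have sum: "smooth_fun AG (\<lambda>x. \<Sum>i\<in>Basis. F i x)" if "\<And>i. i \<in> Basis \<Longrightarrow> smooth_fun AG (F i)"
    for F :: "'d \<Rightarrow> 'g \<Rightarrow> real"
    by (rule smooth_fun_sum[OF atlas finite_Basis that])
  show ?thesis
    unfolding eq by (intro sum smooth_fun_mult[OF atlas] smooth_fun_const[OF atlas] smooth_fun_Ad)
qed

text \<open>The group need not be connected, so a function with vanishing derivative is only locally
  constant; by compactness it takes finitely many values, and \<open>M\<close> is connected.\<close>

lemma constant_length_infinitesimal:
  assumes "\<And>a \<eta>. form (Ad a (br \<eta> \<xi>)) (Ad a \<xi>) = 0"
  shows "constant_length g (ff \<xi>)"
proof -
  define F where "F a = form (Ad a \<xi>) (Ad a \<xi>)" for a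
  have F: "smooth_fun AG F" unfolding F_def[abs_def] by (rule smooth_fun_form)
  have zero: "lfield \<eta> a F = 0" for \<eta> a
  proof -
    have "((\<lambda>s. F (a \<otimes> expc \<eta> s)) has_real_derivative lfield \<eta> a F) (at 0)"
      using has_velocityD[OF has_velocity_translate[OF expc_velocity[of \<eta> 0], of a] F] by simp
    moreover have "((\<lambda>s. F (a \<otimes> expc \<eta> s)) has_real_derivative 0) (at 0)"
    proof -
      have d: "((\<lambda>s. Ad (a \<otimes> expc \<eta> s) \<xi>) has_vector_derivative Ad a (br \<eta> \<xi>)) (at 0)"
        unfolding Ad_mult
        using bounded_linear.has_vector_derivative[OF Ad_linear[of a, unfolded linear_conv_bounded_linear]
            Ad_expc_derivative[of \<eta> \<xi> 0]] by (simp add: Ad_one)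
      from bilinear_vector_derivative[OF form_linear form_linear_left d d]
      show ?thesis
        using assms[of a \<eta>] form_sym[of "Ad a \<xi>"] by (simp add: F_def)
    qed
    ultimately show ?thesis using DERIV_unique by blast
  qed
  have finite: "finite (range F)"
  proof -
    have "\<exists>N. open N \<and> p \<in> N \<and> (\<forall>x\<in>N. F x = F p)" for p
      by (rule locally_constant[OF F zero]) blast
    then obtain N where N: "\<And>p. open (N p)" "\<And>p. p \<in> N p" "\<And>p x. x \<in> N p \<Longrightarrow> F x = F p" by metis
    obtain P where P: "finite P" "UNIV \<subseteq> (\<Union>p\<in>P. N p)"
      using compactE_image[OF compact, of UNIV N] N(1,2) by (metis UNIV_I UN_I subsetI)
    have "range F \<subseteq> F ` P" using P(2) N(3) by fastforce
    then show ?thesis using P(1) finite_surj by blast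
  qed
  define f where "f p = g p (ff \<xi> p) (ff \<xi> p)" for p
  have fF: "f (\<alpha> (inv a) base) = F a" for a by (simp add: f_def F_def length_form)
  have orbit: "\<exists>a. \<alpha> (inv a) base = p" for p
    using act_trans[of base p] by (metis inv_inv in_carrier)
  have "range f \<subseteq> range F" using orbit fF by (metis image_subsetI rangeI)
  then have fin: "finite (range f)" using finite finite_subset by blast
  \<comment> \<open>Continuity of \<open>f\<close> via closed sets: the preimage is a finite union,
    over the values of \<open>f\<close> in \<open>C\<close>, of images of compact level sets of
    \<open>F\<close> under a continuous map.\<close>
  have "closed (f -` C)" if "closed C" for C
  proof -
    have "closed ((\<lambda>a. \<alpha> (inv a) base) ` (F -` {c}))" for c
    proof (intro compact_imp_closed compact_continuous_image)
      show "continuous_on (F -` {c}) (\<lambda>a. \<alpha> (inv a) base)"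
        by (rule continuous_on_compose2[OF smooth_map_continuous[OF act_smooth_orbit]
              continuous_on_subset[OF smooth_map_continuous[OF smooth_inv]]]) auto
      have "closed (F -` {c})"
        by (rule continuous_closed_vimage[OF closed_singleton])
          (use smooth_map_continuous[OF F] in \<open>simp add: continuous_on_eq_continuous_at\<close>)
      then show "compact (F -` {c})" using compact_Int_closed[OF compact] by force
    qed
    then have "closed (\<Union>c\<in>range f \<inter> C. (\<lambda>a. \<alpha> (inv a) base) ` (F -` {c}))"
      using fin by (intro closed_UN) auto
    moreover have "(\<Union>c\<in>range f \<inter> C. (\<lambda>a. \<alpha> (inv a) base) ` (F -` {c})) = f -` C"
    proof (intro equalityI subsetI)
      fix p assume "p \<in> f -` C"
      moreover obtain a where "\<alpha> (inv a) base = p" using orbit by blast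
      ultimately show "p \<in> (\<Union>c\<in>range f \<inter> C. (\<lambda>a. \<alpha> (inv a) base) ` (F -` {c}))"
        using fF[of a] rangeI[of f p] by (intro UN_I[of "f p"]) auto
    qed (auto simp: fF)
    ultimately show ?thesis by simp
  qed
  then have "continuous_on UNIV f" by (simp add: continuous_on_closed_vimage)
  then have "connected (range f)" by (rule connected_continuous_image[OF _ connected])
  then obtain c where "range f = {c}" using connected_finite_iff_sing[of "range f"] fin by auto
  then show ?thesis unfolding constant_length_def constant_on_def f_def[symmetric] by blast
qed

text \<open>Everything is transported to the Euclidean model: \<open>R\<close> is \<open>Ad\<close>
  made orthogonal by \<open>L\<close>, \<open>bk\<close> is the bracket in the new coordinates, and
  \<open>\<Lambda>\<close> is the isomorphism onto the Lie algebra of fields. There is one form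
  \<open>Bf a\<close> for each group element; differentiating in \<open>a\<close> yields the
  identities that each of them satisfies.\<close>

lemma simple_ideal_constant_length:
  assumes ideal: "lie_ideal (lie_algebra AG G) \<hh>" and simple: "simple_lie_algebra \<hh>"
    and Z0: "Z0 \<in> lie_center (lie_algebra AG G)" and Z1: "Z1 \<in> \<hh>"
    and const: "constant_length g (fundamental_field AG G AM \<alpha> (Z0 + Z1))"
    and reg: "regular_in \<hh> Z1" and X: "X \<in> \<hh>"
  shows "constant_length g (fundamental_field AG G AM \<alpha> X)"
proof -
  have Ad_inv: "Ad a (Ad (inv a) \<xi>) = \<xi>" "Ad (inv a) (Ad a \<xi>) = \<xi>" for a \<xi>
    by (simp_all add: Ad_mult[symmetric] Ad_one)
  obtain L L' :: "'d \<Rightarrow> 'd" where L: "linear L" and L': "linear L'"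
    and LL': "\<And>x. L (L' x) = x" and L'L: "\<And>x. L' (L x) = x"
    and orth: "\<And>a x y. L (Ad a x) \<bullet> L (Ad a y) = L x \<bullet> L y"
    using orthogonalization[of Ad "(\<otimes>)" "\<lambda>a. inv a" \<one>,
        OF compact Ad_linear continuous_Ad Ad_mult Ad_inv Ad_one] by metis
  define \<Lambda> where "\<Lambda> x = lfield (L' x)" for x
  define bk where "bk x y = L (br (L' x) (L' y))" for x y
  define R where "R a x = L (Ad a (L' x))" for a x
  define Bf where "Bf a x y = form (Ad a (L' x)) (Ad a (L' y))" for a x y
  have \<Lambda>_lin: "linear \<Lambda>" unfolding \<Lambda>_def[abs_def]
    using linear_compose[OF L' lfield_linear] by (simp add: o_def)
  have \<Lambda>_inj: "inj \<Lambda>" unfolding \<Lambda>_def[abs_def]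
    by (rule injI) (metis LL' lfield_inj injD)
  have \<Lambda>_br: "\<Lambda> (bk x y) = lie_bracket (\<Lambda> x) (\<Lambda> y)" for x y
    by (simp add: \<Lambda>_def bk_def L'L lfield_br)
  have \<Lambda>_mem: "\<Lambda> x \<in> lie_algebra AG G" for x by (simp add: \<Lambda>_def lfield_in_lie_algebra)
  have \<Lambda>_ex: "\<exists>x. Y = \<Lambda> x" if "Y \<in> lie_algebra AG G" for Y
    using that by (metis \<Lambda>_def L'L lie_algebra_lfield)
  have \<Lambda>_ff: "fundamental_field AG G AM \<alpha> (\<Lambda> x) = ff (L' x)" for x
    by (simp add: \<Lambda>_def fundamental_field_lfield)
  have expd: "((\<lambda>s. R (expc (L' x) s) y) has_vector_derivative bk x (R (expc (L' x) t) y)) (at t)" for x y t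
    unfolding R_def bk_def L'L
    by (rule bounded_linear.has_vector_derivative[OF L[unfolded linear_conv_bounded_linear] Ad_expc_derivative])
  have bk_lin: "linear (bk x)" for x
    unfolding bk_def[abs_def]
    using linear_compose[OF linear_compose[OF L' br_linear_right] L] by (simp add: o_def)
  have R_orth: "R a x \<bullet> R a y = x \<bullet> y" for a x y by (simp add: R_def orth LL')
  have R_mult: "R (a \<otimes> b) x = R a (R b x)" for a b x by (simp add: R_def Ad_mult L'L)
  have R_one: "R \<one> x = x" for x by (simp add: R_def Ad_one LL')
  have R_cont: "continuous_on UNIV (\<lambda>a. R a x)" for x
    unfolding R_def by (rule bounded_linear.continuous_on[OF L[unfolded linear_conv_bounded_linear] continuous_Ad])
  interpret M: metric_lie_algebra bk
  proof (rule metric_lie_algebra.intro)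
    show "linear (bk x)" for x by (rule bk_lin)
    show "bk x y = - bk y x" for x y
      unfolding bk_def by (subst br_antisym) (simp add: linear_neg[OF L])
    show "bk x (bk y z) = bk (bk x y) z + bk y (bk x z)" for x y z
      by (simp add: bk_def L'L linear_add[OF L, symmetric] br_jacobi[of "L' x"])
    \<comment> \<open>Differentiate the orthogonality of \<open>R\<close> along a one-parameter
      subgroup.\<close>
    show "bk x y \<bullet> z = - (y \<bullet> bk x z)" for x y z
    proof -
      have "((\<lambda>s. R (expc (L' x) s) y \<bullet> R (expc (L' x) s) z) has_real_derivative
          y \<bullet> bk x z + bk x y \<bullet> z) (at 0)"
        using bilinear_vector_derivative[of "\<lambda>u v. u \<bullet> v", OF _ _ expd[of x y 0] expd[of x z 0]]
        by (simp add: R_one bounded_linear.linear[OF bounded_linear_inner_left]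
            bounded_linear.linear[OF bounded_linear_inner_right])
      then have "((\<lambda>s. y \<bullet> z) has_real_derivative y \<bullet> bk x z + bk x y \<bullet> z) (at 0)"
        by (simp add: R_orth)
      then have "y \<bullet> bk x z + bk x y \<bullet> z = 0" using DERIV_const DERIV_unique by blast
      then show ?thesis by simp
    qed
  qed
  define h where "h = {x. \<Lambda> x \<in> \<hh>}"
  have hh: "subspace \<hh>" "\<hh> \<subseteq> lie_algebra AG G"
    "\<And>Y W. Y \<in> lie_algebra AG G \<Longrightarrow> W \<in> \<hh> \<Longrightarrow> lie_bracket Y W \<in> \<hh>"
    using ideal by (auto simp: lie_ideal_def)
  have h: "subspace h"
    using hh(1) by (auto simp: h_def subspace_def linear_add[OF \<Lambda>_lin] linear_scale[OF \<Lambda>_lin] linear_0[OF \<Lambda>_lin])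
  have h_ideal: "bk x y \<in> h" if "y \<in> h" for x y
    using hh(3)[OF \<Lambda>_mem, of "\<Lambda> y" x] that by (simp add: h_def \<Lambda>_br)
  have hh_eq: "\<hh> = \<Lambda> ` h" using hh(2) \<Lambda>_ex unfolding h_def by blast
  obtain z1 where z1: "Z1 = \<Lambda> z1" "z1 \<in> h" using Z1 hh_eq by blast
  obtain z0 where z0: "Z0 = \<Lambda> z0" using Z0 \<Lambda>_ex by (auto simp: lie_center_def)
  have \<Lambda>_zero: "\<Lambda> x = 0 \<longleftrightarrow> x = 0" for x
    using \<Lambda>_inj linear_0[OF \<Lambda>_lin] by (metis injD)
  have z0_central: "bk z0 x = 0" for x
    using Z0 \<Lambda>_mem[of x] z0 \<Lambda>_br[of z0 x] by (simp add: lie_center_def \<Lambda>_zero[symmetric])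
  have centerless: "x = 0" if x: "x \<in> h" "\<And>y. y \<in> h \<Longrightarrow> bk x y = 0" for x
  proof -
    \<comment> \<open>The center of the ideal is an ideal of it, hence zero or everything by
      simplicity; the second is excluded because a simple algebra has a nonzero bracket.\<close>
    define C where "C = {x \<in> h. \<forall>y\<in>h. bk x y = 0}"
    have subC: "subspace C"
      using h by (auto simp: C_def subspace_def M.br_simps)
    have "lie_ideal \<hh> (\<Lambda> ` C)"
      unfolding lie_ideal_def
    proof (intro conjI ballI)
      show "subspace (\<Lambda> ` C)" by (rule linear_subspace_image[OF \<Lambda>_lin subC])
      show "\<Lambda> ` C \<subseteq> \<hh>" by (auto simp: C_def h_def)
      fix Y W assume "Y \<in> \<hh>" "W \<in> \<Lambda> ` C"
      then obtain y w where yw: "y \<in> h" "w \<in> C" "Y = \<Lambda> y" "W = \<Lambda> w" using hh_eq by blast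
      have "bk y w = 0" using M.br_anti[of y w] yw by (simp add: C_def)
      then have "lie_bracket Y W = \<Lambda> 0" using \<Lambda>_br[of y w] yw by simp
      then show "lie_bracket Y W \<in> \<Lambda> ` C" using subspace_0[OF subC] by blast
    qed
    then have "\<Lambda> ` C = {0} \<or> \<Lambda> ` C = \<hh>" using simple by (auto simp: simple_lie_algebra_def)
    moreover have "\<Lambda> ` C \<noteq> \<hh>"
    proof
      assume eq: "\<Lambda> ` C = \<hh>"
      obtain Y W where YW: "Y \<in> \<hh>" "W \<in> \<hh>" "lie_bracket Y W \<noteq> 0"
        using simple by (auto simp: simple_lie_algebra_def)
      obtain y where y: "y \<in> C" "Y = \<Lambda> y" using YW(1) eq by blast
      obtain w where w: "w \<in> h" "W = \<Lambda> w" using YW(2) hh_eq by blast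
      have "bk y w = 0" using y w by (simp add: C_def)
      then show False using YW(3) \<Lambda>_br[of y w] y w linear_0[OF \<Lambda>_lin] by simp
    qed
    ultimately have "\<Lambda> ` C = {0}" by blast
    moreover have "x \<in> C" using x by (simp add: C_def)
    ultimately show "x = 0" using \<Lambda>_zero by blast
  qed
  have centralizer: "lie_centralizer \<hh> (\<Lambda> v) = \<Lambda> ` (M.ker v \<inter> h)" for v
    unfolding lie_centralizer_def hh_eq M.ker_def
    by (auto simp: \<Lambda>_br[symmetric] \<Lambda>_zero)
  have dims: "dim (M.ker z1 \<inter> h) \<le> dim (M.ker v \<inter> h)" if "v \<in> h" for v
  proof -
    have "\<Lambda> v \<in> \<hh>" using that by (simp add: h_def)
    then have "dim (lie_centralizer \<hh> (\<Lambda> z1)) \<le> dim (lie_centralizer \<hh> (\<Lambda> v))"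
      using reg by (simp add: regular_in_def z1(1))
    then show ?thesis by (simp add: centralizer dim_injective_linear_image[OF \<Lambda>_lin \<Lambda>_inj])
  qed
  have abelian: "bk x y = 0" if "x \<in> M.ker z1 \<inter> h" "y \<in> M.ker z1 \<inter> h" for x y
    by (rule M.regular_centralizer_abelian[OF h h_ideal z1(2) dims that])
  define Z where "Z = z0 + z1"
  have Bf_lin: "linear (Bf a x)" "linear (\<lambda>x. Bf a x y)" for a x y
    unfolding Bf_def[abs_def]
    using linear_compose[OF linear_compose[OF L' Ad_linear] form_linear]
      linear_compose[OF linear_compose[OF L' Ad_linear] form_linear_left] by (simp_all add: o_def)
  have Bf_sym: "Bf a x y = Bf a y x" for a x y by (simp add: Bf_def form_sym)
  \<comment> \<open>Along \<open>a \<otimes> expc (L' v) s\<close> the derivative is again expressed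
    by \<open>Bf a\<close>. So every identity obtained holds for all \<open>a\<close> and can be
    differentiated once more.\<close>
  have Bf_deriv: "((\<lambda>s. Bf (a \<otimes> expc (L' v) s) x y) has_real_derivative Bf a x (bk v y) + Bf a (bk v x) y) (at 0)"
    for a v x y
  proof -
    have d: "((\<lambda>s. Ad (a \<otimes> expc (L' v) s) (L' x)) has_vector_derivative Ad a (L' (bk v x))) (at 0)" for x
      unfolding Ad_mult bk_def L'L
      using bounded_linear.has_vector_derivative[OF Ad_linear[of a, unfolded linear_conv_bounded_linear]
          Ad_expc_derivative[of "L' v" "L' x" 0]] by (simp add: Ad_one)
    from bilinear_vector_derivative[OF form_linear form_linear_left d[of x] d[of y]]
    show ?thesis by (simp add: Bf_def)
  qed
  have "\<exists>c. \<forall>a. Bf a Z Z = c"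
    using const constant_length_iff[of "L' Z"] \<Lambda>_ff[of Z]
    by (simp add: z0 z1(1) Z_def Bf_def linear_add[OF \<Lambda>_lin])
  then obtain c where c: "\<And>a. Bf a Z Z = c" by blast
  have E1: "Bf a (bk x Z) Z = 0" for a x
  proof -
    have "((\<lambda>s. c) has_real_derivative Bf a Z (bk x Z) + Bf a (bk x Z) Z) (at 0)"
      using Bf_deriv[of a x Z Z] by (simp add: c)
    then have "Bf a Z (bk x Z) + Bf a (bk x Z) Z = 0" using DERIV_const DERIV_unique by blast
    then show ?thesis using Bf_sym[of a Z] by simp
  qed
  have E2: "Bf a (bk y (bk x Z)) Z + Bf a (bk x Z) (bk y Z) = 0" for a x y
  proof -
    have "((\<lambda>s. 0) has_real_derivative Bf a (bk x Z) (bk y Z) + Bf a (bk y (bk x Z)) Z) (at 0)"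
      using Bf_deriv[of a y "bk x Z" Z] by (simp add: E1)
    then have "Bf a (bk x Z) (bk y Z) + Bf a (bk y (bk x Z)) Z = 0" using DERIV_const DERIV_unique by blast
    then show ?thesis by simp
  qed
  have E3: "Bf a (bk v (bk y (bk x Z))) Z + Bf a (bk y (bk x Z)) (bk v Z)
      + Bf a (bk v (bk x Z)) (bk y Z) + Bf a (bk x Z) (bk v (bk y Z)) = 0" for a x y v
  proof -
    have "((\<lambda>s. 0) has_real_derivative
        (Bf a (bk y (bk x Z)) (bk v Z) + Bf a (bk v (bk y (bk x Z))) Z) +
        (Bf a (bk x Z) (bk v (bk y Z)) + Bf a (bk v (bk x Z)) (bk y Z))) (at 0)"
      using DERIV_add[OF Bf_deriv[of a v "bk y (bk x Z)" Z] Bf_deriv[of a v "bk x Z" "bk y Z"]]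
      by (simp add: E2)
    then have "(Bf a (bk y (bk x Z)) (bk v Z) + Bf a (bk v (bk y (bk x Z))) Z) +
        (Bf a (bk x Z) (bk v (bk y Z)) + Bf a (bk v (bk x Z)) (bk y Z)) = 0"
      using DERIV_const DERIV_unique by blast
    then show ?thesis by simp
  qed
  have cartan: "constant_length g (ff (L' u))" if u: "u \<in> M.ker z1 \<inter> h" for u
  proof (rule constant_length_infinitesimal)
    fix a \<eta>
    have "Bf a (bk (L \<eta>) u) u = 0"
      by (rule M.cartan_constant_length[OF h h_ideal centerless z1(2) z0_central abelian Bf_lin(1) Bf_sym
            E1[unfolded Z_def] E2[unfolded Z_def] E3[unfolded Z_def] u])
    then show "form (Ad a (br \<eta> (L' u))) (Ad a (L' u)) = 0" by (simp add: Bf_def bk_def L'L)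
  qed

  text \<open>Every element of the ideal is conjugate into the centralizer of \<open>z1\<close>: maximise
    \<open>R a x \<bullet> z1\<close> over the stabiliser \<open>K\<close> of the ideal.\<close>

  obtain x where x: "X = \<Lambda> x" "x \<in> h" using X hh_eq by blast
  define K where "K = {a. \<forall>y\<in>h. R a y \<in> h}"
  \<comment> \<open>The distance to the ideal is constant along the curve. \<open>d\<close> is the
    component orthogonal to \<open>h\<close>; since \<open>bk v\<close> is skew and preserves
    \<open>h\<close>, the derivative of \<open>d s \<bullet> d s\<close> vanishes, and
    \<open>d 0\<close> is zero.\<close>
  have expK: "expc (L' v) t \<in> K" for v t
  proof -
    obtain p where p: "linear p" "\<And>y. p y \<in> h" "\<And>y s. s \<in> h \<Longrightarrow> (y - p y) \<bullet> s = 0"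
      using orthogonal_projection[OF h] by metis
    have "R (expc (L' v) t) y \<in> h" if y: "y \<in> h" for y
    proof -
      define d where "d s = R (expc (L' v) s) y - p (R (expc (L' v) s) y)" for s
      have "((\<lambda>s. d s \<bullet> d s) has_real_derivative 0) (at s)" for s
      proof -
        let ?y = "R (expc (L' v) s) y"
        have "(d has_vector_derivative bk v ?y - p (bk v ?y)) (at s)"
          unfolding d_def[abs_def]
          by (intro has_vector_derivative_diff expd
              bounded_linear.has_vector_derivative[OF p(1)[unfolded linear_conv_bounded_linear]])
        from bilinear_vector_derivative[of "\<lambda>u v. u \<bullet> v", OF _ _ this this]
        have D: "((\<lambda>s. d s \<bullet> d s) has_real_derivative
            d s \<bullet> (bk v ?y - p (bk v ?y)) + (bk v ?y - p (bk v ?y)) \<bullet> d s) (at s)"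
          by (simp add: bounded_linear.linear[OF bounded_linear_inner_left]
              bounded_linear.linear[OF bounded_linear_inner_right])
        have 1: "d s \<bullet> w = 0" if "w \<in> h" for w unfolding d_def by (rule p(3)[OF that])
        have "bk v ?y = bk v (d s) + bk v (p ?y)" by (simp add: d_def M.br_simps)
        moreover have "d s \<bullet> bk v (d s) = 0" using M.invariant[of v "d s" "d s"] by (simp add: inner_commute)
        ultimately have "d s \<bullet> (bk v ?y - p (bk v ?y)) = 0"
          using 1[OF p(2)] 1[OF h_ideal[OF p(2)]] by (simp add: inner_diff_right inner_add_right)
        then show ?thesis using D by (simp add: inner_commute)
      qed
      then have "d t \<bullet> d t = d 0 \<bullet> d 0" by (intro DERIV_isconst_all) auto
      also have "d 0 \<bullet> d 0 = 0"
      proof -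
        have "d 0 = y - p y" by (simp add: d_def R_one)
        moreover have "(y - p y) \<bullet> (y - p y) = 0" by (rule p(3)) (use y p(2) h in \<open>simp add: subspace_diff\<close>)
        ultimately show ?thesis by simp
      qed
      finally have "R (expc (L' v) t) y = p (R (expc (L' v) t) y)" by (simp add: d_def)
      then show ?thesis using p(2) by metis
    qed
    then show ?thesis by (simp add: K_def)
  qed
  have "closed K"
  proof -
    have "K = (\<Inter>y\<in>h. (\<lambda>a. R a y) -` h)" by (auto simp: K_def)
    moreover have "closed ((\<lambda>a. R a y) -` h)" for y
      using continuous_closed_vimage[OF closed_subspace[OF h], of "\<lambda>a. R a y"] R_cont[of y]
      by (simp add: continuous_on_eq_continuous_at)
    ultimately show ?thesis by (simp add: closed_INT)
  qed
  then have "compact K" using compact_Int_closed[OF compact, of K] by simp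
  moreover have "\<one> \<in> K" by (simp add: K_def R_one)
  moreover have "continuous_on K (\<lambda>a. R a x \<bullet> z1)"
    by (intro continuous_intros continuous_on_subset[OF R_cont]) auto
  ultimately obtain a0 where a0: "a0 \<in> K" "\<And>a. a \<in> K \<Longrightarrow> R a x \<bullet> z1 \<le> R a0 x \<bullet> z1"
    using continuous_attains_sup[of K "\<lambda>a. R a x \<bullet> z1"] by blast
  define V where "V = R a0 x"
  have Vh: "V \<in> h" using a0(1) x(2) by (simp add: V_def K_def)
  \<comment> \<open>The stabiliser contains the one-parameter subgroups, so the maximiser
    \<open>a0\<close> can be moved in every direction \<open>y\<close> without leaving
    \<open>K\<close>.\<close>
  have crit: "bk y V \<bullet> z1 = 0" for y
  proof (rule DERIV_local_max)
    show "((\<lambda>s. R (expc (L' y) s) V \<bullet> z1) has_real_derivative bk y V \<bullet> z1) (at 0)"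
      using bilinear_vector_derivative[of "\<lambda>u v. u \<bullet> v", OF _ _ expd[of y V 0] has_vector_derivative_const]
      by (simp add: R_one bounded_linear.linear[OF bounded_linear_inner_left]
          bounded_linear.linear[OF bounded_linear_inner_right])
    show "(0::real) < 1" by simp
    show "\<forall>s. \<bar>0 - s\<bar> < 1 \<longrightarrow> R (expc (L' y) s) V \<bullet> z1 \<le> R (expc (L' y) 0) V \<bullet> z1"
    proof (intro allI impI)
      fix s :: real
      have "expc (L' y) s \<otimes> a0 \<in> K" using expK[of y s] a0(1) by (simp add: K_def R_mult)
      from a0(2)[OF this] show "R (expc (L' y) s) V \<bullet> z1 \<le> R (expc (L' y) 0) V \<bullet> z1"
        by (simp add: R_mult V_def R_one)
    qed
  qed
  \<comment> \<open>In \<open>crit\<close> the direction \<open>y = bk z1 V\<close> turns the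
    derivative into minus the squared norm of \<open>bk z1 V\<close>.\<close>
  have "bk z1 V \<bullet> bk z1 V = 0"
  proof -
    have "bk z1 V \<bullet> bk z1 V = - (V \<bullet> bk z1 (bk z1 V))" by (rule M.invariant)
    also have "bk z1 (bk z1 V) = - bk (bk z1 V) z1" by (rule M.br_anti)
    also have "- (V \<bullet> - bk (bk z1 V) z1) = - (bk (bk z1 V) V \<bullet> z1)"
      using M.invariant[of "bk z1 V" V z1] by simp
    finally show ?thesis by (simp add: crit)
  qed
  then have "V \<in> M.ker z1 \<inter> h" using Vh by (simp add: M.ker_def)
  from cartan[OF this] obtain c' where c': "\<And>a. form (Ad a (L' V)) (Ad a (L' V)) = c'"
    unfolding constant_length_iff by blast
  \<comment> \<open>\<open>V\<close> is \<open>x\<close> moved by \<open>a0\<close>, so the lengths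
    of \<open>x\<close> at \<open>a\<close> are those of \<open>V\<close> at
    \<open>a \<otimes> inv a0\<close>.\<close>
  have "form (Ad a (L' x)) (Ad a (L' x)) = c'" for a
  proof -
    have "Ad (a \<otimes> inv a0) (L' V) = Ad a (L' x)"
      by (simp add: V_def R_def L'L Ad_mult Ad_inv)
    then show ?thesis using c'[of "a \<otimes> inv a0"] by simp
  qed
  then show ?thesis unfolding x(1) \<Lambda>_ff constant_length_iff by blast
qed

end

theorem corollary2:
  fixes AM :: "('m::{t2_space,second_countable_topology}, 'e::euclidean_space) atlas"
    and g :: "'m \<Rightarrow> 'm tangent \<Rightarrow> 'm tangent \<Rightarrow> real"
    and AG :: "('g::{t2_space,second_countable_topology}, 'd::euclidean_space) atlas"
    and G :: "'g monoid"
    and \<alpha> :: "'g \<Rightarrow> 'm \<Rightarrow> 'm"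
    and k :: nat
    and \<gg> :: "nat \<Rightarrow> 'g vfield set"
    and Z Z0 Z1 :: "'g vfield"
  assumes "smooth_atlas AM" and "riemannian_metric AM g"
    and "compact (UNIV :: 'm set)" and "connected (UNIV :: 'm set)"
    and "lie_group AG G" and "compact (UNIV :: 'g set)"
    and "isometric_action AG G AM g \<alpha>"
    and "faithful_action G UNIV \<alpha>" and "transitive_action G UNIV \<alpha>"
    and "k \<ge> 1"
    and "\<And>i. i \<in> {1..k} \<Longrightarrow> lie_ideal (lie_algebra AG G) (\<gg> i) \<and> simple_lie_algebra (\<gg> i)"
    and "direct_sum (lie_algebra AG G) {0..k} (\<gg>(0 := lie_center (lie_algebra AG G)))"
    and "Z = Z0 + Z1" and "Z0 \<in> lie_center (lie_algebra AG G)" and "Z1 \<in> \<gg> 1" and "Z1 \<noteq> 0"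
    and "killing_field AM g (fundamental_field AG G AM \<alpha> Z)"
    and "constant_length g (fundamental_field AG G AM \<alpha> Z)"
    and "regular_in (\<gg> 1) Z1"
  shows "\<forall>X\<in>\<gg> 1. killing_field AM g (fundamental_field AG G AM \<alpha> X) \<and>
                  constant_length g (fundamental_field AG G AM \<alpha> X)"
proof
  fix X assume X: "X \<in> \<gg> 1"
  have grp: "group G" using assms(5) by (simp add: lie_group_def)
  interpret isometric_lie_action AG G AM g \<alpha>
    by (intro isometric_lie_action.intro lie_grp.intro lie_grp_axioms.intro
        isometric_lie_action_axioms.intro grp assms)
  have ideal: "lie_ideal (lie_algebra AG G) (\<gg> 1)" and simple: "simple_lie_algebra (\<gg> 1)"
    using assms(11)[of 1] \<open>k \<ge> 1\<close> by auto
  have "X \<in> lie_algebra AG G" using ideal X by (auto simp: lie_ideal_def)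
  then obtain \<xi> where "X = lfield \<xi>" by (rule lie_algebra_lfield)
  then have "killing_field AM g (fundamental_field AG G AM \<alpha> X)"
    by (simp add: fundamental_field_lfield killing_ff)
  moreover have "constant_length g (fundamental_field AG G AM \<alpha> X)"
    by (rule simple_ideal_constant_length[OF ideal simple assms(14,15) _ assms(19) X])
      (use assms(13,18) in simp)
  ultimately show "killing_field AM g (fundamental_field AG G AM \<alpha> X) \<and>
      constant_length g (fundamental_field AG G AM \<alpha> X)" by simp
qed

end
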